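(* Let $n\ge 2$ be an integer, let $\mu>0$, and let $1<p<p_S(n+\mu)$. Assume that $f\in H^1(\mathbb{R}^n)$ and $g\in L^2(\mathbb{R}^n)$ are both nonnegative and do not vanish identically. Let $R\ge 1$. Then there exist a constant $\varepsilon_0=\varepsilon_0(f,g,n,p,\mu,R)>0$ and a positive constant $C$ independent of $\varepsilon$ such that the following holds for every $\varepsilon$ with $0<\varepsilon\le\varepsilon_0$: if $u$ is an energy solution on $[0,T)$ of the initial value problem $$u_{tt}-\Delta u+\frac{\mu}{1+t}u_t=|u|^p \ \text{ in } \mathbb{R}^n\times[0,\infty),\qquad u(x,0)=\varepsilon f(x),\quad u_t(x,0)=\varepsilon g(x),\quad x\in\mathbb{R}^n,$$ satisfying $$\operatorname{supp} u\subset\{(x,t)\in\mathbb{R}^n\times[0,T): |x|\le t+R\},$$ then $T$ has to satisfy $$T\le C\,\varepsilon^{-2p(p-1)/\gamma(p,n+\mu)}.$$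
   Context: For real $d>1$ and $p>1$ set $$\gamma(p,d):=2+(d+1)p-(d-1)p^2,$$ and let $$p_S(d):=\frac{d+1+\sqrt{d^2+10d-7}}{2(d-1)}$$ be the positive root of the quadratic equation $\gamma(p,d)=0$ in $p$ (the Strauss exponent). In the theorem, $p_S$ and $\gamma(p,\cdot)$ are evaluated at the real number $d=n+\mu$. Energy solution: $u$ is an energy solution of the initial value problem on $[0,T)$ if $$u\in C([0,T),H^1(\mathbb{R}^n))\cap C^1([0,T),L^2(\mathbb{R}^n))\cap L^p_{loc}(\mathbb{R}^n\times[0,T)),$$ the initial conditions $u(\cdot,0)=\varepsilon f$, $u_t(\cdot,0)=\varepsilon g$ hold, and $$\int_{\mathbb{R}^n}u_t(x,t)\phi(x,t)\,dx-\int_{\mathbb{R}^n}u_t(x,0)\phi(x,0)\,dx+\int_0^t ds\int_{\mathbb{R}^n}\{-u_t(x,s)\phi_t(x,s)+\nabla u(x,s)\cdot\nabla\phi(x,s)\}\,dx$$ $$+\int_0^t ds\int_{\mathbb{R}^n}\frac{\mu\,u_t(x,s)}{1+s}\phi(x,s)\,dx=\int_0^t ds\int_{\mathbb{R}^n}|u(x,s)|^p\phi(x,s)\,dx$$ for every $\phi\in C_0^\infty(\mathbb{R}^n\times[0,T))$ and every $t\in[0,T)$. *)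

theory Defs
  imports "HOL-Analysis.Analysis"
begin

definition strauss_gamma :: "real \<Rightarrow> real \<Rightarrow> real" where
  "strauss_gamma p d = 2 + (d + 1) * p - (d - 1) * p\<^sup>2"

definition strauss_exponent :: "real \<Rightarrow> real" where
  "strauss_exponent d = (d + 1 + sqrt (d\<^sup>2 + 10 * d - 7)) / (2 * (d - 1))"

(* Derivatives are taken within S. They are one-sided at boundary points, as needed for
   smoothness up to t = 0 on the half-open cylinders below; for S = UNIV and for the convex
   sets with nonempty interior used here the derivative within S is unique. *)
primrec Ck_on :: "nat \<Rightarrow> 'a::euclidean_space set \<Rightarrow> ('a \<Rightarrow> real) \<Rightarrow> bool" where
  "Ck_on 0 S \<phi> \<longleftrightarrow> continuous_on S \<phi>"
| "Ck_on (Suc k) S \<phi> \<longleftrightarrow> \<phi> differentiable_on S \<and>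
     (\<forall>v. Ck_on k S (\<lambda>z. frechet_derivative \<phi> (at z within S) v))"

definition smooth_on :: "'a::euclidean_space set \<Rightarrow> ('a \<Rightarrow> real) \<Rightarrow> bool" where
  "smooth_on S \<phi> \<longleftrightarrow> (\<forall>k. Ck_on k S \<phi>)"

(* C_0^infinity(S). The support must lie in S itself, so on R^n x [0,T) a test function
   vanishes near t = T but not necessarily at t = 0. Values outside S are irrelevant. *)
definition test_function :: "'a::euclidean_space set \<Rightarrow> ('a \<Rightarrow> real) \<Rightarrow> bool" where
  "test_function S \<phi> \<longleftrightarrow> smooth_on S \<phi> \<and>
     compact (closure {z \<in> S. \<phi> z \<noteq> 0}) \<and> closure {z \<in> S. \<phi> z \<noteq> 0} \<subseteq> S"

(* Elements of L^2 and H^1 are represented by Borel functions; equality of such elements is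
   always expressed as equality almost everywhere. *)
definition L2 :: "('a::euclidean_space \<Rightarrow> 'b::euclidean_space) set" where
  "L2 = {f \<in> borel_measurable lborel. integrable lborel (\<lambda>x. (norm (f x))\<^sup>2)}"

definition L2_norm :: "('a::euclidean_space \<Rightarrow> 'b::euclidean_space) \<Rightarrow> real" where
  "L2_norm f = sqrt (LINT x|lborel. (norm (f x))\<^sup>2)"

definition is_weak_gradient ::
  "('a::euclidean_space \<Rightarrow> real) \<Rightarrow> ('a \<Rightarrow> 'a) \<Rightarrow> bool" where
  "is_weak_gradient f G \<longleftrightarrow> (\<forall>\<psi>. test_function UNIV \<psi> \<longrightarrow>
     (\<forall>b\<in>Basis. (LINT x|lborel. f x * frechet_derivative \<psi> (at x) b)
               = - (LINT x|lborel. (G x \<bullet> b) * \<psi> x)))"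

definition H1 :: "('a::euclidean_space \<Rightarrow> real) set" where
  "H1 = {f \<in> L2. \<exists>G\<in>L2. is_weak_gradient f G}"

(* For f in H1 this is determined up to a null set. *)
definition weak_gradient :: "('a::euclidean_space \<Rightarrow> real) \<Rightarrow> 'a \<Rightarrow> 'a" where
  "weak_gradient f = (SOME G. G \<in> L2 \<and> is_weak_gradient f G)"

definition H1_norm :: "('a::euclidean_space \<Rightarrow> real) \<Rightarrow> real" where
  "H1_norm f = sqrt ((L2_norm f)\<^sup>2 + (L2_norm (weak_gradient f))\<^sup>2)"

definition C_H1 :: "real set \<Rightarrow> (real \<Rightarrow> 'a::euclidean_space \<Rightarrow> real) \<Rightarrow> bool" where
  "C_H1 I U \<longleftrightarrow> (\<forall>t\<in>I. U t \<in> H1 \<and>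
     ((\<lambda>s. H1_norm (\<lambda>x. U s x - U t x)) \<longlongrightarrow> 0) (at t within I))"

definition C_L2 :: "real set \<Rightarrow> (real \<Rightarrow> 'a::euclidean_space \<Rightarrow> real) \<Rightarrow> bool" where
  "C_L2 I U \<longleftrightarrow> (\<forall>t\<in>I. U t \<in> L2 \<and>
     ((\<lambda>s. L2_norm (\<lambda>x. U s x - U t x)) \<longlongrightarrow> 0) (at t within I))"

(* U belongs to C^1(I, L^2), with derivative V. *)
definition C1_L2_deriv ::
  "real set \<Rightarrow> (real \<Rightarrow> 'a::euclidean_space \<Rightarrow> real) \<Rightarrow> (real \<Rightarrow> 'a \<Rightarrow> real) \<Rightarrow> bool" where
  "C1_L2_deriv I U V \<longleftrightarrow> C_L2 I U \<and> C_L2 I V \<and>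
     (\<forall>t\<in>I. ((\<lambda>s. L2_norm (\<lambda>x. (U s x - U t x) / (s - t) - V t x)) \<longlongrightarrow> 0) (at t within I))"

definition Lp_loc :: "real \<Rightarrow> 'a::euclidean_space set \<Rightarrow> ('a \<Rightarrow> real) \<Rightarrow> bool" where
  "Lp_loc p S u \<longleftrightarrow> set_borel_measurable lborel S u \<and>
     (\<forall>K. compact K \<longrightarrow> K \<subseteq> S \<longrightarrow> set_integrable lborel K (\<lambda>z. \<bar>u z\<bar> powr p))"

(* Support relative to S of an almost-everywhere class: the complement in S of the largest
   relatively open subset of S on which u vanishes almost everywhere. *)
definition ess_support :: "'a::euclidean_space set \<Rightarrow> ('a \<Rightarrow> real) \<Rightarrow> 'a set" where
  "ess_support S u =
     {z \<in> S. \<forall>W. open W \<longrightarrow> z \<in> W \<longrightarrow> \<not> (AE w in lborel. w \<in> W \<inter> S \<longrightarrow> u w = 0)}"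

(* The interval [0,T), where T may be infinite. *)
definition time_interval :: "ereal \<Rightarrow> real set" where
  "time_interval T = {t. 0 \<le> t \<and> ereal t < T}"

definition space_time :: "ereal \<Rightarrow> ('a::euclidean_space \<times> real) set" where
  "space_time T = UNIV \<times> time_interval T"

definition time_deriv ::
  "ereal \<Rightarrow> ('a::euclidean_space \<times> real \<Rightarrow> real) \<Rightarrow> 'a \<times> real \<Rightarrow> real" where
  "time_deriv T \<phi> z = frechet_derivative \<phi> (at z within space_time T) (0, 1)"

definition space_grad ::
  "ereal \<Rightarrow> ('a::euclidean_space \<times> real \<Rightarrow> real) \<Rightarrow> 'a \<times> real \<Rightarrow> 'a" where
  "space_grad T \<phi> z =
     (\<Sum>b\<in>Basis. frechet_derivative \<phi> (at z within space_time T) (b, 0) *\<^sub>R b)"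

(* u is a jointly Borel representative (through Lp_loc) whose time slices are elements of H1;
   every function of the stated regularity class has one. The function ut is the L^2-valued
   time derivative, whose slices are unique up to null sets. *)
definition energy_solution ::
  "real \<Rightarrow> real \<Rightarrow> real \<Rightarrow> ('a::euclidean_space \<Rightarrow> real) \<Rightarrow> ('a \<Rightarrow> real) \<Rightarrow> ereal \<Rightarrow>
   ('a \<times> real \<Rightarrow> real) \<Rightarrow> bool" where
  "energy_solution \<mu> p \<epsilon> f g T u \<longleftrightarrow>
     C_H1 (time_interval T) (\<lambda>t x. u (x, t)) \<and>
     Lp_loc p (space_time T) u \<and>
     (\<exists>ut. C1_L2_deriv (time_interval T) (\<lambda>t x. u (x, t)) ut \<and>
        (AE x in lborel. u (x, 0) = \<epsilon> * f x) \<and>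
        (AE x in lborel. ut 0 x = \<epsilon> * g x) \<and>
        (\<forall>\<phi>. test_function (space_time T) \<phi> \<longrightarrow> (\<forall>t\<in>time_interval T.
            (LINT x|lborel. ut t x * \<phi> (x, t))
          - (LINT x|lborel. ut 0 x * \<phi> (x, 0))
          + (LINT s:{0..t}|lborel. (LINT x|lborel.
                - ut s x * time_deriv T \<phi> (x, s)
                + weak_gradient (\<lambda>y. u (y, s)) x \<bullet> space_grad T \<phi> (x, s)))
          + (LINT s:{0..t}|lborel. (LINT x|lborel. \<mu> * ut s x / (1 + s) * \<phi> (x, s)))
          = (LINT s:{0..t}|lborel. (LINT x|lborel. \<bar>u (x, s)\<bar> powr p * \<phi> (x, s))))))"

end

theory Submission
  imports Defs "HOL-Probability.Distributions"
begin

text \<open>Write \<open>N\<close> for the dimension. Testing with 1 shows that \<open>F = \<integral>u\<close> solves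
  \<open>F'' + \<mu>/(1+t) F' = \<integral>\<bar>u\<bar> powr p\<close>. Hoelder's inequality on the ball of radius \<open>t + R\<close> bounds
  the right-hand side below by a multiple of \<open>(1+t) powr (-N (p-1)) * F powr p\<close>. A second lower bound
  comes from a positive solution of \<open>\<Delta>\<phi> = \<phi>\<close> of size \<open>exp \<bar>x\<bar> * (1+\<bar>x\<bar>) powr (-(N-1)/2)\<close>: then
  \<open>G = \<integral>u\<phi>\<close> satisfies \<open>G'' + \<mu>/(1+t) G' - G \<ge> 0\<close> and, by comparison with an explicit subsolution
  (which avoids modified Bessel functions), \<open>G\<close> is at least a multiple of
  \<open>\<epsilon> * exp t * (1+t) powr (-\<mu>/2)\<close>. Hoelder's inequality against the \<open>L\<^sup>q\<close>-norm of \<open>\<phi>\<close>,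
  \<open>q = p/(p-1)\<close>, bounds \<open>\<integral>\<bar>u\<bar> powr p\<close> below by a multiple of
  \<open>\<epsilon> powr p * (1+t) powr (N - 1 - (N + \<mu> - 1) p/2)\<close>. Integrating this twice and then iterating the
  first bound on \<open>{E/2..E}\<close> makes \<open>F E\<close> exceed every bound as soon as
  \<open>E powr (\<gamma>/2) * \<epsilon> powr (p (p-1))\<close> is large.\<close>

section \<open>Smooth functions and cutoffs\<close>

text \<open>The damping enters twice. The integrating factor (1+t)^\<mu> absorbs it, so that F''
  never has to appear; and it costs G a factor (1+t)^(-\<mu>/2), which turns N - 1 into N + \<mu> -
  1 in the second lower bound. This is why \<gamma> is evaluated at N + \<mu>. The obstacle is low
  regularity: u_tt is not given as a function, |u|^p is known to be integrable only on compact sets,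
  its slices only for almost every time, and the support condition says nothing about a single time.
  Hence the identities are used in once-integrated form, obtained from test functions lam(t) a(x);
  bounds on the nonlinear term hold for almost every time; and the support of each slice is
  recovered from continuity in L^2. Smallness of \<epsilon> enters only as \<epsilon> \<le> 1. Since
  test functions live on a cylinder that contains its face t = 0, smoothness is developed for
  derivatives within a set.\<close>

definition derivative_domain :: "'a::euclidean_space set \<Rightarrow> bool" where
  "derivative_domain S \<longleftrightarrow>
     (\<forall>x\<in>S. \<forall>i\<in>Basis. \<forall>e>0. \<exists>d. 0 < \<bar>d\<bar> \<and> \<bar>d\<bar> < e \<and> x + d *\<^sub>R i \<in> S)"

lemma derivative_domain_open:
  assumes "open S" shows "derivative_domain S"
  unfolding derivative_domain_def
proof (intro ballI allI impI)
  fix x and i :: 'a and e :: real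
  assume x: "x \<in> S" "i \<in> Basis" "e > 0"
  obtain r where r: "r > 0" "ball x r \<subseteq> S" using assms x open_contains_ball by blast
  have "x + (min r e / 2) *\<^sub>R i \<in> ball x r"
    using x r by (auto simp: dist_norm)
  then show "\<exists>d. 0 < \<bar>d\<bar> \<and> \<bar>d\<bar> < e \<and> x + d *\<^sub>R i \<in> S"
    using r x by (intro exI[of _ "min r e / 2"]) auto
qed

lemma derivative_domain_UNIV: "derivative_domain UNIV"
  by (rule derivative_domain_open) simp

text \<open>The derivative within \<open>S\<close> is unique as soon as every point is approached
  within \<open>S\<close> along each coordinate line. \<open>derivative_domain\<close> asks for just
  this and leaves the side of approach free, so that the face t = 0 of a cylinder qualifies.\<close>

lemma frechet_derivative_within_eq:
  assumes "derivative_domain S" "z \<in> S" "(f has_derivative D) (at z within S)"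
  shows "frechet_derivative f (at z within S) = D"
proof -
  have "(f has_derivative frechet_derivative f (at z within S)) (at z within S)"
    using assms(3) by (metis differentiableI frechet_derivative_works)
  then show ?thesis
    by (rule frechet_derivative_unique_within[OF _ assms(3)])
       (use assms in \<open>auto simp: derivative_domain_def\<close>)
qed

lemma frechet_derivative_within_cong:
  assumes "\<And>z. z \<in> S \<Longrightarrow> f z = g z" "z \<in> S"
  shows "frechet_derivative f (at z within S) = frechet_derivative g (at z within S)"
proof -
  have "(f has_derivative D) (at z within S) \<longleftrightarrow> (g has_derivative D) (at z within S)" for D
    using has_derivative_transform[of z S f g D] has_derivative_transform[of z S g f D] assms by auto
  then show ?thesis by (simp add: frechet_derivative_def)
qed

lemma Ck_on_cong:
  assumes "\<And>z. z \<in> S \<Longrightarrow> f z = g z"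
  shows "Ck_on k S f \<longleftrightarrow> Ck_on k S g"
  using assms
proof (induction k arbitrary: f g)
  case 0 then show ?case by (auto cong: continuous_on_cong)
next
  case (Suc k)
  have "f differentiable_on S \<longleftrightarrow> g differentiable_on S"
    using differentiable_transform_within[OF _ zero_less_one, of f _ S g]
      differentiable_transform_within[OF _ zero_less_one, of g _ S f] Suc.prems
    unfolding differentiable_on_def by auto
  moreover have "Ck_on k S (\<lambda>z. frechet_derivative f (at z within S) v)
      \<longleftrightarrow> Ck_on k S (\<lambda>z. frechet_derivative g (at z within S) v)" for v
    by (rule Suc.IH) (metis frechet_derivative_within_cong[of S f g] Suc.prems)
  ultimately show ?case by simp
qed

lemma Ck_on_SucI:
  assumes "derivative_domain S"
    and "\<And>z. z \<in> S \<Longrightarrow> (f has_derivative D z) (at z within S)"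
    and "\<And>v. Ck_on k S (\<lambda>z. D z v)"
  shows "Ck_on (Suc k) S f"
proof -
  have "Ck_on k S (\<lambda>z. frechet_derivative f (at z within S) v)" for v
    using assms(3)[of v] frechet_derivative_within_eq[OF assms(1) _ assms(2)]
    by (subst Ck_on_cong[where g = "\<lambda>z. D z v"]) auto
  then show ?thesis using assms(2) by (auto simp: differentiable_on_def differentiable_def)
qed

lemma Ck_on_has_derivative:
  "Ck_on (Suc k) S f \<Longrightarrow> z \<in> S \<Longrightarrow>
     (f has_derivative frechet_derivative f (at z within S)) (at z within S)"
  by (auto simp: differentiable_on_def frechet_derivative_works)

lemma Ck_on_SucD: "Ck_on (Suc k) S f \<Longrightarrow> Ck_on k S f"
proof (induction k arbitrary: f)
  case 0 then show ?case by (auto intro: differentiable_imp_continuous_on)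
next
  case (Suc k) then show ?case by auto
qed

lemma Ck_on_const:
  assumes "derivative_domain S" shows "Ck_on k S (\<lambda>z. c)"
proof (induction k arbitrary: c)
  case 0 show ?case by simp
next
  case (Suc k)
  show ?case by (rule Ck_on_SucI[OF assms, of _ "\<lambda>_ _. 0"]) (auto intro: Suc)
qed

lemma Ck_on_linear:
  assumes "derivative_domain S" "bounded_linear L" shows "Ck_on k S L"
proof (cases k)
  case 0 then show ?thesis using assms(2)
    by (auto intro: linear_continuous_on)
next
  case (Suc j)
  have "(L has_derivative L) (at z within S)" for z
    using assms(2) by (rule bounded_linear_imp_has_derivative)
  then show ?thesis unfolding Suc
    by (intro Ck_on_SucI[OF assms(1), of _ "\<lambda>z. L"] Ck_on_const[OF assms(1)])
qed

lemma Ck_on_add: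
  assumes S: "derivative_domain S" and "Ck_on k S f" "Ck_on k S g"
  shows "Ck_on k S (\<lambda>z. f z + g z)"
  using assms(2,3)
proof (induction k arbitrary: f g)
  case 0 then show ?case by (auto intro: continuous_intros)
next
  case (Suc k)
  have "Ck_on k S (\<lambda>z. frechet_derivative f (at z within S) v + frechet_derivative g (at z within S) v)" for v
    using Suc by auto
  then show ?case
    by (intro Ck_on_SucI[OF S, of _ "\<lambda>z v. frechet_derivative f (at z within S) v + frechet_derivative g (at z within S) v"]
        has_derivative_add Ck_on_has_derivative[OF Suc.prems(1)] Ck_on_has_derivative[OF Suc.prems(2)])
qed

lemma Ck_on_mult:
  assumes S: "derivative_domain S" and "Ck_on k S f" "Ck_on k S g"
  shows "Ck_on k S (\<lambda>z. f z * g z)"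
  using assms(2,3)
proof (induction k arbitrary: f g)
  case 0 then show ?case by (auto intro: continuous_intros)
next
  case (Suc k)
  have "Ck_on k S (\<lambda>z. f z * frechet_derivative g (at z within S) v
      + frechet_derivative f (at z within S) v * g z)" for v
    using Suc Ck_on_SucD[of k S f] Ck_on_SucD[of k S g] by (intro Ck_on_add[OF S]) auto
  then show ?case
    by (intro Ck_on_SucI[OF S, of _ "\<lambda>z v. f z * frechet_derivative g (at z within S) v
      + frechet_derivative f (at z within S) v * g z"]
        has_derivative_mult Ck_on_has_derivative[OF Suc.prems(1)] Ck_on_has_derivative[OF Suc.prems(2)])
qed

text \<open>The induction varies \<open>h\<close> but not \<open>g\<close>: the derivative of h(g)
  is h'(g) times that of g, so the hypothesis is applied to h' and to the same inner function,
  lowered by one degree of smoothness.\<close>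

lemma Ck_on_compose:
  fixes h :: "real \<Rightarrow> real"
  assumes S: "derivative_domain S" and V: "open V" and gS: "\<And>z. z \<in> S \<Longrightarrow> g z \<in> V"
    and "Ck_on k V h" "Ck_on k S g"
  shows "Ck_on k S (\<lambda>z. h (g z))"
  using assms(4,5)
proof (induction k arbitrary: h)
  case 0 then show ?case using gS
    by (auto intro!: continuous_on_compose2[of V h])
next
  case (Suc k)
  define h' where "h' x = frechet_derivative h (at x within V) 1" for x
  have h': "Ck_on k V h'" using Suc.prems(1) by (auto simp: h'_def[abs_def])
  have hd: "(h has_derivative (\<lambda>y. h' x * y)) (at x)" if "x \<in> V" for x
  proof -
    have d: "(h has_derivative frechet_derivative h (at x within V)) (at x)"
      using Ck_on_has_derivative[OF Suc.prems(1) that] at_within_open[OF that V] by simp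
    have "linear (frechet_derivative h (at x within V))"
      using d has_derivative_linear by blast
    then have "frechet_derivative h (at x within V) y = h' x * y" for y
      unfolding h'_def using linear_cmul[of "frechet_derivative h (at x within V)" y 1]
      by (simp add: mult.commute)
    then have "frechet_derivative h (at x within V) = (\<lambda>y. h' x * y)" by (rule ext)
    with d show ?thesis by metis
  qed
  show ?case
  proof (rule Ck_on_SucI[OF S, of _ "\<lambda>z v. h' (g z) * frechet_derivative g (at z within S) v"])
    show "((\<lambda>z. h (g z)) has_derivative (\<lambda>v. h' (g z) * frechet_derivative g (at z within S) v)) (at z within S)"
      if "z \<in> S" for z
      using has_derivative_compose[OF Ck_on_has_derivative[OF Suc.prems(2) that] hd[OF gS[OF that]]] .
    show "Ck_on k S (\<lambda>z. h' (g z) * frechet_derivative g (at z within S) v)" for v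
      using Suc.prems(2) by (intro Ck_on_mult[OF S] Suc.IH[OF h' Ck_on_SucD]) auto
  qed
qed

lemma smooth_on_compose:
  fixes h :: "real \<Rightarrow> real"
  assumes "derivative_domain S" "open V" "\<And>z. z \<in> S \<Longrightarrow> g z \<in> V" "smooth_on V h" "smooth_on S g"
  shows "smooth_on S (\<lambda>z. h (g z))"
  using assms Ck_on_compose[where S = S and V = V and g = g and h = h] unfolding smooth_on_def by blast

lemma smooth_on_mult:
  "derivative_domain S \<Longrightarrow> smooth_on S f \<Longrightarrow> smooth_on S g \<Longrightarrow> smooth_on S (\<lambda>z. f z * g z)"
  by (auto simp: smooth_on_def intro: Ck_on_mult)

lemma smooth_on_add:
  "derivative_domain S \<Longrightarrow> smooth_on S f \<Longrightarrow> smooth_on S g \<Longrightarrow> smooth_on S (\<lambda>z. f z + g z)"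
  by (auto simp: smooth_on_def intro: Ck_on_add)

lemma smooth_on_const: "derivative_domain S \<Longrightarrow> smooth_on S (\<lambda>z. c)"
  by (auto simp: smooth_on_def intro: Ck_on_const)

lemma smooth_on_linear: "derivative_domain S \<Longrightarrow> bounded_linear L \<Longrightarrow> smooth_on S L"
  by (auto simp: smooth_on_def intro: Ck_on_linear)

lemma smooth_on_diff:
  assumes "derivative_domain S" "smooth_on S f" "smooth_on S g"
  shows "smooth_on S (\<lambda>z. f z - g z)"
proof -
  have "smooth_on S (\<lambda>z. f z + (- 1) * g z)"
    using assms by (intro smooth_on_add smooth_on_mult smooth_on_const)
  then show ?thesis by simp
qed

lemma smooth_on_sum:
  assumes "derivative_domain S" "finite I" "\<And>i. i \<in> I \<Longrightarrow> smooth_on S (f i)"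
  shows "smooth_on S (\<lambda>z. \<Sum>i\<in>I. f i z)"
  using assms(2,3) by (induction rule: finite_induct)
    (auto intro: smooth_on_const smooth_on_add assms(1))

lemma smooth_on_imp_continuous_on: "smooth_on S f \<Longrightarrow> continuous_on S f"
  unfolding smooth_on_def using Ck_on.simps(1) by blast

lemma smooth_on_has_derivative:
  "smooth_on S f \<Longrightarrow> z \<in> S \<Longrightarrow>
     (f has_derivative frechet_derivative f (at z within S)) (at z within S)"
  unfolding smooth_on_def using Ck_on_has_derivative by blast

lemma smooth_on_frechet_derivative:
  assumes "smooth_on S f" shows "smooth_on S (\<lambda>z. frechet_derivative f (at z within S) v)"
  unfolding smooth_on_def
proof
  fix k show "Ck_on k S (\<lambda>z. frechet_derivative f (at z within S) v)"
    using assms[unfolded smooth_on_def, rule_format, of "Suc k"] by simp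
qed

text \<open>If every directional derivative of a member is again a member, the C^k induction runs
  through the whole family at once. \<open>N i v\<close> is the index of the derivative of
  \<open>H i\<close> in direction \<open>v\<close>. Exponentials, powers, the averages
  \<open>dir_exp\<close> and pullbacks along \<open>fst\<close> are all handled this way.\<close>

lemma smooth_on_deriv_family:
  fixes H :: "'i \<Rightarrow> 'a::euclidean_space \<Rightarrow> real"
  assumes S: "derivative_domain S"
    and "\<And>i z. i \<in> J \<Longrightarrow> z \<in> S \<Longrightarrow> (H i has_derivative (\<lambda>v. H (N i v) z)) (at z within S)"
    and N: "\<And>i v. i \<in> J \<Longrightarrow> N i v \<in> J"
    and "i \<in> J"
  shows "smooth_on S (H i)"
proof -
  have "Ck_on k S (H i)" for k
    using \<open>i \<in> J\<close>
  proof (induction k arbitrary: i)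
    case 0
    show ?case using has_derivative_continuous_on[OF assms(2)[OF 0]] by simp
  next
    case (Suc k)
    show ?case
      by (rule Ck_on_SucI[OF S assms(2)[OF Suc.prems]]) (use Suc N in auto)
  qed
  then show ?thesis by (simp add: smooth_on_def)
qed

lemma smooth_on_exp: "smooth_on UNIV (exp :: real \<Rightarrow> real)"
proof -
  have "smooth_on UNIV (\<lambda>x. c * exp (x::real))" for c
    by (rule smooth_on_deriv_family[where J = UNIV and H = "\<lambda>c x. c * exp x" and N = "\<lambda>c v. c * v"])
       (auto intro!: derivative_eq_intros derivative_domain_open)
  from this[of 1] show ?thesis by simp
qed

lemma smooth_on_powr: "smooth_on {0<..} (\<lambda>x::real. x powr a)"
proof -
  have D: "derivative_domain {0::real<..}" by (rule derivative_domain_open) auto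
  have "smooth_on {0<..} ((\<lambda>(c, a) x. c * x powr a) (1::real, a))"
  proof (rule smooth_on_deriv_family[OF D, where J = UNIV and H = "\<lambda>(c, a) x. c * x powr a" and N = "\<lambda>(c, a) v. (c * a * v, a - 1)"]; (clarsimp)?)
    fix c a :: real and x :: real assume x: "0 < x"
    have "((\<lambda>x. c * x powr a) has_real_derivative c * (a * x powr (a - 1))) (at x)"
      using x by (auto intro!: derivative_eq_intros simp: powr_diff)
    then have "((\<lambda>x. c * x powr a) has_derivative (\<lambda>v. c * a * v * x powr (a - 1))) (at x)"
      by (auto simp: has_field_derivative_def mult_ac elim!: has_derivative_eq_rhs)
    then show "((\<lambda>x. c * x powr a) has_derivative (\<lambda>v. c * a * v * x powr (a - 1))) (at x within {0<..})"
      by (rule has_derivative_at_withinI)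
  qed
  then show ?thesis by simp
qed

lemma smooth_on_inverse: "smooth_on {0<..} (\<lambda>x::real. inverse x)"
proof -
  have "smooth_on {0<..} (\<lambda>x::real. x powr (-1))" by (rule smooth_on_powr)
  moreover have "Ck_on k {0<..} (\<lambda>x::real. x powr (-1)) = Ck_on k {0<..} (\<lambda>x::real. inverse x)" for k
    by (rule Ck_on_cong) (auto simp: powr_minus)
  ultimately show ?thesis by (simp add: smooth_on_def)
qed

section \<open>Bump functions built from exp (-1/x), and radial cutoffs\<close>

definition flat_exp :: "nat \<Rightarrow> real \<Rightarrow> real" where
  "flat_exp j x = (if x > 0 then exp (- 1 / x) / x ^ j else 0)"

lemma flat_exp_tendsto: "(flat_exp j \<longlongrightarrow> 0) (at 0)"
proof -
  have "(flat_exp j \<longlongrightarrow> 0) (at_right 0)"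
  proof -
    have "((\<lambda>y. y ^ j / exp y) \<longlongrightarrow> 0) (at_top :: real filter)"
      by (rule tendsto_power_div_exp_0)
    then have "((\<lambda>x. (inverse x) ^ j / exp (inverse x)) \<longlongrightarrow> 0) (at_right (0::real))"
      using filterlim_inverse_at_top_right by (rule filterlim_compose)
    moreover have "\<forall>\<^sub>F x in at_right 0. (inverse x) ^ j / exp (inverse x) = flat_exp j x"
      by (auto simp: eventually_at_filter flat_exp_def exp_minus field_simps power_inverse)
    ultimately show ?thesis by (rule Lim_transform_eventually)
  qed
  moreover have "(flat_exp j \<longlongrightarrow> 0) (at_left 0)"
    by (rule Lim_transform_eventually[of "\<lambda>_. 0"]) (auto simp: eventually_at_filter flat_exp_def)
  ultimately show ?thesis by (simp add: filterlim_split_at)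
qed

text \<open>The powers of x in the denominator make the family closed under differentiation: the
  derivative of member j combines the members j + 2 and j + 1. At 0 the difference quotient of
  member j is member j + 1, which tends to 0.\<close>

lemma flat_exp_deriv:
  "(flat_exp j has_real_derivative flat_exp (j + 2) x - real j * flat_exp (j + 1) x) (at x)"
proof (cases x "0::real" rule: linorder_cases)
  case less
  have "(flat_exp j has_real_derivative 0) (at x)"
    by (rule has_field_derivative_transform_within_open[where f = "\<lambda>_. 0" and S = "{..<0}"])
       (use less in \<open>auto simp: flat_exp_def\<close>)
  then show ?thesis using less by (simp add: flat_exp_def)
next
  case equal
  have "((\<lambda>y. (flat_exp j y - flat_exp j 0) / (y - 0)) \<longlongrightarrow> 0) (at 0)"
    by (rule Lim_transform_eventually[OF flat_exp_tendsto[of "j + 1"]])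
       (auto simp: eventually_at_filter flat_exp_def)
  then show ?thesis using equal by (simp add: has_field_derivative_iff flat_exp_def)
next
  case greater
  have "((\<lambda>x. exp (- 1 / x) / x ^ j) has_real_derivative flat_exp (j + 2) x - real j * flat_exp (j + 1) x) (at x)"
    using greater
    apply (auto intro!: derivative_eq_intros simp: flat_exp_def)
    apply (cases j; simp add: field_simps power2_eq_square)
    done
  then show ?thesis
    by (rule has_field_derivative_transform_within_open[where S = "{0<..}"])
       (use greater in \<open>auto simp: flat_exp_def\<close>)
qed

lemma Ck_on_flat_exp: "Ck_on k UNIV (flat_exp j)"
proof (induction k arbitrary: j)
  case 0
  show ?case using flat_exp_deriv by (auto intro!: DERIV_continuous_on)
next
  case (Suc k)
  note U = derivative_domain_UNIV[where 'a = real]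
  show ?case
  proof (rule Ck_on_SucI[OF U, of _ "\<lambda>x v. (flat_exp (j + 2) x + (- real j) * flat_exp (j + 1) x) * v"])
    show "Ck_on k UNIV (\<lambda>x. (flat_exp (j + 2) x + (- real j) * flat_exp (j + 1) x) * v)" for v
      by (intro Ck_on_mult Ck_on_add Ck_on_const Suc U)
  qed (use flat_exp_deriv[of j] in \<open>auto simp: has_field_derivative_def\<close>)
qed

definition smooth_step :: "real \<Rightarrow> real" where
  "smooth_step s = flat_exp 0 s * inverse (flat_exp 0 s + flat_exp 0 (1 - s))"

lemma smooth_on_smooth_step: "smooth_on UNIV smooth_step"
proof -
  note U = derivative_domain_UNIV[where 'a = real]
  have f: "smooth_on UNIV (flat_exp 0)" using Ck_on_flat_exp by (simp add: smooth_on_def)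
  \<comment> \<open>At least one of s and 1 - s is positive, so the denominator never
    vanishes.\<close>
  have pos: "flat_exp 0 s + flat_exp 0 (1 - s) > 0" for s by (auto simp: flat_exp_def add_pos_pos)
  have "smooth_on UNIV (\<lambda>s. 1 - s :: real)"
    by (intro smooth_on_diff smooth_on_const smooth_on_linear bounded_linear_ident U)
  then have "smooth_on UNIV (\<lambda>s. flat_exp 0 (1 - s))"
    by (rule smooth_on_compose[OF U open_UNIV UNIV_I f])
  then have "smooth_on UNIV (\<lambda>s. flat_exp 0 s + flat_exp 0 (1 - s))"
    using f by (intro smooth_on_add U)
  then have "smooth_on UNIV (\<lambda>s. inverse (flat_exp 0 s + flat_exp 0 (1 - s)))"
    by (intro smooth_on_compose[OF U _ _ smooth_on_inverse]) (use pos in auto)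
  then show ?thesis unfolding smooth_step_def[abs_def] using f by (intro smooth_on_mult U)
qed

lemma smooth_step_eq_0: "s \<le> 0 \<Longrightarrow> smooth_step s = 0"
  and smooth_step_eq_1: "s \<ge> 1 \<Longrightarrow> smooth_step s = 1"
  and smooth_step_nonneg: "smooth_step s \<ge> 0"
  by (auto simp: smooth_step_def flat_exp_def)

lemma smooth_on_inner: "smooth_on UNIV (\<lambda>x::'a::euclidean_space. x \<bullet> x)"
proof -
  have "smooth_on UNIV (\<lambda>x::'a. \<Sum>b\<in>Basis. (x \<bullet> b) * (x \<bullet> b))"
    by (intro smooth_on_sum smooth_on_mult smooth_on_linear bounded_linear_inner_left
        derivative_domain_UNIV finite_Basis)
  moreover have "(\<lambda>x::'a. \<Sum>b\<in>Basis. (x \<bullet> b) * (x \<bullet> b)) = (\<lambda>x. x \<bullet> x)"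
    by (auto simp: fun_eq_iff euclidean_inner[symmetric])
  ultimately show ?thesis by simp
qed

text \<open>The step is applied to a function of \<open>x \<bullet> x\<close> because the norm is
  not smooth at the origin. For \<rho> \<ge> 0 the value 1 is kept up to radius \<rho> + 1, so that
  on the closed ball of radius \<rho> derivatives are unaffected as well.\<close>

definition ball_cutoff :: "real \<Rightarrow> 'a::euclidean_space \<Rightarrow> real" where
  "ball_cutoff \<rho> x = smooth_step ((\<rho> + 2)\<^sup>2 - x \<bullet> x)"

lemma smooth_on_ball_cutoff: "smooth_on UNIV (ball_cutoff \<rho>)"
  unfolding ball_cutoff_def[abs_def]
  by (rule smooth_on_compose[OF derivative_domain_UNIV open_UNIV UNIV_I smooth_on_smooth_step])
     (intro smooth_on_diff smooth_on_const smooth_on_inner derivative_domain_UNIV)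

lemma ball_cutoff_nonneg: "ball_cutoff \<rho> x \<ge> 0"
  by (simp add: ball_cutoff_def smooth_step_nonneg)

lemma ball_cutoff_eq_1:
  assumes "\<rho> \<ge> 0" "norm x \<le> \<rho> + 1" shows "ball_cutoff \<rho> x = 1"
proof -
  have "(norm x)\<^sup>2 \<le> (\<rho> + 1)\<^sup>2" using assms by (intro power_mono) auto
  also have "\<dots> \<le> (\<rho> + 2)\<^sup>2 - 1" using assms by (simp add: power2_eq_square algebra_simps)
  finally show ?thesis unfolding ball_cutoff_def
    by (intro smooth_step_eq_1) (simp add: power2_norm_eq_inner)
qed

lemma ball_cutoff_eq_0:
  assumes "\<rho> \<ge> 0" "norm x \<ge> \<rho> + 2" shows "ball_cutoff \<rho> x = 0"
proof -
  have "(\<rho> + 2)\<^sup>2 \<le> (norm x)\<^sup>2" using assms by (intro power_mono) auto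
  then show ?thesis unfolding ball_cutoff_def
    by (intro smooth_step_eq_0) (simp add: power2_norm_eq_inner)
qed

lemma test_function_ball_cutoff:
  fixes a :: "'a::euclidean_space \<Rightarrow> real"
  assumes "\<rho> \<ge> 0" "smooth_on UNIV a"
  shows "test_function UNIV (\<lambda>x. ball_cutoff \<rho> x * a x)"
proof -
  have "{x. ball_cutoff \<rho> x * a x \<noteq> 0} \<subseteq> cball 0 (\<rho> + 2)"
    using ball_cutoff_eq_0[OF assms(1)] by (force simp: not_le)
  then have "bounded {x. ball_cutoff \<rho> x * a x \<noteq> 0}" using bounded_cball bounded_subset by blast
  then show ?thesis unfolding test_function_def
    using assms smooth_on_ball_cutoff by (auto intro!: smooth_on_mult derivative_domain_UNIV)
qed

section \<open>A positive eigenfunction of the Laplacian\<close>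

text \<open>Applied with a = x \<bullet> sgn y and h = v \<bullet> sgn y, this Taylor remainder is
  quadratic in v uniformly in y, which is what differentiation under the integral needs. It rests on
  1 + h \<le> exp h, used at h and at -h.\<close>

lemma exp_first_order_bound:
  fixes h :: real
  shows "\<bar>exp (a + h) - exp a - h * exp a\<bar> \<le> h\<^sup>2 * exp (\<bar>a\<bar> + \<bar>h\<bar>)"
proof -
  have 1: "0 \<le> exp h - 1 - h" using exp_ge_add_one_self[of h] by linarith
  have "exp h * exp (- h) = 1" by (simp add: exp_minus)
  moreover have "exp h * (1 - h) \<le> exp h * exp (- h)"
    using exp_ge_add_one_self[of "- h"] by (intro mult_left_mono) auto
  ultimately have 2: "exp h - 1 - h \<le> h * (exp h - 1)" by (simp add: algebra_simps)
  have 3: "h * (exp h - 1) \<le> h\<^sup>2 * exp \<bar>h\<bar>"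
  proof (cases "h \<ge> 0")
    case True
    have "exp h - 1 \<le> h * exp h" using \<open>exp h * (1 - h) \<le> exp h * exp (- h)\<close> \<open>exp h * exp (- h) = 1\<close>
      by (simp add: algebra_simps)
    then show ?thesis using True by (simp add: power2_eq_square mult_left_mono mult.assoc)
  next
    case False
    have "1 - exp h \<le> - h" using 1 by simp
    then have "(- h) * (1 - exp h) \<le> (- h) * (- h)" using False by (intro mult_left_mono) auto
    moreover have "h\<^sup>2 * 1 \<le> h\<^sup>2 * exp \<bar>h\<bar>" by (intro mult_left_mono) auto
    ultimately show ?thesis by (simp add: power2_eq_square algebra_simps)
  qed
  have "exp (a + h) - exp a - h * exp a = exp a * (exp h - 1 - h)"
    by (simp add: exp_add algebra_simps)
  then have "\<bar>exp (a + h) - exp a - h * exp a\<bar> = exp a * \<bar>exp h - 1 - h\<bar>"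
    by (simp add: abs_mult)
  also have "\<dots> = exp a * (exp h - 1 - h)" using 1 by simp
  also have "\<dots> \<le> exp \<bar>a\<bar> * (h\<^sup>2 * exp \<bar>h\<bar>)" using 1 2 3 by (intro mult_mono) auto
  finally show ?thesis by (simp add: exp_add mult_ac)
qed

text \<open>Averaging \<open>exp (x \<bullet> \<omega>)\<close> over the directions \<open>\<omega> = sgn y\<close> of the points \<open>y\<close> of the unit
  ball replaces the usual average over the unit sphere and needs no surface measure.\<close>

definition dir_exp :: "('a::euclidean_space \<Rightarrow> real) \<Rightarrow> 'a \<Rightarrow> real" where
  "dir_exp P x = (LINT y:cball 0 1|lborel. P y * exp (x \<bullet> sgn y))"

text \<open>Differentiating \<open>dir_exp P\<close> in direction v multiplies the weight by
  \<open>sgn y \<bullet> v\<close>. Bounded weights are stable under this, so they index a family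
  closed under differentiation.\<close>

definition bounded_weight :: "('a::euclidean_space \<Rightarrow> real) \<Rightarrow> bool" where
  "bounded_weight P \<longleftrightarrow> P \<in> borel_measurable borel \<and> (\<exists>B. \<forall>y. \<bar>P y\<bar> \<le> B)"

lemma set_integrable_cball_bounded:
  fixes f :: "'a::euclidean_space \<Rightarrow> real"
  assumes [measurable]: "f \<in> borel_measurable borel"
    and B: "\<And>y. y \<in> cball c r \<Longrightarrow> \<bar>f y\<bar> \<le> B"
  shows "set_integrable lborel (cball c r) f"
proof -
  have "integrable lborel (\<lambda>y. B * indicat_real (cball c r) y)"
    using emeasure_lborel_cball_finite[of c r] by (intro integrable_mult_right) (auto intro: integrable_real_indicator)
  then show ?thesis unfolding set_integrable_def
    by (rule Bochner_Integration.integrable_bound)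
       (use B order_trans[OF B abs_ge_self] in \<open>auto simp: indicator_def split: if_splits\<close>)
qed

lemma sgn_inner_le: "\<bar>sgn y \<bullet> v\<bar> \<le> norm (v::'a::euclidean_space)"
  using Cauchy_Schwarz_ineq2[of "sgn y" v] by (cases "y = 0") (auto simp: norm_sgn)

lemma borel_measurable_sgn_vec [measurable]:
  "(sgn :: 'a::euclidean_space \<Rightarrow> 'a) \<in> borel_measurable borel"
  unfolding sgn_div_norm[abs_def] by measurable

lemma dir_exp_integrable:
  assumes "bounded_weight P"
  shows "set_integrable lborel (cball 0 1) (\<lambda>y. P y * exp (x \<bullet> sgn y))"
proof -
  obtain B where B: "\<And>y. \<bar>P y\<bar> \<le> B" using assms by (auto simp: bounded_weight_def)
  have [measurable]: "P \<in> borel_measurable borel" using assms by (simp add: bounded_weight_def)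
  have "\<bar>P y * exp (x \<bullet> sgn y)\<bar> \<le> B * exp (norm x)" for y
    unfolding abs_mult using B[of y] sgn_inner_le[of y x]
    by (intro mult_mono) (auto simp: inner_commute)
  then show ?thesis by (intro set_integrable_cball_bounded) auto
qed

lemma bounded_weight_inner:
  assumes "bounded_weight P" shows "bounded_weight (\<lambda>y. P y * (sgn y \<bullet> v))"
proof -
  obtain B where B: "\<And>y. \<bar>P y\<bar> \<le> B" using assms by (auto simp: bounded_weight_def)
  have [measurable]: "P \<in> borel_measurable borel" using assms by (simp add: bounded_weight_def)
  have "\<bar>P y * (sgn y \<bullet> v)\<bar> \<le> B * norm v" for y
    unfolding abs_mult using B[of y] sgn_inner_le[of y v] by (intro mult_mono) auto
  moreover have "(\<lambda>y. P y * (sgn y \<bullet> v)) \<in> borel_measurable borel" by measurable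
  ultimately show ?thesis unfolding bounded_weight_def by blast
qed

lemma bounded_weight_1: "bounded_weight (\<lambda>_. 1)"
  by (auto simp: bounded_weight_def)

lemma dir_exp_has_derivative:
  fixes x :: "'a::euclidean_space"
  assumes P: "bounded_weight P"
  shows "(dir_exp P has_derivative (\<lambda>v. dir_exp (\<lambda>y. P y * (sgn y \<bullet> v)) x)) (at x)"
proof -
  obtain B where B: "\<And>y. \<bar>P y\<bar> \<le> B" using P by (auto simp: bounded_weight_def)
  have B0: "B \<ge> 0" using B[of 0] by linarith
  have [measurable]: "P \<in> borel_measurable borel" using P by (simp add: bounded_weight_def)
  define D where "D v = dir_exp (\<lambda>y. P y * (sgn y \<bullet> v)) x" for v
  define V where "V = measure lborel (cball (0::'a) 1)"
  have int: "set_integrable lborel (cball 0 1) (\<lambda>y. P y * (sgn y \<bullet> v) * exp (x \<bullet> sgn y))" for v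
    by (rule dir_exp_integrable[OF bounded_weight_inner[OF P]])
  have add: "D (v + w) = D v + D w" for v w
    unfolding D_def dir_exp_def using int
    by (subst set_integral_add(2)[symmetric]) (auto simp: inner_add_right algebra_simps)
  have sc: "D (c *\<^sub>R v) = c *\<^sub>R D v" for c v
    unfolding D_def dir_exp_def real_scaleR_def
    by (subst set_integral_mult_right[symmetric]) (simp add: mult_ac)
  have lin: "bounded_linear D"
    unfolding linear_conv_bounded_linear[symmetric] using add sc by (rule linearI)
  have bd: "\<bar>dir_exp P (x + v) - dir_exp P x - D v\<bar>
      \<le> B * V * exp (norm x + norm v) * (norm v)\<^sup>2" for v
  proof -
    let ?E = "\<lambda>y. P y * (exp (x \<bullet> sgn y + v \<bullet> sgn y) - exp (x \<bullet> sgn y) - (v \<bullet> sgn y) * exp (x \<bullet> sgn y))"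
    have i: "set_integrable lborel (cball 0 1) (\<lambda>y. P y * exp ((x + v) \<bullet> sgn y))"
      "set_integrable lborel (cball 0 1) (\<lambda>y. P y * exp (x \<bullet> sgn y))"
      by (rule dir_exp_integrable[OF P])+
    have eqE: "dir_exp P (x + v) - dir_exp P x - D v = (LINT y:cball 0 1|lborel. ?E y)"
      unfolding D_def dir_exp_def
      by (subst set_integral_diff(2)[symmetric] set_integral_diff(2)[OF set_integral_diff(1)[OF i] int, symmetric]
          | rule i)+
         (simp add: inner_add_left inner_commute algebra_simps)
    have E: "\<bar>?E y\<bar> \<le> B * ((norm v)\<^sup>2 * exp (norm x + norm v))" for y
    proof -
      have "\<bar>v \<bullet> sgn y\<bar> \<le> norm v" "\<bar>x \<bullet> sgn y\<bar> \<le> norm x"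
        using sgn_inner_le[of y] by (auto simp: inner_commute)
      moreover have "(v \<bullet> sgn y)\<^sup>2 \<le> (norm v)\<^sup>2"
        using \<open>\<bar>v \<bullet> sgn y\<bar> \<le> norm v\<close> by (metis abs_le_square_iff abs_norm_cancel)
      ultimately have "(v \<bullet> sgn y)\<^sup>2 * exp (\<bar>x \<bullet> sgn y\<bar> + \<bar>v \<bullet> sgn y\<bar>)
          \<le> (norm v)\<^sup>2 * exp (norm x + norm v)"
        by (intro mult_mono) auto
      then have "\<bar>exp (x \<bullet> sgn y + v \<bullet> sgn y) - exp (x \<bullet> sgn y) - (v \<bullet> sgn y) * exp (x \<bullet> sgn y)\<bar>
          \<le> (norm v)\<^sup>2 * exp (norm x + norm v)"
        using exp_first_order_bound[of "x \<bullet> sgn y" "v \<bullet> sgn y"] by linarith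
      then show ?thesis unfolding abs_mult using B[of y] B0 by (intro mult_mono) auto
    qed
    have Ei: "set_integrable lborel (cball 0 1) ?E"
      by (rule set_integrable_cball_bounded[OF _ E]) measurable
    have "\<bar>LINT y:cball 0 1|lborel. ?E y\<bar>
        \<le> (LINT y:cball (0::'a) 1|lborel. B * ((norm v)\<^sup>2 * exp (norm x + norm v)))"
      unfolding set_lebesgue_integral_def
    proof (rule integral_abs_bound_integral)
      show "integrable lborel (\<lambda>y::'a. indicat_real (cball 0 1) y *\<^sub>R (B * ((norm v)\<^sup>2 * exp (norm x + norm v))))"
        using set_integrable_cball_bounded[of "\<lambda>_. B * ((norm v)\<^sup>2 * exp (norm x + norm v))" 0 1]
        by (auto simp: set_integrable_def)
    qed (use E Ei in \<open>auto simp: set_integrable_def indicator_def\<close>)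
    also have "\<dots> = B * V * exp (norm x + norm v) * (norm v)\<^sup>2"
      by (simp add: set_lebesgue_integral_def V_def mult_ac)
    finally show ?thesis using eqE by simp
  qed
  have "((\<lambda>v. norm (dir_exp P (x + v) - dir_exp P x - D v) / norm v) \<longlongrightarrow> 0) (at 0)"
  proof (rule Lim_null_comparison)
    show "\<forall>\<^sub>F v in at 0. norm (norm (dir_exp P (x + v) - dir_exp P x - D v) / norm v)
        \<le> B * V * exp (norm x + norm v) * norm v"
      unfolding eventually_at_filter
    proof (rule always_eventually, intro allI impI)
      fix v :: 'a assume "v \<noteq> 0"
      then show "norm (norm (dir_exp P (x + v) - dir_exp P x - D v) / norm v)
        \<le> B * V * exp (norm x + norm v) * norm v"
        using bd[of v] by (simp add: divide_le_eq power2_eq_square mult_ac)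
    qed
    show "((\<lambda>v::'a. B * V * exp (norm x + norm v) * norm v) \<longlongrightarrow> 0) (at 0)"
      by (auto intro!: tendsto_eq_intros)
  qed
  then show ?thesis using lin unfolding has_derivative_at D_def[abs_def] by simp
qed

lemma smooth_on_dir_exp:
  assumes "bounded_weight P" shows "smooth_on UNIV (dir_exp P)"
  using assms
  by (intro smooth_on_deriv_family[OF derivative_domain_UNIV, of "Collect bounded_weight" dir_exp
        "\<lambda>P v y. P y * (sgn y \<bullet> v)"])
     (auto intro: dir_exp_has_derivative bounded_weight_inner)

abbreviation wave_eigen :: "'a::euclidean_space \<Rightarrow> real" where
  "wave_eigen \<equiv> dir_exp (\<lambda>_. 1)"

lemma frechet_derivative_dir_exp:
  "bounded_weight P \<Longrightarrow> frechet_derivative (dir_exp P) (at x) v = dir_exp (\<lambda>y. P y * (sgn y \<bullet> v)) x"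
  using frechet_derivative_at[OF dir_exp_has_derivative, of P x] by metis

definition laplacian :: "('a::euclidean_space \<Rightarrow> real) \<Rightarrow> 'a \<Rightarrow> real" where
  "laplacian a x = (\<Sum>b\<in>Basis. frechet_derivative (\<lambda>y. frechet_derivative a (at y) b) (at x) b)"

text \<open>Summed over the basis, two derivatives produce the weight |sgn y|^2. It is 1 except at y
  = 0, where \<open>sgn\<close> takes the default value 0, and the origin is a null set.\<close>

lemma laplacian_wave_eigen: "laplacian wave_eigen x = wave_eigen (x::'a::euclidean_space)"
proof -
  have [measurable]: "cball (0::'a) 1 \<in> sets borel" by simp
  have w: "bounded_weight (\<lambda>y::'a. 1 * (sgn y \<bullet> b))" for b
    by (rule bounded_weight_inner[OF bounded_weight_1])
  have "laplacian wave_eigen x = (\<Sum>b\<in>Basis. dir_exp (\<lambda>y. 1 * (sgn y \<bullet> b) * (sgn y \<bullet> b)) x)"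
    unfolding laplacian_def frechet_derivative_dir_exp[OF bounded_weight_1]
    by (subst frechet_derivative_dir_exp[OF w]) simp
  also have "\<dots> = (LINT y|lborel. (\<Sum>b\<in>Basis. indicat_real (cball 0 1) y *
      (1 * (sgn y \<bullet> b) * (sgn y \<bullet> b) * exp (x \<bullet> sgn y))))"
    unfolding dir_exp_def set_lebesgue_integral_def real_scaleR_def
    using dir_exp_integrable[OF bounded_weight_inner[OF w]]
    by (subst Bochner_Integration.integral_sum) (auto simp: set_integrable_def)
  also have "\<dots> = (LINT y|lborel. indicat_real (cball 0 1) y * exp (x \<bullet> sgn y))"
  proof (rule integral_cong_AE)
    have "(\<Sum>b\<in>Basis. indicat_real (cball 0 1) y * (1 * (sgn y \<bullet> b) * (sgn y \<bullet> b) * exp (x \<bullet> sgn y)))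
        = indicat_real (cball 0 1) y * exp (x \<bullet> sgn y)" if "y \<noteq> 0" for y :: 'a
    proof -
      have "(\<Sum>b\<in>Basis. (sgn y \<bullet> b) * (sgn y \<bullet> b)) = sgn y \<bullet> sgn y"
        by (rule euclidean_inner[symmetric])
      also have "\<dots> = 1" using that by (simp add: dot_square_norm norm_sgn)
      finally show ?thesis by (simp add: sum_distrib_left[symmetric] sum_distrib_right[symmetric])
    qed
    then show "AE y in lborel. (\<Sum>b\<in>Basis. indicat_real (cball 0 1) y *
       (1 * (sgn y \<bullet> b) * (sgn y \<bullet> b) * exp (x \<bullet> sgn y))) = indicat_real (cball 0 1) y * exp (x \<bullet> sgn y)"
      using AE_lborel_singleton[of "0::'a"] by auto
  qed (unfold measurable_lborel2, measurable)
  finally show ?thesis by (simp add: dir_exp_def set_lebesgue_integral_def)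
qed

lemma wave_eigen_pos: "wave_eigen (x::'a::euclidean_space) > 0"
proof -
  have i: "set_integrable lborel (cball 0 1) (\<lambda>y. 1 * exp (x \<bullet> sgn y))"
    by (rule dir_exp_integrable[OF bounded_weight_1])
  have "0 < exp (- norm x) * measure lborel (cball (0::'a) 1)"
    using content_cball_pos[of 1 "0::'a"] by simp
  also have "\<dots> = (LINT y|lborel. exp (- norm x) * indicat_real (cball 0 1) (y::'a))" by simp
  also have "\<dots> \<le> (LINT y|lborel. indicat_real (cball 0 1) y *\<^sub>R (1 * exp (x \<bullet> sgn y)))"
  proof (rule integral_mono)
    show "integrable lborel (\<lambda>y::'a. exp (- norm x) * indicat_real (cball 0 1) y)"
      using emeasure_lborel_cball_finite[of "0::'a" 1]
      by (intro integrable_mult_right) (auto intro: integrable_real_indicator)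
    show "exp (- norm x) * indicat_real (cball 0 1) y \<le> indicat_real (cball 0 1) y *\<^sub>R (1 * exp (x \<bullet> sgn y))" for y
      using sgn_inner_le[of y x] by (auto simp: indicator_def inner_commute)
  qed (use i in \<open>auto simp: set_integrable_def\<close>)
  finally show ?thesis by (simp add: dir_exp_def set_lebesgue_integral_def)
qed

section \<open>Gaussian domination of the eigenfunction at infinity\<close>

lemma nn_integral_gaussian:
  assumes "\<sigma> > 0"
  shows "(\<integral>\<^sup>+z. ennreal (exp (- (z - c)\<^sup>2 / (2 * \<sigma>\<^sup>2))) \<partial>lborel) = ennreal (sqrt (2 * pi * \<sigma>\<^sup>2))"
proof -
  have "exp (- (z - c)\<^sup>2 / (2 * \<sigma>\<^sup>2)) = sqrt (2 * pi * \<sigma>\<^sup>2) * normal_density c \<sigma> z" for z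
    using assms by (simp add: normal_density_def)
  then have "(\<integral>\<^sup>+z. ennreal (exp (- (z - c)\<^sup>2 / (2 * \<sigma>\<^sup>2))) \<partial>lborel)
      = (\<integral>\<^sup>+z. ennreal (sqrt (2 * pi * \<sigma>\<^sup>2) * normal_density c \<sigma> z) \<partial>lborel)" by simp
  also have "\<dots> = ennreal (LINT z|lborel. sqrt (2 * pi * \<sigma>\<^sup>2) * normal_density c \<sigma> z)"
    using assms by (intro nn_integral_eq_integral) auto
  finally show ?thesis using assms by simp
qed

text \<open>Each slice \<open>y \<bullet> k = const\<close> is a product of one-dimensional Gaussians, whatever its centre.\<close>

lemma nn_integral_slab_gaussian:
  fixes k :: "'a::euclidean_space" and a :: "'a \<Rightarrow> real"
  assumes k: "k \<in> Basis" and s: "\<sigma> > 0"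
  shows "(\<integral>\<^sup>+y. indicator {-1..1} (y \<bullet> k) *
      (\<Prod>j\<in>Basis - {k}. ennreal (exp (- (y \<bullet> j - (y \<bullet> k) * a j)\<^sup>2 / (2 * \<sigma>\<^sup>2)))) \<partial>lborel)
    = 2 * ennreal (sqrt (2 * pi * \<sigma>\<^sup>2)) ^ (DIM('a) - 1)"
proof -
  interpret product_sigma_finite "\<lambda>b::'a. lborel :: real measure" by standard
  define F :: "'a \<Rightarrow> ennreal" where "F y = indicator {-1..1} (y \<bullet> k) *
      (\<Prod>j\<in>Basis - {k}. ennreal (exp (- (y \<bullet> j - (y \<bullet> k) * a j)\<^sup>2 / (2 * \<sigma>\<^sup>2))))" for y
  define H :: "('a \<Rightarrow> real) \<Rightarrow> ennreal" where "H x = indicator {-1..1} (x k) *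
      (\<Prod>j\<in>Basis - {k}. ennreal (exp (- (x j - x k * a j)\<^sup>2 / (2 * \<sigma>\<^sup>2))))" for x
  let ?S = "\<lambda>x::'a \<Rightarrow> real. \<Sum>b\<in>Basis. x b *\<^sub>R b"
  have ins: "insert k (Basis - {k}) = Basis" using k by auto
  have [measurable]: "F \<in> borel_measurable borel" unfolding F_def[abs_def] by measurable
  have [simp]: "?S x \<bullet> j = x j" if "j \<in> Basis" for x and j :: 'a
    using that by (simp add: inner_sum_left inner_Basis if_distrib[of "\<lambda>c. _ * c"] cong: if_cong)
  have FH: "F (?S x) = H x" for x
    unfolding F_def H_def using k by (auto intro!: arg_cong2[where f="(*)"] prod.cong)
  have Hm: "H \<in> borel_measurable (Pi\<^sub>M (insert k (Basis - {k})) (\<lambda>b. lborel))"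
    unfolding H_def[abs_def] by measurable
  have "(\<integral>\<^sup>+y. F y \<partial>lborel) = (\<integral>\<^sup>+x. F (?S x) \<partial>(\<Pi>\<^sub>M b\<in>Basis. lborel))"
    by (subst lborel_eq, subst nn_integral_distr) auto
  also have "\<dots> = (\<integral>\<^sup>+x. H x \<partial>(Pi\<^sub>M (insert k (Basis - {k})) (\<lambda>b. lborel)))"
    unfolding ins FH ..
  also have "\<dots> = (\<integral>\<^sup>+t. (\<integral>\<^sup>+x. H (x(k := t)) \<partial>(Pi\<^sub>M (Basis - {k}) (\<lambda>b. lborel))) \<partial>lborel)"
    by (rule product_nn_integral_insert_rev[OF _ _ Hm]) auto
  also have "\<dots> = (\<integral>\<^sup>+t. indicator {-1..1::real} t * ennreal (sqrt (2 * pi * \<sigma>\<^sup>2)) ^ (DIM('a) - 1) \<partial>lborel)"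
  proof (rule nn_integral_cong)
    fix t :: real
    have "H (x(k := t)) = indicator {-1..1} t *
      (\<Prod>j\<in>Basis - {k}. ennreal (exp (- (x j - t * a j)\<^sup>2 / (2 * \<sigma>\<^sup>2))))" for x
      unfolding H_def by (auto intro!: arg_cong2[where f="(*)"] prod.cong)
    then have "(\<integral>\<^sup>+x. H (x(k := t)) \<partial>(Pi\<^sub>M (Basis - {k}) (\<lambda>b. lborel)))
      = (\<integral>\<^sup>+x. indicator {-1..1} t * (\<Prod>j\<in>Basis - {k}. ennreal (exp (- (x j - t * a j)\<^sup>2 / (2 * \<sigma>\<^sup>2))))
          \<partial>(Pi\<^sub>M (Basis - {k}) (\<lambda>b. lborel)))" by simp
    also have "\<dots> = indicator {-1..1} t *
       (\<integral>\<^sup>+x. (\<Prod>j\<in>Basis - {k}. ennreal (exp (- (x j - t * a j)\<^sup>2 / (2 * \<sigma>\<^sup>2))))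
          \<partial>(Pi\<^sub>M (Basis - {k}) (\<lambda>b. lborel)))"
      by (rule nn_integral_cmult) measurable
    also have "(\<integral>\<^sup>+x. (\<Prod>j\<in>Basis - {k}. ennreal (exp (- (x j - t * a j)\<^sup>2 / (2 * \<sigma>\<^sup>2))))
          \<partial>(Pi\<^sub>M (Basis - {k}) (\<lambda>b. lborel)))
       = (\<Prod>j\<in>Basis - {k}. (\<integral>\<^sup>+z. ennreal (exp (- (z - t * a j)\<^sup>2 / (2 * \<sigma>\<^sup>2))) \<partial>lborel))"
      by (rule product_nn_integral_prod) auto
    also have "\<dots> = ennreal (sqrt (2 * pi * \<sigma>\<^sup>2)) ^ (DIM('a) - 1)"
      unfolding nn_integral_gaussian[OF s] using k by simp
    finally show "(\<integral>\<^sup>+x. H (x(k := t)) \<partial>(Pi\<^sub>M (Basis - {k}) (\<lambda>b. lborel)))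
      = indicator {-1..1} t * ennreal (sqrt (2 * pi * \<sigma>\<^sup>2)) ^ (DIM('a) - 1)" .
  qed
  also have "\<dots> = 2 * ennreal (sqrt (2 * pi * \<sigma>\<^sup>2)) ^ (DIM('a) - 1)"
    by (subst nn_integral_multc) auto
  finally show ?thesis unfolding F_def .
qed

text \<open>The squared coordinates of a unit vector sum to 1, so they cannot all be below average.
  Slicing along this axis replaces a rotation of e to a coordinate axis; the price is a constant
  depending on the dimension.\<close>

lemma exists_large_coordinate:
  fixes e :: "'a::euclidean_space"
  assumes "norm e = 1"
  obtains k where "k \<in> Basis" "(e \<bullet> k)\<^sup>2 \<ge> 1 / DIM('a)"
proof -
  have "\<exists>k\<in>Basis. (e \<bullet> k)\<^sup>2 \<ge> 1 / DIM('a)"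
  proof (rule ccontr)
    assume "\<not> ?thesis"
    then have "(\<Sum>k\<in>Basis. (e \<bullet> k)\<^sup>2) < (\<Sum>k\<in>(Basis::'a set). 1 / DIM('a))"
      by (intro sum_strict_mono) (auto simp: not_le)
    also have "\<dots> = 1" by simp
    finally have "(norm e)\<^sup>2 < 1"
      unfolding power2_norm_eq_inner by (subst euclidean_inner) (simp add: power2_eq_square)
    then show False using assms by simp
  qed
  then show ?thesis using that by blast
qed

text \<open>Both sides measure how far y is from the line through e. With w = y - (y_k/e_k) e, so
  that w_k = 0, the sum is |w|^2, and |w|^2 - (e \<bullet> w)^2 is the squared distance of y from
  that line. Cauchy-Schwarz for w and the part of e orthogonal to k bounds (e \<bullet> w)^2 by (1 -
  1/N) |w|^2, so the squared distance is at least |w|^2/N.\<close>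

lemma inner_sgn_gaussian_bound:
  fixes e y :: "'a::euclidean_space"
  assumes e: "norm e = 1" and k: "k \<in> Basis" "(e \<bullet> k)\<^sup>2 \<ge> 1 / DIM('a)" and y: "norm y \<le> 1"
  shows "e \<bullet> sgn y \<le> 1 - (\<Sum>j\<in>Basis - {k}. (y \<bullet> j - (y \<bullet> k) * ((e \<bullet> j) / (e \<bullet> k)))\<^sup>2) / (2 * DIM('a))"
proof -
  define N :: real where "N = DIM('a)"
  have N: "N > 0" by (simp add: N_def)
  have ek: "e \<bullet> k \<noteq> 0"
  proof
    assume "e \<bullet> k = 0"
    then show False using k N by (simp add: N_def[symmetric])
  qed
  have ee: "e \<bullet> e = 1" using e by (simp add: dot_square_norm)
  define w where "w = y - ((y \<bullet> k) / (e \<bullet> k)) *\<^sub>R e"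
  have wk: "w \<bullet> k = 0" using ek by (simp add: w_def inner_diff_left)
  have kk: "k \<bullet> k = 1" using k by simp
  have ww: "w \<bullet> w - (e \<bullet> w)\<^sup>2 = y \<bullet> y - (e \<bullet> y)\<^sup>2"
    unfolding w_def by (simp add: inner_diff_left inner_diff_right ee inner_commute power2_eq_square algebra_simps)
  have sum: "(\<Sum>j\<in>Basis - {k}. (y \<bullet> j - (y \<bullet> k) * ((e \<bullet> j) / (e \<bullet> k)))\<^sup>2) = w \<bullet> w"
  proof -
    have "w \<bullet> w = (\<Sum>j\<in>Basis. (w \<bullet> j)\<^sup>2)" by (simp add: euclidean_inner[of w w] power2_eq_square)
    also have "\<dots> = (w \<bullet> k)\<^sup>2 + (\<Sum>j\<in>Basis - {k}. (w \<bullet> j)\<^sup>2)"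
      using k by (intro sum.remove) auto
    finally show ?thesis using wk by (simp add: w_def inner_diff_left)
  qed
  have "(e \<bullet> w)\<^sup>2 = ((e - (e \<bullet> k) *\<^sub>R k) \<bullet> w)\<^sup>2"
    using wk by (simp add: inner_diff_left inner_commute[of k w])
  also have "\<dots> \<le> ((e - (e \<bullet> k) *\<^sub>R k) \<bullet> (e - (e \<bullet> k) *\<^sub>R k)) * (w \<bullet> w)"
    by (rule Cauchy_Schwarz_ineq)
  also have "\<dots> = (1 - (e \<bullet> k)\<^sup>2) * (w \<bullet> w)"
    by (simp add: inner_diff_left inner_diff_right ee kk inner_commute power2_eq_square)
  also have "\<dots> \<le> (1 - 1 / N) * (w \<bullet> w)"
    using k by (intro mult_right_mono) (auto simp: N_def)
  finally have A: "(w \<bullet> w) / N \<le> y \<bullet> y - (e \<bullet> y)\<^sup>2" using ww by (simp add: algebra_simps)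
  \<comment> \<open>With c the cosine of the angle between y and e, the squared distance is |y|^2 (1
    - c^2) \<le> 1 - c^2 \<le> 2 (1 - c). For y = 0 the claim reads 0 \<le> 1.\<close>
  have B: "(y \<bullet> y - (e \<bullet> y)\<^sup>2) / 2 \<le> 1 - e \<bullet> sgn y"
  proof (cases "y = 0")
    case False
    define c where "c = e \<bullet> sgn y"
    have c: "\<bar>c\<bar> \<le> 1" using sgn_inner_le[of y e] e by (simp add: c_def inner_commute)
    have ey: "e \<bullet> y = norm y * c" using False by (simp add: c_def sgn_div_norm)
    have "y \<bullet> y - (e \<bullet> y)\<^sup>2 = (norm y)\<^sup>2 * (1 - c\<^sup>2)"
      by (simp add: ey power_mult_distrib dot_square_norm algebra_simps)
    also have "\<dots> \<le> 1 * (1 - c\<^sup>2)"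
      using y c by (intro mult_right_mono) (auto simp: power_le_one abs_square_le_1)
    also have "\<dots> \<le> 2 * (1 - c)"
    proof -
      have "0 \<le> (1 - c)\<^sup>2" by simp
      then show ?thesis by (simp add: power2_eq_square algebra_simps)
    qed
    finally show ?thesis by (simp add: c_def)
  qed simp
  have "e \<bullet> sgn y \<le> 1 - (w \<bullet> w) / N / 2" using A B by argo
  then show ?thesis unfolding sum by (simp add: N_def mult.commute)
qed

text \<open>Laplace's method as a pointwise inequality: for x = r e the exponent r (e \<bullet> sgn
  y) is at most r minus a quadratic form in the N - 1 coordinates other than k, which gives
  Gaussians of variance N/r. Each of these coordinates contributes a factor of order r^(-1/2), and
  coordinate k contributes the length 2 of its range.\<close>

lemma wave_eigen_large_bound:
  fixes x :: "'a::euclidean_space"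
  assumes x: "x \<noteq> 0"
  shows "wave_eigen x \<le> exp (norm x) * (2 * sqrt (2 * pi * (DIM('a) / norm x)) ^ (DIM('a) - 1))"
proof -
  define r where "r = norm x"
  have r: "r > 0" using x by (simp add: r_def)
  define e where "e = (1 / r) *\<^sub>R x"
  have e: "norm e = 1" using r by (simp add: e_def r_def)
  have xe: "x = r *\<^sub>R e" using r by (simp add: e_def)
  obtain k where k: "k \<in> Basis" "(e \<bullet> k)\<^sup>2 \<ge> 1 / DIM('a)" using exists_large_coordinate[OF e] .
  define \<sigma> where "\<sigma> = sqrt (DIM('a) / r)"
  have s: "\<sigma> > 0" "\<sigma>\<^sup>2 = DIM('a) / r" using r by (auto simp: \<sigma>_def)
  define a where "a j = (e \<bullet> j) / (e \<bullet> k)" for j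
  define Q where "Q y = (\<Prod>j\<in>Basis - {k}. exp (- (y \<bullet> j - (y \<bullet> k) * a j)\<^sup>2 / (2 * \<sigma>\<^sup>2)))" for y
  have pt: "indicat_real (cball 0 1) y * exp (x \<bullet> sgn y) \<le> exp r * (indicat_real {-1..1} (y \<bullet> k) * Q y)" for y
  proof (cases "norm y \<le> 1")
    case True
    have "\<bar>y \<bullet> k\<bar> \<le> 1" using Basis_le_norm[OF k(1), of y] True by linarith
    have "x \<bullet> sgn y = r * (e \<bullet> sgn y)" by (subst xe) simp
    also have "\<dots> \<le> r * (1 - (\<Sum>j\<in>Basis - {k}. (y \<bullet> j - (y \<bullet> k) * a j)\<^sup>2) / (2 * DIM('a)))"
      using inner_sgn_gaussian_bound[OF e k True] r unfolding a_def by (intro mult_left_mono) auto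
    also have "\<dots> = r + (\<Sum>j\<in>Basis - {k}. - (y \<bullet> j - (y \<bullet> k) * a j)\<^sup>2 / (2 * \<sigma>\<^sup>2))"
      using r by (simp add: s sum_negf sum_divide_distrib[symmetric] sum_distrib_left field_simps)
    finally have "exp (x \<bullet> sgn y) \<le> exp r * Q y"
      unfolding Q_def by (simp add: exp_sum[symmetric] exp_add[symmetric])
    then show ?thesis using True \<open>\<bar>y \<bullet> k\<bar> \<le> 1\<close> by (simp add: indicator_def abs_le_iff)
  qed (auto simp: indicator_def Q_def intro!: mult_nonneg_nonneg prod_nonneg)
  have "ennreal (wave_eigen x) = (\<integral>\<^sup>+y. ennreal (indicat_real (cball 0 1) y * exp (x \<bullet> sgn y)) \<partial>lborel)"
    using dir_exp_integrable[OF bounded_weight_1, of x] unfolding dir_exp_def set_lebesgue_integral_def set_integrable_def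
    by (subst nn_integral_eq_integral) auto
  also have "\<dots> \<le> (\<integral>\<^sup>+y. ennreal (exp r * (indicat_real {-1..1} (y \<bullet> k) * Q y)) \<partial>lborel)"
    using pt by (intro nn_integral_mono ennreal_leI)
  also have "\<dots> = (\<integral>\<^sup>+y. ennreal (exp r) * (indicator {-1..1} (y \<bullet> k) *
      (\<Prod>j\<in>Basis - {k}. ennreal (exp (- (y \<bullet> j - (y \<bullet> k) * a j)\<^sup>2 / (2 * \<sigma>\<^sup>2))))) \<partial>lborel)"
    unfolding Q_def by (subst prod_ennreal) (auto simp: ennreal_mult' ennreal_indicator prod_nonneg intro!: nn_integral_cong)
  also have "\<dots> = ennreal (exp r) * (2 * ennreal (sqrt (2 * pi * \<sigma>\<^sup>2)) ^ (DIM('a) - 1))"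
    by (subst nn_integral_cmult, measurable) (simp only: nn_integral_slab_gaussian[OF k(1) s(1)])
  also have "\<dots> = ennreal (exp r * (2 * sqrt (2 * pi * \<sigma>\<^sup>2) ^ (DIM('a) - 1)))"
    using s r by (subst ennreal_power) (auto simp: ennreal_mult')
  finally show ?thesis using s r by (subst (asm) ennreal_le_iff) (auto simp: r_def)
qed


lemma wave_eigen_decay:
  obtains C where "C > 0"
    "\<And>x::'a::euclidean_space. wave_eigen x \<le> C * (1 + norm x) powr (- ((real DIM('a) - 1) / 2)) * exp (norm x)"
proof -
  define m :: real where "m = (real DIM('a) - 1) / 2"
  have m: "m \<ge> 0" using DIM_positive[where 'a='a] unfolding m_def
    by (metis One_nat_def Suc_leI diff_ge_0_iff_ge divide_nonneg_pos of_nat_1 of_nat_le_iff zero_less_numeral)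
  have m2: "2 * m = real (DIM('a) - 1)" using DIM_positive[where 'a='a] by (simp add: m_def of_nat_diff Suc_leI)
  define V where "V = measure lborel (cball (0::'a) 1)"
  have V: "V > 0" using content_cball_pos[of 1 "0::'a"] by (simp add: V_def)
  \<comment> \<open>The 4 in place of 2 pays for 1/r \<le> 2/(1 + r), valid for r > 1. The second
    summand of \<open>C\<close> covers the unit ball, where a negative power of r is no
    bound.\<close>
  define A where "A = 2 * sqrt (4 * pi * DIM('a)) ^ (DIM('a) - 1)"
  have A: "A > 0" by (simp add: A_def)
  define C where "C = A + V * 2 powr m * exp 1"
  have "C > 0" using A V by (simp add: C_def add_pos_pos)
  moreover have "wave_eigen x \<le> C * (1 + norm x) powr (- m) * exp (norm x)" for x :: 'a
  proof (cases "norm x \<le> 1")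
    case True
    have i: "set_integrable lborel (cball 0 1) (\<lambda>y. 1 * exp (x \<bullet> sgn y))"
      by (rule dir_exp_integrable[OF bounded_weight_1])
    have "wave_eigen x \<le> (LINT y:cball (0::'a) 1|lborel. exp 1)"
      unfolding dir_exp_def
    proof (rule set_integral_mono[OF i])
      show "set_integrable lborel (cball (0::'a) 1) (\<lambda>y. exp 1 :: real)"
        by (rule set_integrable_cball_bounded[where B = "exp 1"]) auto
      show "1 * exp (x \<bullet> sgn y) \<le> exp 1" for y
        using sgn_inner_le[of y x] True by (simp add: inner_commute)
    qed
    also have "\<dots> = V * exp 1" by (simp add: set_lebesgue_integral_def V_def)
    also have "\<dots> = V * 2 powr m * exp 1 * 2 powr (- m)"
      by (simp add: powr_minus field_simps)
    also have "\<dots> \<le> C * (1 + norm x) powr (- m)"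
      using A V True m norm_ge_zero[of x] by (intro mult_mono powr_mono2') (auto simp: C_def simp del: norm_ge_zero)
    also have "\<dots> \<le> C * (1 + norm x) powr (- m) * exp (norm x)"
      using \<open>C > 0\<close> mult_left_mono[of 1 "exp (norm x)" "C * (1 + norm x) powr (- m)"] by simp
    finally show ?thesis .
  next
    case False
    define r where "r = norm x"
    have r: "r > 1" using False by (simp add: r_def)
    have "sqrt (2 * pi * (DIM('a) / r)) ^ (DIM('a) - 1) \<le> sqrt (4 * pi * DIM('a) * (1 / (1 + r))) ^ (DIM('a) - 1)"
    proof (intro power_mono real_sqrt_le_mono)
      have "1 / r \<le> 2 * (1 / (1 + r))" using r by (simp add: field_simps)
      then have "2 * pi * DIM('a) * (1 / r) \<le> 2 * pi * DIM('a) * (2 * (1 / (1 + r)))"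
        by (intro mult_left_mono) auto
      then show "2 * pi * (DIM('a) / r) \<le> 4 * pi * DIM('a) * (1 / (1 + r))" by simp
    qed (use r in auto)
    also have "\<dots> = sqrt (4 * pi * DIM('a)) ^ (DIM('a) - 1) * sqrt (1 / (1 + r)) ^ (DIM('a) - 1)"
      by (simp only: real_sqrt_mult power_mult_distrib)
    also have "sqrt (1 / (1 + r)) ^ (DIM('a) - 1) = (1 + r) powr (- m)"
    proof -
      have "sqrt (1 / (1 + r)) = (1 + r) powr (- 1 / 2)"
        using r by (simp add: powr_minus powr_half_sqrt[symmetric] powr_divide field_simps)
      then show ?thesis using r m2 by (simp add: powr_realpow[symmetric] powr_powr m_def)
    qed
    finally have *: "2 * sqrt (2 * pi * (DIM('a) / r)) ^ (DIM('a) - 1) \<le> A * (1 + r) powr (- m)"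
      by (simp add: A_def)
    have "wave_eigen x \<le> exp r * (2 * sqrt (2 * pi * (DIM('a) / r)) ^ (DIM('a) - 1))"
    proof -
      have "x \<noteq> 0" using r by (auto simp: r_def)
      then show ?thesis using wave_eigen_large_bound unfolding r_def by blast
    qed
    also have "\<dots> \<le> exp r * (C * (1 + r) powr (- m))"
      using * V by (intro mult_left_mono order_trans[OF *] mult_right_mono) (auto simp: C_def)
    finally show ?thesis by (simp add: r_def mult_ac)
  qed
  ultimately show ?thesis using that unfolding m_def by blast
qed

section \<open>Concentration near the boundary sphere and L^q norms over balls\<close>

lemma power_diff_le:
  fixes \<rho> h :: real
  assumes "0 \<le> h" "h \<le> \<rho>"
  shows "\<rho> ^ n - (\<rho> - h) ^ n \<le> n * \<rho> ^ (n - 1) * h"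
proof (induction n)
  case (Suc n)
  have "\<rho> ^ Suc n - (\<rho> - h) ^ Suc n = \<rho> * (\<rho> ^ n - (\<rho> - h) ^ n) + h * (\<rho> - h) ^ n"
    by (simp add: algebra_simps)
  also have "\<dots> \<le> \<rho> * (n * \<rho> ^ (n - 1) * h) + h * \<rho> ^ n"
    using assms Suc by (intro add_mono mult_left_mono power_mono) auto
  also have "\<dots> = Suc n * \<rho> ^ (Suc n - 1) * h"
    by (cases n) (auto simp: algebra_simps)
  finally show ?case .
qed simp

text \<open>Substitute for polar coordinates: a bound linear in the thickness h, with the area of
  the outer sphere as its constant. When h exceeds \<rho> the whole ball obeys it, since \<rho>^N
  \<le> \<rho>^(N-1) h.\<close>

lemma measure_shell_le:
  assumes \<rho>: "\<rho> \<ge> 0" and h: "h \<ge> 0"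
  shows "measure lborel {x::'a::euclidean_space. norm x \<le> \<rho> \<and> \<rho> - norm x < h}
    \<le> unit_ball_vol DIM('a) * DIM('a) * \<rho> ^ (DIM('a) - 1) * h"
proof (cases "h \<le> \<rho>")
  case True
  have "{x::'a. norm x \<le> \<rho> \<and> \<rho> - norm x < h} = cball 0 \<rho> - cball 0 (\<rho> - h)" by auto
  then have "measure lborel {x::'a. norm x \<le> \<rho> \<and> \<rho> - norm x < h}
      = measure lborel (cball (0::'a) \<rho>) - measure lborel (cball (0::'a) (\<rho> - h))"
    using emeasure_lborel_cball_finite[of "0::'a" \<rho>] h
    by (simp add: measure_Diff subset_cball)
  also have "\<dots> = unit_ball_vol DIM('a) * (\<rho> ^ DIM('a) - (\<rho> - h) ^ DIM('a))"
    using \<rho> True by (simp add: content_cball algebra_simps)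
  also have "\<dots> \<le> unit_ball_vol DIM('a) * (DIM('a) * \<rho> ^ (DIM('a) - 1) * h)"
    using power_diff_le[OF h True] by (intro mult_left_mono) auto
  finally show ?thesis by (simp add: mult_ac)
next
  case False
  have "measure lborel {x::'a. norm x \<le> \<rho> \<and> \<rho> - norm x < h} \<le> measure lborel (cball (0::'a) \<rho>)"
  proof (rule measure_mono_fmeasurable)
    have "{x::'a. norm x \<le> \<rho> \<and> \<rho> - norm x < h} = cball 0 \<rho> - cball 0 (\<rho> - h)" by auto
    then show "{x::'a. norm x \<le> \<rho> \<and> \<rho> - norm x < h} \<in> sets lborel" by simp
    show "cball (0::'a) \<rho> \<in> fmeasurable lborel"
      using emeasure_lborel_cball_finite[of "0::'a" \<rho>] by (intro fmeasurableI) auto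
  qed auto
  also have "\<dots> = unit_ball_vol DIM('a) * 1 * \<rho> ^ (DIM('a) - 1) * \<rho>"
    using \<rho> power_minus_mult[of "DIM('a)" \<rho>] by (simp add: content_cball)
  also have "\<dots> \<le> unit_ball_vol DIM('a) * DIM('a) * \<rho> ^ (DIM('a) - 1) * h"
    using False \<rho> DIM_positive[where 'a='a]
    by (intro mult_mono) (auto simp: Suc_le_eq)
  finally show ?thesis .
qed

text \<open>The integrand is concentrated within a bounded distance of the boundary sphere, so the
  integral has the size of the sphere and not of the ball. The ball is covered by nested shells
  \<open>B n\<close> of thickness n + 1; at depth between n and n + 1 the integrand is at most z^n
  with z = exp (-c), and the series of (n + 1) z^n converges.\<close>

lemma nn_integral_exp_depth:
  fixes c :: real
  assumes c: "c > 0"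
  obtains C where "C > 0" "\<And>\<rho>. \<rho> \<ge> 0 \<Longrightarrow>
    (\<integral>\<^sup>+(x::'a::euclidean_space). ennreal (exp (- c * (\<rho> - norm x))) * indicator (cball 0 \<rho>) x \<partial>lborel)
      \<le> ennreal (C * \<rho> ^ (DIM('a) - 1))"
proof -
  define D where "D = unit_ball_vol DIM('a) * DIM('a)"
  have D: "D > 0" by (simp add: D_def)
  define z where "z = exp (- c)"
  have z: "0 < z" "z < 1" using c by (auto simp: z_def)
  have "summable (\<lambda>n. diffs (\<lambda>_. 1) n * z ^ n)"
    by (rule termdiff_converges[of z 1]) (use z in \<open>auto intro: summable_geometric\<close>)
  then have sm: "summable (\<lambda>n. z ^ n * real (Suc n))" by (simp add: diffs_def mult.commute)
  define S where "S = (\<Sum>n. z ^ n * real (Suc n))"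
  have S: "S > 0" unfolding S_def using z by (intro suminf_pos sm) auto
  have "(\<integral>\<^sup>+(x::'a). ennreal (exp (- c * (\<rho> - norm x))) * indicator (cball 0 \<rho>) x \<partial>lborel)
      \<le> ennreal (S * D * \<rho> ^ (DIM('a) - 1))" if \<rho>: "\<rho> \<ge> 0" for \<rho>
  proof -
    define B where "B n = {x::'a. norm x \<le> \<rho> \<and> \<rho> - norm x < real (Suc n)}" for n
    have Bm[measurable]: "B n \<in> sets borel" for n
    proof -
      have "B n = cball 0 \<rho> - cball 0 (\<rho> - real (Suc n))" by (auto simp: B_def)
      then show ?thesis by simp
    qed
    have Bf: "emeasure lborel (B n) = ennreal (measure lborel (B n))" for n
      using emeasure_lborel_cball_finite[of "0::'a" \<rho>] emeasure_mono[of "B n" "cball 0 \<rho>" lborel]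
      by (intro emeasure_eq_ennreal_measure) (auto simp: B_def top_unique subset_eq)
    have pt: "ennreal (exp (- c * (\<rho> - norm x))) * indicator (cball 0 \<rho>) x
        \<le> (\<Sum>n. ennreal (z ^ n) * indicator (B n) x)" for x
    proof (cases "x \<in> cball 0 \<rho>")
      case True
      define n where "n = nat \<lfloor>\<rho> - norm x\<rfloor>"
      have n: "real n \<le> \<rho> - norm x" "\<rho> - norm x < real (Suc n)"
        using True unfolding n_def of_nat_Suc by (simp_all add: of_nat_nat; linarith)+
      have "exp (- c * (\<rho> - norm x)) \<le> exp (- c * real n)" using c n by simp
      also have "\<dots> = z ^ n" by (simp add: z_def exp_of_nat_mult[symmetric] mult.commute)
      finally have "ennreal (exp (- c * (\<rho> - norm x))) * indicator (cball 0 \<rho>) x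
          \<le> ennreal (z ^ n) * indicator (B n) x"
        using True n by (auto simp: B_def intro: ennreal_leI)
      also have "\<dots> = (\<Sum>i\<in>{n}. ennreal (z ^ i) * indicator (B i) x)"
        by (simp only: sum.insert sum.empty finite.emptyI empty_iff not_False_eq_True add_0_right)
      also have "\<dots> \<le> (\<Sum>n. ennreal (z ^ n) * indicator (B n) x)"
        by (rule sum_le_suminf) auto
      finally show ?thesis .
    qed simp
    have "(\<integral>\<^sup>+(x::'a). ennreal (exp (- c * (\<rho> - norm x))) * indicator (cball 0 \<rho>) x \<partial>lborel)
        \<le> (\<integral>\<^sup>+x. (\<Sum>n. ennreal (z ^ n) * indicator (B n) x) \<partial>lborel)"
      by (rule nn_integral_mono) (rule pt)
    also have "\<dots> = (\<Sum>n. \<integral>\<^sup>+x. ennreal (z ^ n) * indicator (B n) x \<partial>lborel)"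
      by (rule nn_integral_suminf) measurable
    also have "\<dots> = (\<Sum>n. ennreal (z ^ n * measure lborel (B n)))"
      using z by (simp add: nn_integral_cmult_indicator Bf ennreal_mult')
    also have "\<dots> \<le> (\<Sum>n. ennreal (z ^ n * real (Suc n) * (D * \<rho> ^ (DIM('a) - 1))))"
    proof (intro suminf_le ennreal_leI)
      fix n
      have "measure lborel (B n) \<le> D * \<rho> ^ (DIM('a) - 1) * real (Suc n)"
        unfolding B_def D_def by (rule measure_shell_le[OF \<rho>]) simp
      then show "z ^ n * measure lborel (B n) \<le> z ^ n * real (Suc n) * (D * \<rho> ^ (DIM('a) - 1))"
        using z mult_left_mono[of "measure lborel (B n)" "D * \<rho> ^ (DIM('a) - 1) * real (Suc n)" "z ^ n"]
        by (simp add: mult_ac)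
    qed auto
    also have "\<dots> = ennreal (S * (D * \<rho> ^ (DIM('a) - 1)))"
      unfolding S_def suminf_mult2[OF sm]
      using z D \<rho> sm by (intro suminf_ennreal2 summable_mult2) auto
    finally show ?thesis by (simp add: mult_ac)
  qed
  then show ?thesis using that[of "S * D"] S D by simp
qed

text \<open>Half of the exponential decay in the depth \<delta> = \<rho> - r is spent on moving the
  power from r to \<rho>: one has 1 + \<rho> \<le> (1 + r)(1 + \<delta>), and (1 + \<delta>)^s \<le>
  M^s exp (\<delta> s/M), where M \<ge> 2 s/q makes s/M \<le> q/2.\<close>

lemma power_exp_depth:
  fixes s q \<rho> r :: real
  assumes s: "s \<ge> 0" and q: "q > 0" and r: "0 \<le> r" "r \<le> \<rho>"
  shows "(1 + r) powr (- s) * exp (q * r) \<le> max 1 (2 * s / q) powr s *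
    ((1 + \<rho>) powr (- s) * exp (q * \<rho>) * exp (- (q / 2) * (\<rho> - r)))"
proof -
  define M where "M = max 1 (2 * s / q)"
  have M: "M \<ge> 1" "2 * s / q \<le> M" by (auto simp: M_def)
  define \<delta> where "\<delta> = \<rho> - r"
  have \<delta>: "\<delta> \<ge> 0" using r by (simp add: \<delta>_def)
  have "1 + \<delta> \<le> M * (1 + \<delta> / M)" using M by (simp add: field_simps)
  also have "\<dots> \<le> M * exp (\<delta> / M)" using M exp_ge_add_one_self[of "\<delta> / M"] by (intro mult_left_mono) auto
  finally have "(1 + \<delta>) powr s \<le> (M * exp (\<delta> / M)) powr s" using \<delta> s by (intro powr_mono2) auto
  also have "\<dots> = M powr s * exp (\<delta> * (s / M))" using M by (simp add: powr_mult exp_powr_real mult_ac)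
  also have "\<dots> \<le> M powr s * exp (\<delta> * (q / 2))"
  proof -
    have "2 * s \<le> M * q" using M q by (simp add: field_simps)
    then have "s / M \<le> q / 2" using M by (simp add: field_simps)
    then have "\<delta> * (s / M) \<le> \<delta> * (q / 2)" using \<delta> by (intro mult_left_mono)
    then show ?thesis by (intro mult_left_mono) auto
  qed
  finally have 1: "(1 + \<delta>) powr s \<le> M powr s * exp (\<delta> * (q / 2))" .
  have "(1 + r) * (1 + \<delta>) = 1 + \<rho> + r * \<delta>" by (simp add: \<delta>_def algebra_simps)
  moreover have "r * \<delta> \<ge> 0" using r \<delta> by simp
  ultimately have "1 + \<rho> \<le> (1 + r) * (1 + \<delta>)" by linarith
  then have "(1 + \<rho>) powr s \<le> ((1 + r) * (1 + \<delta>)) powr s" using r s by (intro powr_mono2) auto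
  also have "\<dots> = (1 + r) powr s * (1 + \<delta>) powr s" using r \<delta> by (simp add: powr_mult)
  also have "\<dots> \<le> (1 + r) powr s * (M powr s * exp (\<delta> * (q / 2)))"
    using 1 by (intro mult_left_mono) auto
  finally have 2: "(1 + r) powr (- s) \<le> M powr s * exp (\<delta> * (q / 2)) * (1 + \<rho>) powr (- s)"
    using r by (simp add: powr_minus field_simps)
  have "(1 + r) powr (- s) * exp (q * r) \<le> M powr s * exp (\<delta> * (q / 2)) * (1 + \<rho>) powr (- s) * exp (q * r)"
    using 2 by (intro mult_right_mono) auto
  also have "exp (\<delta> * (q / 2)) * exp (q * r) = exp (q * \<rho>) * exp (- (q / 2) * (\<rho> - r))"
    unfolding exp_add[symmetric] \<delta>_def by (simp add: field_simps)
  then have "M powr s * exp (\<delta> * (q / 2)) * (1 + \<rho>) powr (- s) * exp (q * r)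
     = M powr s * ((1 + \<rho>) powr (- s) * exp (q * \<rho>) * exp (- (q / 2) * (\<rho> - r)))"
    by (simp add: mult_ac)
  finally show ?thesis by (simp add: M_def)
qed

text \<open>In the exponent, N - 1 is the size of the boundary sphere and (N - 1) q/2 the q-th power
  of the decay of the eigenfunction there.\<close>

lemma wave_eigen_Lq_norm:
  fixes q :: real
  assumes q: "q > 0"
  obtains C where "C > 0" "\<And>\<rho>. \<rho> \<ge> 0 \<Longrightarrow>
    (\<integral>\<^sup>+(x::'a::euclidean_space). ennreal (wave_eigen x powr q) * indicator (cball 0 \<rho>) x \<partial>lborel)
      \<le> ennreal (C * (1 + \<rho>) powr (real DIM('a) - 1 - (real DIM('a) - 1) * q / 2) * exp (q * \<rho>))"
proof -
  obtain C1 where C1: "C1 > 0" and dec: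
    "\<And>x::'a. wave_eigen x \<le> C1 * (1 + norm x) powr (- ((real DIM('a) - 1) / 2)) * exp (norm x)"
    using wave_eigen_decay by blast
  obtain C2 where C2: "C2 > 0" and dep: "\<And>\<rho>. \<rho> \<ge> 0 \<Longrightarrow>
    (\<integral>\<^sup>+(x::'a). ennreal (exp (- (q / 2) * (\<rho> - norm x))) * indicator (cball 0 \<rho>) x \<partial>lborel)
      \<le> ennreal (C2 * \<rho> ^ (DIM('a) - 1))"
    using nn_integral_exp_depth[of "q / 2"] q by auto
  define s where "s = (real DIM('a) - 1) * q / 2"
  have d1: "real DIM('a) - 1 = real (DIM('a) - 1)" using DIM_positive[where 'a='a] by (simp add: of_nat_diff Suc_leI)
  have s: "s \<ge> 0" unfolding s_def d1 using q by simp
  define K where "K = C1 powr q * max 1 (2 * s / q) powr s"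
  have K: "K > 0" using C1 by (simp add: K_def)
  have [measurable]: "cball (0::'a) r \<in> sets borel" for r by simp
  have "(\<integral>\<^sup>+(x::'a). ennreal (wave_eigen x powr q) * indicator (cball 0 \<rho>) x \<partial>lborel)
      \<le> ennreal (K * C2 * (1 + \<rho>) powr (real DIM('a) - 1 - s) * exp (q * \<rho>))" if \<rho>: "\<rho> \<ge> 0" for \<rho>
  proof -
    define L where "L = K * ((1 + \<rho>) powr (- s) * exp (q * \<rho>))"
    have L: "L \<ge> 0" using K by (simp add: L_def)
    have pt: "ennreal (wave_eigen x powr q) * indicator (cball 0 \<rho>) x
       \<le> ennreal L * (ennreal (exp (- (q / 2) * (\<rho> - norm x))) * indicator (cball 0 \<rho>) x)" for x :: 'a
    proof (cases "x \<in> cball 0 \<rho>")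
      case True
      then have r: "norm x \<le> \<rho>" by simp
      have "wave_eigen x powr q \<le> (C1 * (1 + norm x) powr (- ((real DIM('a) - 1) / 2)) * exp (norm x)) powr q"
        using dec[of x] wave_eigen_pos[of x] q by (intro powr_mono2) auto
      also have "\<dots> = C1 powr q * ((1 + norm x) powr (- s) * exp (q * norm x))"
        using C1 by (simp add: powr_mult powr_powr exp_powr_real s_def mult_ac)
      also have "\<dots> \<le> C1 powr q * (max 1 (2 * s / q) powr s *
         ((1 + \<rho>) powr (- s) * exp (q * \<rho>) * exp (- (q / 2) * (\<rho> - norm x))))"
        using power_exp_depth[OF s q _ r] by (intro mult_left_mono) auto
      also have "\<dots> = L * exp (- (q / 2) * (\<rho> - norm x))" by (simp add: L_def K_def mult_ac)
      finally show ?thesis using True L by (simp add: ennreal_mult'[symmetric] ennreal_leI)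
    qed simp
    have "(\<integral>\<^sup>+(x::'a). ennreal (wave_eigen x powr q) * indicator (cball 0 \<rho>) x \<partial>lborel)
       \<le> (\<integral>\<^sup>+(x::'a). ennreal L * (ennreal (exp (- (q / 2) * (\<rho> - norm x))) * indicator (cball 0 \<rho>) x) \<partial>lborel)"
      by (rule nn_integral_mono) (rule pt)
    also have "\<dots> = ennreal L * (\<integral>\<^sup>+(x::'a). (ennreal (exp (- (q / 2) * (\<rho> - norm x))) * indicator (cball 0 \<rho>) x) \<partial>lborel)"
      by (rule nn_integral_cmult) measurable
    also have "\<dots> \<le> ennreal L * ennreal (C2 * \<rho> ^ (DIM('a) - 1))"
      by (intro mult_left_mono dep \<rho>) auto
    also have "\<dots> = ennreal (L * (C2 * \<rho> ^ (DIM('a) - 1)))" using L by (simp add: ennreal_mult')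
    also have "\<dots> \<le> ennreal (L * (C2 * (1 + \<rho>) powr (real DIM('a) - 1)))"
    proof (intro ennreal_leI mult_left_mono L)
      have "\<rho> ^ (DIM('a) - 1) \<le> (1 + \<rho>) ^ (DIM('a) - 1)" using \<rho> by (intro power_mono) auto
      also have "\<dots> = (1 + \<rho>) powr (real DIM('a) - 1)" unfolding d1 using \<rho> by (simp only: powr_realpow)
      finally show "\<rho> ^ (DIM('a) - 1) \<le> (1 + \<rho>) powr (real DIM('a) - 1)" .
    qed (use C2 in auto)
    also have "L * (C2 * (1 + \<rho>) powr (real DIM('a) - 1))
        = K * C2 * (1 + \<rho>) powr (real DIM('a) - 1 - s) * exp (q * \<rho>)"
      using \<rho> by (simp add: L_def diff_conv_add_uminus[of _ s] powr_add mult_ac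
          del: add_uminus_conv_diff)
    finally show ?thesis .
  qed
  then show ?thesis using that[of "K * C2"] K C2 by (simp add: s_def)
qed

section \<open>Ordinary differential inequalities\<close>

lemma set_integral_FTC:
  fixes F f :: "real \<Rightarrow> real"
  assumes "a \<le> b" "\<And>x. x \<in> {a..b} \<Longrightarrow> (F has_real_derivative f x) (at x within {a..b})"
    "continuous_on {a..b} f"
  shows "(LINT x:{a..b}|lborel. f x) = F b - F a"
  using integral_FTC_atLeastAtMost[OF assms(1) _ assms(3), of F] assms(2)
  by (simp add: set_lebesgue_integral_def has_real_derivative_iff_has_vector_derivative)

lemma set_integral_nonneg_on:
  fixes f :: "'a \<Rightarrow> real"
  assumes "\<And>x. x \<in> A \<Longrightarrow> 0 \<le> f x" shows "0 \<le> (LINT x:A|M. f x)"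
  unfolding set_lebesgue_integral_def using assms by (intro integral_nonneg_AE) (auto simp: indicator_def)

lemma derivative_ge_imp_increment_ge:
  fixes F f :: "real \<Rightarrow> real"
  assumes ab: "a \<le> b" and F: "\<And>x. x \<in> {a..b} \<Longrightarrow> (F has_real_derivative f x) (at x within {a..b})"
    and f: "continuous_on {a..b} f" and c: "\<And>x. x \<in> {a..b} \<Longrightarrow> c \<le> f x"
  shows "c * (b - a) \<le> F b - F a"
proof -
  have "(LINT x:{a..b}|lborel. f x - c) = (F b - c * b) - (F a - c * a)"
    using F f by (intro set_integral_FTC[OF ab]) (auto intro!: derivative_eq_intros continuous_intros)
  moreover have "(LINT x:{a..b}|lborel. f x - c) \<ge> 0" by (intro set_integral_nonneg_on) (simp add: c)
  ultimately show ?thesis by (simp add: algebra_simps)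
qed

section \<open>Growth of the weighted mean by comparison\<close>

definition wave_weight :: "real \<Rightarrow> real \<Rightarrow> real \<Rightarrow> real" where
  "wave_weight b c t = exp (1 + t + c / (1 + t)) * (1 + t) powr b"

lemma wave_weight_pos: "t > -1 \<Longrightarrow> wave_weight b c t > 0"
  by (simp add: wave_weight_def)

lemma wave_weight_deriv:
  assumes "t > -1"
  shows "(wave_weight b c has_real_derivative
     (1 - c / (1 + t)\<^sup>2 + b / (1 + t)) * wave_weight b c t) (at t within S)"
proof -
  have p: "(1 + t) powr (b - 1) = (1 + t) powr b / (1 + t)" using assms by (simp add: powr_diff)
  have "((\<lambda>t. exp (1 + t + c / (1 + t))) has_real_derivative
      exp (1 + t + c / (1 + t)) * (1 - c / (1 + t)\<^sup>2)) (at t within S)"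
    using assms by (auto intro!: derivative_eq_intros simp: power2_eq_square)
  moreover have "((\<lambda>t. (1 + t) powr b) has_real_derivative b * ((1 + t) powr b / (1 + t))) (at t within S)"
    using assms by (auto intro!: derivative_eq_intros simp: p)
  ultimately show ?thesis unfolding wave_weight_def[abs_def]
    using DERIV_mult by (fastforce simp: algebra_simps)
qed

text \<open>With \<open>\<tau> = 1 + t\<close> and \<open>h = exp (\<tau> + c/\<tau>) \<tau>\<^sup>-\<^sup>b\<close>, \<open>b = \<mu>/2\<close>, the choice of \<open>c\<close> makes
  \<open>h'' + \<mu>/\<tau> h' \<le> h\<close> for \<open>\<tau> \<ge> \<surd>c\<close> while \<open>h' \<le> 0\<close> at \<open>\<tau> = \<surd>c\<close>; so the Wronskian of \<open>G\<close> and \<open>h\<close>,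
  weighted by \<open>\<tau>\<^sup>\<mu>\<close>, starts nonnegative and increases. Here \<open>wave_weight b c = \<tau>\<^sup>\<mu> h\<close> and
  \<open>(1 - b/\<tau> - c/\<tau>\<^sup>2) wave_weight b c = \<tau>\<^sup>\<mu> h'\<close>.\<close>

lemma wave_growth:
  fixes G G' :: "real \<Rightarrow> real" and b E :: real
  defines "c \<equiv> (3 + b)\<^sup>2"
  assumes b: "b > 0"
    and G: "\<And>t. t \<in> {0..E} \<Longrightarrow> (G has_real_derivative G' t) (at t within {0..E})"
    and G'c: "continuous_on {0..E} G'"
    and G0: "G 0 > 0" and G'0: "G' 0 \<ge> 0"
    and i: "\<And>t. t \<in> {0..E} \<Longrightarrow>
       (1 + t) powr (2 * b) * G' t - G' 0 \<ge> (LINT s:{0..t}|lborel. (1 + s) powr (2 * b) * G s)"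
    and ii: "\<And>s t. 0 \<le> s \<Longrightarrow> s \<le> t \<Longrightarrow> t \<le> E \<Longrightarrow>
       wave_weight b c t * G' t - wave_weight b c s * G' s \<ge>
         (LINT r:{s..t}|lborel. (1 - b / (1 + r) - c / (1 + r)\<^sup>2) * wave_weight b c r * G' r
            + wave_weight b c r * G r)"
    and t: "2 + b \<le> t" "t \<le> E"
  shows "G t \<ge> G 0 / wave_weight (- b) c (2 + b) * (exp t * (1 + t) powr (- b))"
proof -
  have Gc: "continuous_on {0..E} G" using G by (rule DERIV_continuous_on)
  have G'pos: "G' s \<ge> 0" if "s \<in> {0..E}" "\<And>r. r \<in> {0..s} \<Longrightarrow> G r \<ge> 0" for s
  proof -
    have "(LINT r:{0..s}|lborel. (1 + r) powr (2 * b) * G r) \<ge> 0"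
      using that by (intro set_integral_nonneg_on mult_nonneg_nonneg) auto
    then have "(1 + s) powr (2 * b) * G' s \<ge> 0" using i[OF that(1)] G'0 by linarith
    then show ?thesis using that(1) by (simp add: zero_le_mult_iff)
  qed
  have sub: "(G has_real_derivative G' r) (at r within {x..y})" if "0 \<le> x" "y \<le> E" "r \<in> {x..y}" for r x y
    by (rule DERIV_subset[OF G]) (use that in auto)
  have subc: "continuous_on {x..y} G'" if "0 \<le> x" "y \<le> E" for x y
    using G'c by (rule continuous_on_subset) (use that in auto)
  \<comment> \<open>Before the first point z with G z \<le> 0, assumption \<open>i\<close> gives G'
    \<ge> 0, so G z \<ge> G 0 > 0: there is no such point.\<close>
  have Gpos: "G s > 0" if s: "s \<in> {0..E}" for s
  proof (rule ccontr)
    assume "\<not> G s > 0"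
    define Z where "Z = {0..E} \<inter> G -` {..0}"
    have "compact Z" unfolding Z_def
      by (metis Gc closed_atMost compact_Icc compact_Int_closed continuous_on_closed_vimage
          closed_atLeastAtMost Int_absorb Int_assoc Int_commute)
    moreover have "s \<in> Z" using s \<open>\<not> G s > 0\<close> by (auto simp: Z_def)
    ultimately obtain z where z: "z \<in> Z" "\<And>y. y \<in> Z \<Longrightarrow> z \<le> y"
      using compact_attains_inf[of Z] by blast
    have before: "G r > 0" if "r \<in> {0..<z}" for r
    proof (rule ccontr)
      assume "\<not> ?thesis"
      then have "r \<in> Z" using that z(1) by (auto simp: Z_def)
      then show False using z(2) that by fastforce
    qed
    have z0: "z \<in> {0..E}" "G z \<le> 0" using z(1) by (auto simp: Z_def)
    have "G 0 \<le> G z"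
    proof (cases "z = 0")
      case False
      then have "0 < z" using z0 by auto
      then obtain x where x: "x \<in> {0<..<z}" "G z - G 0 = G' x * (z - 0)"
        using mvt_simple[of 0 z G "\<lambda>x y. G' x * y"] sub[of 0 z] z0
        by (auto simp: has_field_derivative_def)
      have "0 \<le> G' x" using x z0 by (intro G'pos) (auto intro!: less_imp_le[OF before])
      then have "0 \<le> G' x * (z - 0)" using \<open>0 < z\<close> by simp
      then show ?thesis using x(2) by linarith
    qed simp
    then show False using z0 G0 by simp
  qed
  have G'nn: "G' s \<ge> 0" if "s \<in> {0..E}" for s
    using that Gpos by (intro G'pos) (auto intro: less_imp_le)
  \<comment> \<open>The time at which 1 + t is the square root of c; there the first and last terms
    of 1 - b/\<tau> - c/\<tau>^2 cancel.\<close>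
  define ts where "ts = 2 + b"
  have ts: "ts \<ge> 0" "ts \<le> E" "1 + ts = 3 + b" using b t by (auto simp: ts_def)
  define l where "l = wave_weight b c"
  define m where "m r = (1 - b / (1 + r) - c / (1 + r)\<^sup>2) * l r" for r
  define l' where "l' r = (1 - c / (1 + r)\<^sup>2 + b / (1 + r)) * l r" for r
  define m' where "m' r = (b / (1 + r)\<^sup>2 + 2 * c / (1 + r) ^ 3) * l r + (1 - b / (1 + r) - c / (1 + r)\<^sup>2) * l' r" for r
  have lpos: "l r > 0" if "r \<ge> 0" for r using wave_weight_pos[of r b c] that by (simp add: l_def)
  have ld: "(l has_real_derivative l' r) (at r within S)" if "r \<ge> 0" for r S
    unfolding l_def l'_def using wave_weight_deriv[of r b c S] that by simp
  have md: "(m has_real_derivative m' r) (at r within S)" if "r \<ge> 0" for r S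
  proof -
    have x: "1 + r > 0" using that by simp
    have A: "((\<lambda>r. b / (1 + r)) has_real_derivative - (b / (1 + r)\<^sup>2)) (at r within S)"
      using x by (auto intro!: derivative_eq_intros simp: power2_eq_square)
    have B: "((\<lambda>r. c / (1 + r)\<^sup>2) has_real_derivative - (c * (2 * (1 + r)) / ((1 + r)\<^sup>2 * (1 + r)\<^sup>2))) (at r within S)"
      using x by (auto intro!: derivative_eq_intros)
    have e: "c * (2 * (1 + r)) / ((1 + r)\<^sup>2 * (1 + r)\<^sup>2) = 2 * c / (1 + r) ^ 3"
    proof -
      have "(1 + r)\<^sup>2 * (1 + r)\<^sup>2 = (1 + r) ^ 3 * (1 + r)" by (simp add: power2_eq_square power3_eq_cube)
      moreover have "c * (2 * (1 + r)) = (2 * c) * (1 + r)" by simp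
      ultimately show ?thesis using x by (simp only: mult_divide_mult_cancel_right)
    qed
    have "((\<lambda>r. 1 - b / (1 + r) - c / (1 + r)\<^sup>2) has_real_derivative (b / (1 + r)\<^sup>2 + 2 * c / (1 + r) ^ 3)) (at r within S)"
      using DERIV_diff[OF DERIV_diff[OF DERIV_const[of 1] A] B] unfolding e by simp
    from DERIV_mult[OF this ld[OF that]] show ?thesis
      unfolding m_def[abs_def] m'_def by (simp add: mult_ac add.commute)
  qed
  \<comment> \<open>Divided by l, the left side is 1 + (b - b^2 + 2 c/x - 2 c + (c/x)^2)/x^2. For x
    \<ge> 3 + b one has c/x \<le> 3 + b, and then c = (3 + b)^2 makes the bracket at most -3 - 3 b -
    2 b^2. This dictates the choice of c.\<close>
  have m'le: "m' r \<le> l r" if r: "r \<ge> ts" for r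
  proof -
    define x where "x = 1 + r"
    have x: "x \<ge> 3 + b" "x > 0" using r ts b by (auto simp: x_def)
    have e: "m' r = (b / x\<^sup>2 + 2 * c / x ^ 3 + (1 - b / x - c / x\<^sup>2) * (1 - c / x\<^sup>2 + b / x)) * l r"
      by (simp only: m'_def l'_def x_def distrib_right mult.assoc)
    have "c / x \<le> 3 + b" using x b unfolding c_def
      by (simp add: power2_eq_square divide_le_eq mult_left_mono)
    moreover have "c / x * (c / x) \<le> (3 + b) * (3 + b)"
      using calculation x b by (intro mult_mono) (auto simp: c_def)
    ultimately have "b - b\<^sup>2 + 2 * (c / x) - 2 * c + (c / x)\<^sup>2 \<le> b - b\<^sup>2 + 2 * (3 + b) - 2 * c + c"
      by (simp add: power2_eq_square c_def)
    also have "\<dots> = - 3 - 3 * b - 2 * b\<^sup>2" by (simp add: c_def power2_eq_square algebra_simps)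
    also have "\<dots> \<le> 0" using b zero_le_power2[of b] by linarith
    finally have "(b - b\<^sup>2 + 2 * (c / x) - 2 * c + (c / x)\<^sup>2) / x\<^sup>2 \<le> 0"
      by (simp add: divide_nonpos_nonneg)
    moreover have "b / x\<^sup>2 + 2 * c / x ^ 3 + (1 - b / x - c / x\<^sup>2) * (1 - c / x\<^sup>2 + b / x)
       = 1 + (b - b\<^sup>2 + 2 * (c / x) - 2 * c + (c / x)\<^sup>2) / x\<^sup>2"
      using x by (simp add: field_simps power2_eq_square power3_eq_cube)
    ultimately show ?thesis unfolding e using lpos[of r] r ts by (simp add: mult_le_cancel_right2)
  qed
  have lc: "continuous_on {x..y} l" "continuous_on {x..y} m" if "0 \<le> x" for x y
    by (rule DERIV_continuous_on[OF ld], use that in auto)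
       (rule DERIV_continuous_on[OF md], use that in auto)
  have l'c: "continuous_on {x..y} l'" if "0 \<le> x" for x y
    unfolding l'_def[abs_def] using that by (intro continuous_intros lc) auto
  have m'c: "continuous_on {x..y} m'" if "0 \<le> x" for x y
    unfolding m'_def[abs_def] using that by (intro continuous_intros lc l'c) auto
  have subGc: "continuous_on {x..y} G" if "0 \<le> x" "y \<le> E" for x y
    using Gc by (rule continuous_on_subset) (use that in auto)
  have W: "l s * G' s - m s * G s \<ge> 0" if s: "ts \<le> s" "s \<le> E" for s
  proof -
    have c': "continuous_on {ts..s} G" "continuous_on {ts..s} G'" "continuous_on {ts..s} l"
      "continuous_on {ts..s} m" "continuous_on {ts..s} m'"
      using subGc subc lc m'c ts s by auto
    \<comment> \<open>The product rule for m G, with m' \<le> l, is set against the increment of l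
      G' in assumption \<open>ii\<close>: together they show that l G' - m G does not fall below its
      value at ts.\<close>
    have "(LINT r:{ts..s}|lborel. m' r * G r + m r * G' r) = m s * G s - m ts * G ts"
    proof (rule set_integral_FTC)
      show "((\<lambda>r. m r * G r) has_real_derivative m' x * G x + m x * G' x) (at x within {ts..s})"
        if "x \<in> {ts..s}" for x
        using DERIV_mult[OF md sub] that s ts by (auto simp: mult_ac add.commute)
      show "continuous_on {ts..s} (\<lambda>r. m' r * G r + m r * G' r)"
        by (intro continuous_intros c')
    qed (use s in auto)
    moreover have "(LINT r:{ts..s}|lborel. m' r * G r + m r * G' r) \<le> (LINT r:{ts..s}|lborel. m r * G' r + l r * G r)"
    proof (rule set_integral_mono)
      show "set_integrable lborel {ts..s} (\<lambda>r. m' r * G r + m r * G' r)"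
        by (intro borel_integrable_atLeastAtMost' continuous_intros c')
      show "set_integrable lborel {ts..s} (\<lambda>r. m r * G' r + l r * G r)"
        by (intro borel_integrable_atLeastAtMost' continuous_intros c')
      show "m' r * G r + m r * G' r \<le> m r * G' r + l r * G r" if "r \<in> {ts..s}" for r
        using m'le[of r] Gpos[of r] that s ts mult_right_mono[of "m' r" "l r" "G r"] by auto
    qed
    moreover have "l s * G' s - l ts * G' ts \<ge> (LINT r:{ts..s}|lborel. m r * G' r + l r * G r)"
      using ii[of ts s] s ts by (simp add: l_def m_def)
    moreover have "l ts * G' ts - m ts * G ts \<ge> 0"
    proof -
      have "m ts \<le> 0" unfolding m_def ts(3) c_def using b lpos[OF ts(1)] by (simp add: mult_le_0_iff)
      then have "m ts * G ts \<le> 0" using Gpos[of ts] ts by (simp add: mult_le_0_iff)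
      moreover have "l ts * G' ts \<ge> 0" using G'nn[of ts] lpos[OF ts(1)] ts by simp
      ultimately show ?thesis by linarith
    qed
    ultimately show ?thesis by linarith
  qed
  define h where "h = wave_weight (- b) c"
  have hl: "h r = l r * (1 + r) powr (- 2 * b)" if "r \<ge> 0" for r
    unfolding h_def l_def wave_weight_def using that by (simp add: powr_add[symmetric])
  have hpos: "h r > 0" if "r \<ge> 0" for r using wave_weight_pos[of r "- b" c] that by (simp add: h_def)
  define h' where "h' r = (1 - c / (1 + r)\<^sup>2 + (- b) / (1 + r)) * h r" for r
  have hd: "(h has_real_derivative h' r) (at r within S)" if "r \<ge> 0" for r S
    unfolding h_def h'_def using wave_weight_deriv[of r "- b" c S] that by simp
  have hm: "h' r = m r * (1 + r) powr (- 2 * b)" if "r \<ge> 0" for r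
    using hl[OF that] by (simp add: h'_def m_def)
  have hc: "continuous_on {ts..t} h" by (rule DERIV_continuous_on[OF hd]) (use ts in auto)
  \<comment> \<open>From ts on, G/h is nondecreasing: its derivative is the Wronskian times (1 +
    x)^(-2b), divided by h^2.\<close>
  have "0 * (t - ts) \<le> G t / h t - G ts / h ts"
  proof (rule derivative_ge_imp_increment_ge)
    fix x assume x: "x \<in> {ts..t}"
    then have x0: "x \<ge> 0" using ts by auto
    show "((\<lambda>r. G r / h r) has_real_derivative (G' x * h x - G x * h' x) / (h x * h x)) (at x within {ts..t})"
      using DERIV_divide[OF sub hd[OF x0]] x ts t hpos[OF x0] by auto
    have "G' x * h x - G x * h' x = (1 + x) powr (- 2 * b) * (l x * G' x - m x * G x)"
      using hl[OF x0] hm[OF x0] by (simp add: algebra_simps)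
    then show "0 \<le> (G' x * h x - G x * h' x) / (h x * h x)"
      using W[of x] x t by (auto intro!: divide_nonneg_nonneg)
  next
    have "h x \<noteq> 0" if "x \<in> {ts..t}" for x using hpos[of x] that ts by auto
    moreover have "continuous_on {ts..t} h'"
      unfolding h'_def[abs_def] using ts by (intro continuous_intros hc) auto
    ultimately show "continuous_on {ts..t} (\<lambda>x. (G' x * h x - G x * h' x) / (h x * h x))"
      using subGc subc ts t hc by (intro continuous_intros) auto
  qed (use t ts in \<open>auto simp: ts_def\<close>)
  then have 1: "G ts / h ts * h t \<le> G t" using hpos[of t] t b by (simp add: field_simps)
  have 2: "G 0 \<le> G ts"
    using derivative_ge_imp_increment_ge[of 0 ts G G' 0] sub subc ts G'nn by auto
  have 3: "exp t * (1 + t) powr (- b) \<le> h t"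
    unfolding h_def wave_weight_def using t b by (intro mult_right_mono) (auto simp: c_def)
  have "G 0 / h ts * (exp t * (1 + t) powr (- b)) \<le> G ts / h ts * h t"
    using 2 3 hpos[OF ts(1)] G0 by (intro mult_mono divide_right_mono) auto
  with 1 show ?thesis by (simp add: h_def ts_def)
qed


text \<open>This is \<open>F'' + \<mu> / (1 + t) F' = K\<close>, multiplied by \<open>(1 + t)\<^sup>\<mu>\<close> and integrated once, so that
  \<open>K\<close> need not be continuous.\<close>

definition damped_equation ::
  "real \<Rightarrow> real \<Rightarrow> (real \<Rightarrow> real) \<Rightarrow> (real \<Rightarrow> real) \<Rightarrow> (real \<Rightarrow> real) \<Rightarrow> bool" where
  "damped_equation \<mu> E F F' K \<longleftrightarrow>
     (\<forall>t\<in>{0..E}. (F has_real_derivative F' t) (at t within {0..E})) \<and>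
     continuous_on {0..E} F' \<and> F 0 \<ge> 0 \<and> F' 0 \<ge> 0 \<and> (\<forall>s\<in>{0..E}. K s \<ge> 0) \<and>
     set_integrable lborel {0..E} (\<lambda>s. (1 + s) powr \<mu> * K s) \<and>
     (\<forall>t\<in>{0..E}. (1 + t) powr \<mu> * F' t - F' 0 = (LINT s:{0..t}|lborel. (1 + s) powr \<mu> * K s))"

text \<open>The first half of the time d builds up the velocity F', the second half turns it into
  displacement; each contributes a factor d/2. On {a..E} the values of 1 + s differ by a factor of
  at most 4, so the damping weight varies by at most 4^\<mu>.\<close>

lemma double_integration:
  assumes sys: "damped_equation \<mu> E F F' K"
    and \<mu>: "\<mu> \<ge> 0" and a: "0 \<le> a" and d: "0 < d" and aE: "1 + E \<le> 4 * (1 + a)" and k: "\<kappa> \<ge> 0"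
    and Kk: "AE s in lborel. s \<in> {a..E} \<longrightarrow> \<kappa> \<le> K s"
    and t: "t \<in> {a + d..E}"
  shows "F t \<ge> 4 powr (- \<mu>) * (d / 2)\<^sup>2 * \<kappa>"
proof -
  have F: "\<And>t. t \<in> {0..E} \<Longrightarrow> (F has_real_derivative F' t) (at t within {0..E})"
    and F'c: "continuous_on {0..E} F'" and F0: "F 0 \<ge> 0" and F'0: "F' 0 \<ge> 0"
    and K: "\<And>s. s \<in> {0..E} \<Longrightarrow> K s \<ge> 0"
    and Ki: "set_integrable lborel {0..E} (\<lambda>s. (1 + s) powr \<mu> * K s)"
    and id: "\<And>t. t \<in> {0..E} \<Longrightarrow> (1 + t) powr \<mu> * F' t - F' 0 = (LINT s:{0..t}|lborel. (1 + s) powr \<mu> * K s)"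
    using sys by (auto simp: damped_equation_def)
  have sub: "(F has_real_derivative F' r) (at r within {x..y})" if "0 \<le> x" "y \<le> E" "r \<in> {x..y}" for r x y
    by (rule DERIV_subset[OF F]) (use that in auto)
  have subc: "continuous_on {x..y} F'" if "0 \<le> x" "y \<le> E" for x y
    using F'c by (rule continuous_on_subset) (use that in auto)
  have F'nn: "F' s \<ge> 0" if "s \<in> {0..E}" for s
  proof -
    have "(LINT r:{0..s}|lborel. (1 + r) powr \<mu> * K r) \<ge> 0"
      using that K by (intro set_integral_nonneg_on mult_nonneg_nonneg) auto
    then have "(1 + s) powr \<mu> * F' s \<ge> 0" using id[OF that] F'0 by linarith
    then show ?thesis using that by (simp add: zero_le_mult_iff)
  qed
  define c where "c = 4 powr (- \<mu>) * (d / 2) * \<kappa>"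
  have F'c': "F' s \<ge> c" if s: "s \<in> {a + d / 2..t}" for s
  proof -
    have sE: "s \<in> {0..E}" "a \<le> s" using s t a d by auto
    have int: "set_integrable lborel {0..s} (\<lambda>s. (1 + s) powr \<mu> * K s)"
      "set_integrable lborel {a..s} (\<lambda>s. (1 + s) powr \<mu> * K s)"
      using sE a by (auto intro: set_integrable_subset[OF Ki])
    have "(1 + a) powr \<mu> * \<kappa> * (d / 2) \<le> (1 + a) powr \<mu> * \<kappa> * (s - a)"
      using s k by (intro mult_left_mono) auto
    also have "\<dots> = (LINT r:{a..s}|lborel. (1 + a) powr \<mu> * \<kappa>)"
      using sE by (simp add: set_lebesgue_integral_def)
    also have "\<dots> \<le> (LINT r:{a..s}|lborel. (1 + r) powr \<mu> * K r)"
    proof (rule set_integral_mono_AE[OF _ int(2)])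
      show "set_integrable lborel {a..s} (\<lambda>r. (1 + a) powr \<mu> * \<kappa>)"
        by (intro borel_integrable_atLeastAtMost' continuous_intros)
      show "AE x\<in>{a..s} in lborel. (1 + a) powr \<mu> * \<kappa> \<le> (1 + x) powr \<mu> * K x"
        using Kk
      proof eventually_elim
        case (elim x)
        then show ?case using sE a \<mu> k by (auto intro!: mult_mono powr_mono2)
      qed
    qed
    also have "\<dots> \<le> (LINT r:{0..s}|lborel. (1 + r) powr \<mu> * K r)"
      unfolding set_lebesgue_integral_def
    proof (rule integral_mono_AE)
      show "AE r in lborel. indicat_real {a..s} r *\<^sub>R ((1 + r) powr \<mu> * K r)
          \<le> indicat_real {0..s} r *\<^sub>R ((1 + r) powr \<mu> * K r)"
        using a sE K by (auto simp: indicator_def intro!: AE_I2 mult_nonneg_nonneg)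
    qed (use int in \<open>auto simp: set_integrable_def\<close>)
    also have "\<dots> \<le> (1 + s) powr \<mu> * F' s" using id[OF sE(1)] F'0 by simp
    also have "\<dots> \<le> (4 * (1 + a)) powr \<mu> * F' s"
      using aE sE \<mu> F'nn[OF sE(1)] by (intro mult_right_mono powr_mono2) auto
    also have "\<dots> = (1 + a) powr \<mu> * (4 powr \<mu> * F' s)" by (subst powr_mult) simp
    finally have "\<kappa> * (d / 2) \<le> 4 powr \<mu> * F' s" using a by (simp add: mult.assoc)
    then show ?thesis unfolding c_def by (simp add: powr_minus field_simps)
  qed
  have "F 0 \<le> F (a + d / 2)"
    using derivative_ge_imp_increment_ge[of 0 "a + d / 2" F F' 0] sub subc F'nn a d t by auto
  moreover have "c * (t - (a + d / 2)) \<le> F t - F (a + d / 2)"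
    using sub subc F'c' a d t by (intro derivative_ge_imp_increment_ge[where f = F']) auto
  moreover have "c * (d / 2) \<le> c * (t - (a + d / 2))"
    using t d k by (intro mult_left_mono) (auto simp: c_def)
  moreover have "c * (d / 2) = 4 powr (- \<mu>) * (d / 2)\<^sup>2 * \<kappa>" by (simp add: c_def power2_eq_square)
  ultimately show ?thesis using F0 by linarith
qed

section \<open>Iteration and the resulting bound on the lifespan\<close>

lemma powr_comparable:
  fixes x y a :: real
  assumes "y > 0" "y / 4 \<le> x" "x \<le> 4 * y"
  shows "x powr a \<ge> 4 powr (- \<bar>a\<bar>) * y powr a"
proof (cases "a \<ge> 0")
  case True
  have "4 powr (- \<bar>a\<bar>) * y powr a = (y / 4) powr a"
    using assms True by (simp add: powr_divide powr_minus field_simps)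
  also have "\<dots> \<le> x powr a" using assms True by (intro powr_mono2) auto
  finally show ?thesis .
next
  case False
  have "4 powr (- \<bar>a\<bar>) * y powr a = (4 * y) powr a" using assms False by (simp add: powr_mult)
  also have "\<dots> \<le> x powr a" using assms False by (intro powr_mono2') auto
  finally show ?thesis .
qed

text \<open>On \<open>{E/2..E}\<close> the two lower bounds for \<open>K\<close> are iterated on the intervals
  \<open>{E - E/2 * 2\<^sup>-\<^sup>j..E}\<close>. If \<open>E\<close> exceeds the claimed bound, \<open>F\<close> is at least a fixed multiple of
  \<open>\<theta> ^ j\<close> there, with \<open>\<theta> > 1\<close>, for every \<open>j\<close>.\<close>

lemma lifespan_bound:
  fixes p \<mu> n C1 C2 t0 :: real
  assumes p: "p > 1" and \<mu>: "\<mu> \<ge> 0" and n: "n \<ge> 0" and C1: "C1 > 0" and C2: "C2 > 0" and t0: "t0 \<ge> 0"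
    and \<gamma>: "strauss_gamma p (n + \<mu>) > 0"
  obtains C where "C > 0"
    "\<And>E \<epsilon> F F' K. \<lbrakk>E > 0; 0 < \<epsilon>; \<epsilon> \<le> 1; damped_equation \<mu> E F F' K;
      AE s in lborel. s \<in> {0..E} \<longrightarrow> F s \<ge> 0 \<longrightarrow> K s \<ge> C1 * (1 + s) powr (- n * (p - 1)) * F s powr p;
      AE s in lborel. s \<in> {t0..E} \<longrightarrow> K s \<ge> C2 * \<epsilon> powr p * (1 + s) powr (n - 1 - (n + \<mu> - 1) * p / 2)\<rbrakk>
      \<Longrightarrow> E \<le> C * \<epsilon> powr (- 2 * p * (p - 1) / strauss_gamma p (n + \<mu>))"
proof -
  define g where "g = strauss_gamma p (n + \<mu>)"
  have g: "g > 0" using \<gamma> by (simp add: g_def)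
  define e where "e = n - 1 - (n + \<mu> - 1) * p / 2"
  define q where "q = p - 1"
  have q: "q > 0" using p by (simp add: q_def)
  \<comment> \<open>The base step uses d = E/4 and step j uses d = E/4 times 2^(-j), so (d/2)^2 is
    E^2/64, in step j reduced by 4^(-j). The powers of 4 with absolute values replace 1 + s by E on
    {E/4..E}.\<close>
  define c0 where "c0 = 4 powr (- \<mu>) * (C2 * 4 powr (- \<bar>e\<bar>)) / 64"
  define c1 where "c1 = 4 powr (- \<mu>) * (C1 * 4 powr (- \<bar>n * q\<bar>)) / 64"
  have c: "c0 > 0" "c1 > 0" using C1 C2 by (auto simp: c0_def c1_def)
  \<comment> \<open>Shrinking the intervals costs 4^(-j) at step j. A bound growing like \<theta>^j
    gains \<theta>^(q j) from the power p = 1 + q, and \<theta>^q = 4 balances the loss.\<close>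
  define \<theta> where "\<theta> = (4::real) powr (1 / q)"
  have \<theta>: "\<theta> > 1" using q by (simp add: \<theta>_def)
  define M where "M = \<theta> / (c1 * c0 powr q)"
  have M: "M > 0" using c \<theta> by (simp add: M_def)
  define E0 where "E0 = 4 * (1 + t0)"
  define C where "C = E0 + M powr (2 / g)"
  have "C > 0" using t0 M by (simp add: C_def E0_def add_nonneg_pos)
  moreover have "E \<le> C * \<epsilon> powr (- 2 * p * (p - 1) / g)"
    if E: "E > 0" and \<epsilon>: "0 < \<epsilon>" "\<epsilon> \<le> 1"
      and sys: "damped_equation \<mu> E F F' K"
      and K1: "AE s in lborel. s \<in> {0..E} \<longrightarrow> F s \<ge> 0 \<longrightarrow> K s \<ge> C1 * (1 + s) powr (- n * (p - 1)) * F s powr p"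
      and K2: "AE s in lborel. s \<in> {t0..E} \<longrightarrow> K s \<ge> C2 * \<epsilon> powr p * (1 + s) powr (n - 1 - (n + \<mu> - 1) * p / 2)"
    for E \<epsilon> :: real and F F' K :: "real \<Rightarrow> real"
  proof -
    define X where "X = \<epsilon> powr (- 2 * p * (p - 1) / g)"
    \<comment> \<open>Here \<epsilon> \<le> 1 enters: with X \<ge> 1 the constant \<open>E0\<close>
      disposes of small E.\<close>
    have X1: "X \<ge> 1"
    proof -
      have "\<epsilon> powr (2 * p * (p - 1) / g) \<le> 1" using \<epsilon> p g by (intro powr_le1) auto
      then show ?thesis using \<epsilon> by (simp add: X_def powr_minus one_le_inverse_iff)
    qed
    show ?thesis
    proof (cases "E \<le> E0")
      case True
      also have "E0 \<le> C * 1" by (simp add: C_def)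
      also have "\<dots> \<le> C * X" using X1 \<open>C > 0\<close> by (intro mult_left_mono) auto
      finally show ?thesis by (simp add: X_def)
    next
      case False
      then have E4: "E \<ge> 4" "E / 4 \<ge> t0" using t0 by (auto simp: E0_def)
      note di = double_integration[OF sys \<mu>]
      have cmp: "(1 + s) powr a \<ge> 4 powr (- \<bar>a\<bar>) * E powr a" if "s \<in> {E/4..E}" for s a
        using that E4 by (intro powr_comparable) auto
      define B where "B = c0 * \<epsilon> powr p * E powr (e + 2)"
      have B: "B > 0" using c \<epsilon> E by (simp add: B_def)
      have base: "F t \<ge> B" if t: "t \<in> {E/2..E}" for t
      proof -
        have "F t \<ge> 4 powr (- \<mu>) * ((E / 4) / 2)\<^sup>2 * (C2 * \<epsilon> powr p * (4 powr (- \<bar>e\<bar>) * E powr e))"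
        proof (rule di[where a = "E/4"])
          show "AE s in lborel. s \<in> {E / 4..E} \<longrightarrow> C2 * \<epsilon> powr p * (4 powr - \<bar>e\<bar> * E powr e) \<le> K s"
            using K2
          proof eventually_elim
            case (elim s)
            show ?case
            proof
              assume s: "s \<in> {E/4..E}"
              have "C2 * \<epsilon> powr p * (4 powr - \<bar>e\<bar> * E powr e) \<le> C2 * \<epsilon> powr p * (1 + s) powr e"
                using C2 \<epsilon> cmp[OF s] by (intro mult_left_mono) auto
              then show "C2 * \<epsilon> powr p * (4 powr - \<bar>e\<bar> * E powr e) \<le> K s"
                using elim s E4 by (simp add: e_def)
            qed
          qed
        qed (use E4 C2 t in auto)
        also have "4 powr (- \<mu>) * ((E / 4) / 2)\<^sup>2 * (C2 * \<epsilon> powr p * (4 powr (- \<bar>e\<bar>) * E powr e)) = B"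
          using E by (simp add: B_def c0_def powr_add power2_eq_square)
        finally show ?thesis .
      qed
      define Q where "Q = c1 * E powr (2 - n * q)"
      have Q: "Q > 0" using c E by (simp add: Q_def)
      \<comment> \<open>The threshold of the iteration: a bound Y = L \<theta>^j is sent to Q L^q Y,
        and L^q Q = \<theta> makes this L \<theta>^(j+1).\<close>
      define L where "L = (\<theta> / Q) powr (1 / q)"
      have L: "L > 0" using Q \<theta> by (simp add: L_def)
      have LQ: "L powr q * Q = \<theta>" using Q \<theta> q by (simp add: L_def powr_powr)
      have BL: "B < L"
      proof (rule ccontr)
        assume "\<not> B < L"
        have iter: "F t \<ge> L * \<theta> ^ j" if "t \<in> {E - E/2 * (1/2) ^ j..E}" for j t
          using that
        proof (induction j arbitrary: t)
          case 0 then show ?case using base[of t] \<open>\<not> B < L\<close> by auto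
        next
          case (Suc j)
          define a where "a = E - E/2 * (1/2) ^ j"
          define d where "d = E/4 * (1/2) ^ j"
          have pj: "0 < (1/2::real) ^ j" "(1/2::real) ^ j \<le> 1" by (auto intro: power_le_one)
          have a: "E/2 \<le> a" "a \<le> E" "d > 0" "a + d = E - E/2 * (1/2) ^ Suc j"
            using pj E by (auto simp: a_def d_def)
          define Y where "Y = L * \<theta> ^ j"
          have Y: "Y > 0" using L \<theta> by (simp add: Y_def)
          have Yp: "Y powr p = Y * (L powr q * 4 ^ j)"
          proof -
            have "Y powr p = Y powr (1 + q)" by (simp add: q_def)
            also have "\<dots> = Y * Y powr q" using Y by (simp add: powr_add)
            also have "Y powr q = L powr q * (\<theta> powr q) ^ j"
              using L \<theta> by (simp add: Y_def powr_mult powr_realpow[symmetric] powr_powr mult.commute)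
            also have "\<theta> powr q = 4" using q by (simp add: \<theta>_def powr_powr)
            finally show ?thesis .
          qed
          have "F t \<ge> 4 powr (- \<mu>) * (d / 2)\<^sup>2 * (C1 * (4 powr (- \<bar>n * q\<bar>) * E powr (- n * q)) * Y powr p)"
          proof (rule di[where a = a])
            show "AE s in lborel. s \<in> {a..E} \<longrightarrow> C1 * (4 powr (- \<bar>n * q\<bar>) * E powr (- n * q)) * Y powr p \<le> K s"
              using K1
            proof eventually_elim
              case (elim s)
              show ?case
              proof
                assume s: "s \<in> {a..E}"
                have FY: "F s \<ge> Y" using Suc.IH[of s] s by (simp add: Y_def a_def)
                have "C1 * (4 powr (- \<bar>n * q\<bar>) * E powr (- n * q)) * Y powr p
                    \<le> C1 * (1 + s) powr (- n * q) * F s powr p"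
                  using C1 cmp[of s "- n * q"] s a E FY Y p by (intro mult_mono powr_mono2) auto
                also have "\<dots> \<le> K s" using elim s a E FY Y by (auto simp: q_def)
                finally show "C1 * (4 powr (- \<bar>n * q\<bar>) * E powr (- n * q)) * Y powr p \<le> K s" .
              qed
            qed
            show "t \<in> {a + d..E}" using Suc.prems a by simp
          qed (use a E C1 in auto)
          also have "4 powr (- \<mu>) * (d / 2)\<^sup>2 * (C1 * (4 powr (- \<bar>n * q\<bar>) * E powr (- n * q)) * Y powr p)
             = (c1 * (E\<^sup>2 * E powr (- n * q))) * (((1/2) ^ j)\<^sup>2 * 4 ^ j) * (Y * L powr q)"
            unfolding Yp d_def c1_def by (simp add: power2_eq_square)
          also have "((1/2::real) ^ j)\<^sup>2 * 4 ^ j = 1"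
            by (simp add: power_mult[symmetric] power_mult_distrib[symmetric] power2_eq_square)
          also have "c1 * (E\<^sup>2 * E powr (- n * q)) = Q"
            using E by (simp add: Q_def powr_diff powr_minus field_simps power2_eq_square)
          also have "Q * 1 * (Y * L powr q) = L * \<theta> ^ Suc j" using LQ by (simp add: Y_def mult_ac)
          finally show ?case .
        qed
        obtain j where "F E / L < \<theta> ^ j" using \<theta> real_arch_pow by blast
        then have "F E < L * \<theta> ^ j" using L by (simp add: field_simps)
        moreover have "F E \<ge> L * \<theta> ^ j" using E by (intro iter) auto
        ultimately show False by simp
      qed
      have "B powr q < L powr q" using BL B q by (intro powr_less_mono2) auto
      also have "L powr q = \<theta> / Q" using Q \<theta> q by (simp add: L_def powr_powr)
      finally have "Q * B powr q < \<theta>" using Q by (simp add: field_simps)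
      moreover have "Q * B powr q = c1 * c0 powr q * (\<epsilon> powr (p * q) * E powr (g / 2))"
      proof -
        have "B powr q = c0 powr q * \<epsilon> powr (p * q) * E powr ((e + 2) * q)"
          using c \<epsilon> E by (simp add: B_def powr_mult powr_powr)
        \<comment> \<open>The Strauss polynomial arises here, as twice the sum of the exponents of E
          in Q and in B^q.\<close>
        moreover have "g / 2 = (2 - n * q) + (e + 2) * q"
          by (simp add: g_def strauss_gamma_def q_def e_def power2_eq_square field_simps)
        ultimately show ?thesis unfolding Q_def by (simp only: powr_add mult_ac)
      qed
      ultimately have "\<epsilon> powr (p * q) * E powr (g / 2) \<le> M"
        using c by (simp add: M_def field_simps)
      then have "E powr (g / 2) \<le> M * \<epsilon> powr (- (p * q))"
        using \<epsilon> by (simp add: powr_minus field_simps)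
      then have "(E powr (g / 2)) powr (2 / g) \<le> (M * \<epsilon> powr (- (p * q))) powr (2 / g)"
        using g by (intro powr_mono2) auto
      also have "(E powr (g / 2)) powr (2 / g) = E" using E g by (simp add: powr_powr)
      also have "(M * \<epsilon> powr (- (p * q))) powr (2 / g) = M powr (2 / g) * X"
        using M \<epsilon> by (simp add: powr_mult powr_powr X_def q_def mult_ac)
      also have "\<dots> \<le> C * X" using X1 t0 by (intro mult_right_mono) (auto simp: C_def E0_def)
      finally show ?thesis by (simp add: X_def)
    qed
  qed
  ultimately show ?thesis using that[of C] unfolding g_def by blast
qed

text \<open>Young's inequality with a tuned parameter: \<theta> = G/D is the scaling for which b G
  and \<theta>^p D both equal the claimed bound X. The term with \<open>\<phi>\<close> then takes
  the share 1/q of X, and the share 1/p is left for the integral of |v|^p.\<close>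

lemma Hoelder_lower_bound:
  fixes v \<phi> :: "'a \<Rightarrow> real"
  assumes p: "p > 1" and D: "D > 0" and G: "G \<ge> 0"
    and v: "set_integrable M B (\<lambda>x. \<bar>v x\<bar> powr p)"
    and \<phi>: "\<And>x. \<phi> x \<ge> 0" "set_integrable M B (\<lambda>x. \<phi> x powr (p / (p - 1)))"
      "(LINT x:B|M. \<phi> x powr (p / (p - 1))) \<le> D"
    and v\<phi>: "set_integrable M B (\<lambda>x. v x * \<phi> x)" "G \<le> (LINT x:B|M. v x * \<phi> x)"
  shows "G powr p * D powr (1 - p) \<le> (LINT x:B|M. \<bar>v x\<bar> powr p)"
proof (cases "G = 0")
  case True
  then show ?thesis using p by (simp add: set_integral_nonneg_on)
next
  case False
  then have G0: "G > 0" using G by simp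
  define q where "q = p / (p - 1)"
  have q: "q > 1" "1 / p + 1 / q = 1" using p by (auto simp: q_def field_simps)
  define \<theta> where "\<theta> = G / D"
  have \<theta>: "\<theta> > 0" using G0 D by (simp add: \<theta>_def)
  define b where "b = \<theta> powr (p - 1)"
  have b: "b > 0" "b powr q = \<theta> powr p" using \<theta> p by (auto simp: b_def powr_powr q_def)
  define X where "X = G powr p * D powr (1 - p)"
  have X1: "b * G = X"
  proof -
    have "D powr (1 - p) = inverse (D powr (p - 1))" by (simp flip: powr_minus)
    then have "b * G = G powr (p - 1) * G powr 1 * D powr (1 - p)"
      using G0 D by (simp add: b_def \<theta>_def powr_divide) (simp add: divide_inverse)
    then show ?thesis unfolding powr_add[symmetric] by (simp add: X_def)
  qed
  have X2: "\<theta> powr p * D = X"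
  proof -
    have "\<theta> powr p * D = G powr p * (D powr (- p) * D powr 1)"
      using G0 D by (simp add: \<theta>_def powr_divide powr_minus field_simps)
    then show ?thesis unfolding powr_add[symmetric] by (simp add: X_def)
  qed
  have pt: "b * (v x * \<phi> x) \<le> \<bar>v x\<bar> powr p / p + (\<theta> powr p / q) * \<phi> x powr q" for x
  proof -
    have "b * (v x * \<phi> x) \<le> \<bar>v x\<bar> * (b * \<phi> x)"
      using b \<phi>(1)[of x] by (simp add: mult.left_commute mult_left_mono mult_right_mono)
    also have "\<dots> \<le> \<bar>v x\<bar> powr p / p + (b * \<phi> x) powr q / q"
      using p q b \<phi>(1)[of x] by (intro Youngs_inequality) auto
    finally show ?thesis using b \<phi>(1)[of x] by (simp add: powr_mult)
  qed
  have "X \<le> b * (LINT x:B|M. v x * \<phi> x)" using X1 v\<phi>(2) b by (simp flip: X1 add: mult_left_mono)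
  also have "\<dots> = (LINT x:B|M. b * (v x * \<phi> x))" by simp
  also have "\<dots> \<le> (LINT x:B|M. \<bar>v x\<bar> powr p / p + (\<theta> powr p / q) * \<phi> x powr q)"
    using v v\<phi>(1) \<phi>(2) pt by (intro set_integral_mono set_integral_add) (auto simp: q_def)
  also have "\<dots> = (LINT x:B|M. \<bar>v x\<bar> powr p) / p + (\<theta> powr p / q) * (LINT x:B|M. \<phi> x powr q)"
    using v \<phi>(2) by (subst set_integral_add(2)) (auto simp: q_def)
  also have "\<dots> \<le> (LINT x:B|M. \<bar>v x\<bar> powr p) / p + (\<theta> powr p / q) * D"
    using \<phi>(3) q unfolding q_def[symmetric] by (intro add_left_mono mult_left_mono) auto
  also have "(\<theta> powr p / q) * D = X * (1 / q)" using X2 by simp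
  also have "1 / q = 1 - 1 / p" using q by simp
  finally have "X / p \<le> (LINT x:B|M. \<bar>v x\<bar> powr p) / p" by (simp add: algebra_simps)
  then show ?thesis using p by (simp add: X_def divide_le_cancel)
qed

section \<open>Square-integrable functions and test functions\<close>

lemma L2_measurable: "f \<in> L2 \<Longrightarrow> f \<in> borel_measurable borel"
  by (simp add: L2_def)

lemma L2_integrable_square: "f \<in> L2 \<Longrightarrow> integrable lborel (\<lambda>x. (f x)\<^sup>2)" for f :: "'a::euclidean_space \<Rightarrow> real"
  by (simp add: L2_def)

lemma L2_mult_integrable:
  fixes f g :: "'a::euclidean_space \<Rightarrow> real"
  assumes f: "f \<in> L2" and g: "g \<in> L2"
  shows "integrable lborel (\<lambda>x. f x * g x)"
proof (rule Bochner_Integration.integrable_bound)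
  show "integrable lborel (\<lambda>x. (f x)\<^sup>2 + (g x)\<^sup>2)"
    using f g by (intro Bochner_Integration.integrable_add L2_integrable_square)
  have [measurable]: "f \<in> borel_measurable borel" "g \<in> borel_measurable borel"
    using f g by (simp_all add: L2_measurable)
  show "(\<lambda>x. f x * g x) \<in> borel_measurable lborel" by measurable
  have "\<bar>f x * g x\<bar> \<le> (f x)\<^sup>2 + (g x)\<^sup>2" for x
  proof -
    have "2 * (\<bar>f x\<bar> * \<bar>g x\<bar>) \<le> (f x)\<^sup>2 + (g x)\<^sup>2"
      using sum_squares_bound[of "\<bar>f x\<bar>" "\<bar>g x\<bar>"] by (simp add: mult.assoc)
    moreover have "0 \<le> \<bar>f x\<bar> * \<bar>g x\<bar>" by simp
    ultimately have "\<bar>f x\<bar> * \<bar>g x\<bar> \<le> (f x)\<^sup>2 + (g x)\<^sup>2" by linarith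
    then show ?thesis by (simp add: abs_mult)
  qed
  then show "AE x in lborel. norm (f x * g x) \<le> norm ((f x)\<^sup>2 + (g x)\<^sup>2)" by (auto simp: abs_mult)
qed

lemma L2_diff:
  fixes f g :: "'a::euclidean_space \<Rightarrow> real"
  assumes f: "f \<in> L2" and g: "g \<in> L2"
  shows "(\<lambda>x. f x - g x) \<in> L2"
proof -
  have [measurable]: "f \<in> borel_measurable borel" "g \<in> borel_measurable borel"
    using f g by (simp_all add: L2_measurable)
  have "integrable lborel (\<lambda>x. (f x)\<^sup>2 + (g x)\<^sup>2 - 2 * (f x * g x))"
    using f g by (intro Bochner_Integration.integrable_add Bochner_Integration.integrable_diff
        L2_integrable_square integrable_mult_right L2_mult_integrable)
  then show ?thesis unfolding L2_def by (simp add: power2_diff mult.assoc)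
qed

lemma L2_divide:
  fixes f :: "'a::euclidean_space \<Rightarrow> real"
  assumes f: "f \<in> L2" shows "(\<lambda>x. f x / c) \<in> L2"
proof -
  have [measurable]: "f \<in> borel_measurable borel" using f by (simp add: L2_measurable)
  have "integrable lborel (\<lambda>x. (f x)\<^sup>2 / c\<^sup>2)"
    using f by (intro integrable_divide L2_integrable_square)
  then show ?thesis unfolding L2_def by (simp add: power_divide)
qed

lemma L2_norm_square: "(L2_norm f)\<^sup>2 = (LINT x|lborel. (norm (f x))\<^sup>2)"
  unfolding L2_norm_def by (simp add: Bochner_Integration.integral_nonneg)

lemma L2_Cauchy_Schwarz:
  fixes f g :: "'a::euclidean_space \<Rightarrow> real"
  assumes f: "f \<in> L2" and g: "g \<in> L2"
  shows "\<bar>LINT x|lborel. f x * g x\<bar> \<le> L2_norm f * L2_norm g"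
proof -
  define A B C where "A = (LINT x|lborel. (f x)\<^sup>2)" and "B = (LINT x|lborel. f x * g x)"
    and "C = (LINT x|lborel. (g x)\<^sup>2)"
  have nn: "A \<ge> 0" "C \<ge> 0" by (auto simp: A_def C_def Bochner_Integration.integral_nonneg)
  have q: "0 \<le> A * s\<^sup>2 - 2 * B * s + C" for s
  proof -
    have "0 \<le> (LINT x|lborel. (s * f x - g x)\<^sup>2)" by (rule Bochner_Integration.integral_nonneg) simp
    also have "(LINT x|lborel. (s * f x - g x)\<^sup>2)
      = (LINT x|lborel. (s\<^sup>2 * (f x)\<^sup>2 - (2 * s) * (f x * g x)) + (g x)\<^sup>2)"
      by (rule Bochner_Integration.integral_cong) (auto simp: power2_eq_square algebra_simps)
    also have "\<dots> = s\<^sup>2 * A - (2 * s) * B + C"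
      unfolding A_def B_def C_def using f g
      by (simp add: L2_integrable_square L2_mult_integrable Bochner_Integration.integral_add
         Bochner_Integration.integral_diff Bochner_Integration.integrable_diff)
    finally show ?thesis by (simp add: mult_ac)
  qed
  have "B\<^sup>2 \<le> A * C"
  proof (cases "A = 0")
    case True
    have "B = 0"
    proof (rule ccontr)
      assume "B \<noteq> 0"
      \<comment> \<open>With A = 0 the quadratic polynomial is affine, and this argument gives it
        the value -1.\<close>
      then show False using q[of "(C + 1) / (2 * B)"] True by simp
    qed
    then show ?thesis using True by simp
  next
    case False
    then have "A > 0" using nn by simp
    have "0 \<le> A * (B / A)\<^sup>2 - 2 * B * (B / A) + C" by (rule q)
    also have "\<dots> = C - B\<^sup>2 / A" using \<open>A > 0\<close> by (simp add: power2_eq_square field_simps)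
    finally show ?thesis using \<open>A > 0\<close> by (simp add: field_simps)
  qed
  then have "sqrt (B\<^sup>2) \<le> sqrt (A * C)" by (rule real_sqrt_le_mono)
  then show ?thesis by (simp add: real_sqrt_mult L2_norm_def A_def B_def C_def)
qed

text \<open>The squared mass of v on A is at most the squared L^2 distance from v to any w that
  vanishes there. This carries support information from almost every time to every time.\<close>

lemma L2_vanish_limit:
  fixes v :: "'a::euclidean_space \<Rightarrow> real"
  assumes v: "v \<in> L2" and A[measurable]: "A \<in> sets borel"
    and lim: "\<And>e. e > 0 \<Longrightarrow> \<exists>w\<in>L2. (AE x in lborel. x \<in> A \<longrightarrow> w x = 0) \<and> L2_norm (\<lambda>x. w x - v x) < e"
  shows "AE x in lborel. x \<in> A \<longrightarrow> v x = 0"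
proof -
  have [measurable]: "v \<in> borel_measurable borel" using v by (simp add: L2_measurable)
  define J where "J = (LINT x|lborel. indicat_real A x * (v x)\<^sup>2)"
  have int: "integrable lborel (\<lambda>x. indicat_real A x * (v x)\<^sup>2)"
    by (rule Bochner_Integration.integrable_bound[OF L2_integrable_square[OF v]])
       (auto simp: indicator_def)
  have J2: "J \<le> e\<^sup>2" if e: "e > 0" for e
  proof -
    obtain w where w: "w \<in> L2" "AE x in lborel. x \<in> A \<longrightarrow> w x = 0" "L2_norm (\<lambda>x. w x - v x) < e"
      using lim[OF e] by blast
    have "J \<le> (LINT x|lborel. (norm (w x - v x))\<^sup>2)"
      unfolding J_def
    proof (rule integral_mono_AE[OF int])
      show "integrable lborel (\<lambda>x. (norm (w x - v x))\<^sup>2)"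
        using L2_integrable_square[OF L2_diff[OF w(1) v]] by simp
      show "AE x in lborel. indicat_real A x * (v x)\<^sup>2 \<le> (norm (w x - v x))\<^sup>2"
        using w(2) by eventually_elim (auto simp: indicator_def)
    qed
    also have "\<dots> = (L2_norm (\<lambda>x. w x - v x))\<^sup>2" by (simp add: L2_norm_square)
    also have "\<dots> \<le> e\<^sup>2" using w(3) by (intro power_mono) (auto simp: L2_norm_def Bochner_Integration.integral_nonneg)
    finally show ?thesis .
  qed
  have "J \<le> e" if "e > 0" for e
    using J2[of "sqrt e"] that by simp
  then have "J \<le> 0" using field_le_epsilon[of J 0] by simp
  moreover have "J \<ge> 0" unfolding J_def by (intro Bochner_Integration.integral_nonneg) (simp add: indicator_def)
  ultimately have "(LINT x|lborel. indicat_real A x * (v x)\<^sup>2) = 0" unfolding J_def by linarith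
  then have "AE x in lborel. indicat_real A x * (v x)\<^sup>2 = 0"
    by (subst (asm) integral_nonneg_eq_0_iff_AE[OF int]) (auto simp: indicator_def)
  then show ?thesis by eventually_elim (auto simp: indicator_def)
qed

section \<open>Test functions in space and the weak gradient\<close>

lemma test_function_UNIV_bounds:
  fixes a :: "'a::euclidean_space \<Rightarrow> real"
  assumes "test_function UNIV a"
  obtains r B where "r > 0" "\<And>x. \<bar>a x\<bar> \<le> B" "\<And>x. norm x > r \<Longrightarrow> a x = 0"
    "continuous_on UNIV a"
proof -
  have cont: "continuous_on UNIV a" and K: "compact (closure {x. a x \<noteq> 0})"
    using assms by (auto simp: test_function_def smooth_on_imp_continuous_on)
  obtain r where r: "r > 0" "\<And>x. x \<in> closure {x. a x \<noteq> 0} \<Longrightarrow> norm x \<le> r"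
    using compact_imp_bounded[OF K] bounded_pos by blast
  have zero: "a x = 0" if "norm x > r" for x
    using r(2)[of x] that closure_subset[of "{x. a x \<noteq> 0}"] by force
  have "compact (a ` cball 0 r)"
    by (intro compact_continuous_image continuous_on_subset[OF cont]) auto
  then obtain B where B: "\<And>x. x \<in> cball 0 r \<Longrightarrow> \<bar>a x\<bar> \<le> B"
    using compact_imp_bounded[of "a ` cball 0 r"] unfolding bounded_iff ball_simps real_norm_def by blast
  have "\<bar>a x\<bar> \<le> \<bar>B\<bar>" for x
    using B[of x] zero[of x] by (cases "norm x > r") (auto simp: not_less)
  then show ?thesis using that r zero cont by blast
qed

lemma bounded_support_L2:
  fixes a :: "'a::euclidean_space \<Rightarrow> real"
  assumes [measurable]: "a \<in> borel_measurable borel" and "\<And>x. \<bar>a x\<bar> \<le> B" "\<And>x. norm x > r \<Longrightarrow> a x = 0"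
  shows "a \<in> L2"
proof -
  have "set_integrable lborel (cball 0 r) (\<lambda>x. (a x)\<^sup>2)"
  proof (rule set_integrable_cball_bounded)
    show "\<bar>(a y)\<^sup>2\<bar> \<le> B\<^sup>2" for y using assms(2)[of y] by (simp add: abs_le_square_iff[symmetric])
  qed measurable
  moreover have "(\<lambda>x. indicat_real (cball 0 r) x *\<^sub>R (a x)\<^sup>2) = (\<lambda>x. (a x)\<^sup>2)"
    using assms(3) by (auto simp: indicator_def fun_eq_iff)
  ultimately show ?thesis unfolding L2_def set_integrable_def by simp
qed

lemma test_function_measurable:
  fixes a :: "'a::euclidean_space \<Rightarrow> real"
  shows "test_function UNIV a \<Longrightarrow> a \<in> borel_measurable borel"
  by (intro borel_measurable_continuous_onI) (auto simp: test_function_def smooth_on_imp_continuous_on)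

lemma test_function_L2:
  fixes a :: "'a::euclidean_space \<Rightarrow> real"
  assumes "test_function UNIV a" shows "a \<in> L2"
  using test_function_UNIV_bounds[OF assms] bounded_support_L2[OF test_function_measurable[OF assms]]
  by metis

lemma test_function_deriv:
  fixes a :: "'a::euclidean_space \<Rightarrow> real"
  assumes "test_function UNIV a"
  shows "test_function UNIV (\<lambda>x. frechet_derivative a (at x) v)"
proof -
  define C where "C = closure {x. a x \<noteq> 0}"
  have C: "compact C" using assms by (simp add: test_function_def C_def)
  have "{x. frechet_derivative a (at x) v \<noteq> 0} \<subseteq> C"
  proof
    fix x assume x: "x \<in> {x. frechet_derivative a (at x) v \<noteq> 0}"
    show "x \<in> C"
    proof (rule ccontr)
      assume "x \<notin> C"
      have "(a has_derivative (\<lambda>_. 0)) (at x)"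
      proof (rule has_derivative_transform_within_open[where f = "\<lambda>_. 0" and s = "- C"])
        show "0 = a y" if "y \<in> - C" for y
          using that closure_subset[of "{x. a x \<noteq> 0}"] by (auto simp: C_def)
      qed (use C \<open>x \<notin> C\<close> in \<open>auto simp: compact_imp_closed\<close>)
      then have "frechet_derivative a (at x) = (\<lambda>_. 0)" by (rule frechet_derivative_at[symmetric])
      then show False using x by simp
    qed
  qed
  then have "closure {x. frechet_derivative a (at x) v \<noteq> 0} \<subseteq> C"
    using C by (simp add: closure_minimal compact_imp_closed)
  then have "compact (closure {x. frechet_derivative a (at x) v \<noteq> 0})"
    using C by (metis closed_closure compact_Int_closed inf.absorb_iff2)
  moreover have "smooth_on UNIV (\<lambda>x. frechet_derivative a (at x) v)"
    using smooth_on_frechet_derivative[of UNIV a v] assms by (simp add: test_function_def)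
  ultimately show ?thesis by (simp add: test_function_def)
qed

text \<open>Each partial derivative of \<open>a\<close> is itself a test function, so the weak
  gradient may be tested with it. Both derivatives end up on \<open>a\<close>, and w needs no second
  derivative.\<close>

lemma weak_gradient_laplacian:
  fixes a w :: "'a::euclidean_space \<Rightarrow> real"
  assumes w: "w \<in> H1" and a: "test_function UNIV a"
  shows "integrable lborel (\<lambda>x. weak_gradient w x \<bullet> (\<Sum>b\<in>Basis. frechet_derivative a (at x) b *\<^sub>R b))" (is ?I)
    and "(LINT x|lborel. weak_gradient w x \<bullet> (\<Sum>b\<in>Basis. frechet_derivative a (at x) b *\<^sub>R b))
      = - (LINT x|lborel. w x * laplacian a x)" (is ?E)
proof -
  define Gw where "Gw = weak_gradient w"
  have "\<exists>G. G \<in> L2 \<and> is_weak_gradient w G" using w by (auto simp: H1_def)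
  then have G: "Gw \<in> L2" "is_weak_gradient w Gw"
    unfolding Gw_def weak_gradient_def by (metis (mono_tags, lifting) someI_ex)+
  have wL: "w \<in> L2" using w by (simp add: H1_def)
  have [measurable]: "Gw \<in> borel_measurable borel" using G by (simp add: L2_def)
  have GbL: "(\<lambda>x. Gw x \<bullet> b) \<in> L2" if "b \<in> Basis" for b
  proof -
    have "integrable lborel (\<lambda>x. (Gw x \<bullet> b)\<^sup>2)"
    proof (rule Bochner_Integration.integrable_bound)
      show "integrable lborel (\<lambda>x. (norm (Gw x))\<^sup>2)" using G by (simp add: L2_def)
      show "AE x in lborel. norm ((Gw x \<bullet> b)\<^sup>2) \<le> norm ((norm (Gw x))\<^sup>2)"
        using Basis_le_norm[OF that] by (auto simp: abs_le_square_iff[symmetric])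
    qed measurable
    then show ?thesis by (simp add: L2_def)
  qed
  have t1: "test_function UNIV (\<lambda>x. frechet_derivative a (at x) b)" for b
    by (rule test_function_deriv[OF a])
  have t2: "test_function UNIV (\<lambda>x. frechet_derivative (\<lambda>y. frechet_derivative a (at y) b) (at x) b)" for b
    by (rule test_function_deriv[OF t1])
  have exp: "Gw x \<bullet> (\<Sum>b\<in>Basis. frechet_derivative a (at x) b *\<^sub>R b)
      = (\<Sum>b\<in>Basis. (Gw x \<bullet> b) * frechet_derivative a (at x) b)" for x
    by (simp add: inner_sum_right mult.commute)
  have i1: "integrable lborel (\<lambda>x. (Gw x \<bullet> b) * frechet_derivative a (at x) b)" if "b \<in> Basis" for b
    by (rule L2_mult_integrable[OF GbL[OF that] test_function_L2[OF t1]])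
  have i2: "integrable lborel (\<lambda>x. w x * frechet_derivative (\<lambda>y. frechet_derivative a (at y) b) (at x) b)" for b
    by (rule L2_mult_integrable[OF wL test_function_L2[OF t2]])
  show ?I unfolding Gw_def[symmetric] exp by (intro Bochner_Integration.integrable_sum i1)
  have "(LINT x|lborel. Gw x \<bullet> (\<Sum>b\<in>Basis. frechet_derivative a (at x) b *\<^sub>R b))
     = (\<Sum>b\<in>Basis. LINT x|lborel. (Gw x \<bullet> b) * frechet_derivative a (at x) b)"
    unfolding exp by (rule Bochner_Integration.integral_sum) (rule i1)
  also have "\<dots> = (\<Sum>b\<in>Basis. - (LINT x|lborel. w x * frechet_derivative (\<lambda>y. frechet_derivative a (at y) b) (at x) b))"
    using G(2) t1 unfolding is_weak_gradient_def by (intro sum.cong) auto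
  also have "\<dots> = - (LINT x|lborel. (\<Sum>b\<in>Basis. w x * frechet_derivative (\<lambda>y. frechet_derivative a (at y) b) (at x) b))"
    unfolding sum_negf by (subst Bochner_Integration.integral_sum) (auto intro: i2)
  finally show ?E by (simp add: Gw_def laplacian_def sum_distrib_left)
qed

lemma laplacian_L2:
  fixes a :: "'a::euclidean_space \<Rightarrow> real"
  assumes a: "test_function UNIV a" shows "laplacian a \<in> L2"
proof -
  have "(\<lambda>x. \<Sum>b\<in>B. frechet_derivative (\<lambda>y. frechet_derivative a (at y) b) (at x) b) \<in> L2" if "finite B" for B
    using that
  proof induction
    case empty
    show ?case by (simp add: L2_def)
  next
    case (insert b B)
    have "(\<lambda>x. frechet_derivative (\<lambda>y. frechet_derivative a (at y) b) (at x) b -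
        (0 - (\<Sum>b\<in>B. frechet_derivative (\<lambda>y. frechet_derivative a (at y) b) (at x) b))) \<in> L2"
      by (intro L2_diff insert.IH test_function_L2[OF test_function_deriv[OF test_function_deriv[OF a]]])
         (simp add: L2_def)
    then show ?case using insert by simp
  qed
  then show ?thesis by (simp add: laplacian_def[abs_def])
qed

lemma laplacian_cong_open:
  assumes "open S" "x \<in> S" "\<And>y. y \<in> S \<Longrightarrow> f y = g y"
  shows "laplacian f x = laplacian g x"
proof -
  have fd: "frechet_derivative f' (at y) = frechet_derivative g' (at y)"
    if "y \<in> S" "\<And>y. y \<in> S \<Longrightarrow> f' y = g' y" for f' g' :: "'a \<Rightarrow> real" and y
    using frechet_derivative_within_cong[of S f' g' y] that at_within_open[OF that(1) assms(1)] by simp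
  show ?thesis unfolding laplacian_def
    by (intro sum.cong refl fun_cong[OF fd[OF assms(2)]] fun_cong[OF fd] assms(3))
qed

section \<open>Energy solutions\<close>

lemma L2_pairing_tendsto:
  fixes W :: "real \<Rightarrow> 'a::euclidean_space \<Rightarrow> real"
  assumes v: "v \<in> L2" and a: "a \<in> L2" and W: "\<forall>\<^sub>F s in net. W s \<in> L2"
    and lim: "((\<lambda>s. L2_norm (\<lambda>x. W s x - v x)) \<longlongrightarrow> 0) net"
  shows "((\<lambda>s. LINT x|lborel. W s x * a x) \<longlongrightarrow> (LINT x|lborel. v x * a x)) net"
proof (rule LIM_zero_cancel, rule Lim_null_comparison)
  show "((\<lambda>s. L2_norm (\<lambda>x. W s x - v x) * L2_norm a) \<longlongrightarrow> 0) net"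
    using tendsto_mult[OF lim tendsto_const[of "L2_norm a"]] by simp
  show "\<forall>\<^sub>F s in net. norm ((LINT x|lborel. W s x * a x) - (LINT x|lborel. v x * a x))
      \<le> L2_norm (\<lambda>x. W s x - v x) * L2_norm a"
    using W
  proof eventually_elim
    case (elim s)
    have "(LINT x|lborel. W s x * a x) - (LINT x|lborel. v x * a x) = (LINT x|lborel. (W s x - v x) * a x)"
      unfolding left_diff_distrib using elim v a
      by (intro Bochner_Integration.integral_diff[symmetric] L2_mult_integrable)
    then show ?case using L2_Cauchy_Schwarz[OF L2_diff[OF elim v] a] by simp
  qed
qed

lemma L2_pairing_has_derivative:
  fixes U V :: "real \<Rightarrow> 'a::euclidean_space \<Rightarrow> real"
  assumes D: "C1_L2_deriv I U V" and a: "a \<in> L2" and t: "t \<in> I"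
  shows "((\<lambda>s. LINT x|lborel. U s x * a x) has_real_derivative (LINT x|lborel. V t x * a x)) (at t within I)"
  unfolding has_field_derivative_iff
proof (rule Lim_transform_eventually)
  have L: "U s \<in> L2" "V s \<in> L2" if "s \<in> I" for s using D that by (auto simp: C1_L2_deriv_def C_L2_def)
  have ev: "\<forall>\<^sub>F s in at t within I. s \<in> I" by (auto simp: eventually_at_filter)
  show "((\<lambda>s. LINT x|lborel. (U s x - U t x) / (s - t) * a x) \<longlongrightarrow> (LINT x|lborel. V t x * a x)) (at t within I)"
  proof (rule L2_pairing_tendsto[OF L(2)[OF t] a])
    show "\<forall>\<^sub>F s in at t within I. (\<lambda>x. (U s x - U t x) / (s - t)) \<in> L2"
      using ev by eventually_elim (intro L2_divide L2_diff L t)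
  qed (use D t in \<open>auto simp: C1_L2_deriv_def\<close>)
  show "\<forall>\<^sub>F s in at t within I. (LINT x|lborel. (U s x - U t x) / (s - t) * a x)
      = ((LINT x|lborel. U s x * a x) - (LINT x|lborel. U t x * a x)) / (s - t)"
    using ev
  proof eventually_elim
    case (elim s)
    have "(LINT x|lborel. (U s x - U t x) / (s - t) * a x) = (LINT x|lborel. (U s x * a x - U t x * a x) / (s - t))"
      by (simp add: left_diff_distrib)
    then show ?case
      using L elim t a by (simp add: L2_mult_integrable Bochner_Integration.integral_diff)
  qed
qed

lemma L2_pairing_continuous:
  fixes V :: "real \<Rightarrow> 'a::euclidean_space \<Rightarrow> real"
  assumes V: "C_L2 I V" and a: "a \<in> L2"
  shows "continuous_on I (\<lambda>s. LINT x|lborel. V s x * a x)"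
  unfolding continuous_on_def
proof
  fix t assume t: "t \<in> I"
  have "\<forall>\<^sub>F s in at t within I. V s \<in> L2" using V by (auto simp: C_L2_def eventually_at_filter)
  then show "((\<lambda>s. LINT x|lborel. V s x * a x) \<longlongrightarrow> (LINT x|lborel. V t x * a x)) (at t within I)"
    using V t by (intro L2_pairing_tendsto a) (auto simp: C_L2_def)
qed

definition weak_formulation ::
  "real \<Rightarrow> real \<Rightarrow> ereal \<Rightarrow> ('a::euclidean_space \<times> real \<Rightarrow> real) \<Rightarrow> (real \<Rightarrow> 'a \<Rightarrow> real) \<Rightarrow> bool" where
  "weak_formulation \<mu> p T u ut \<longleftrightarrow>
     (\<forall>\<phi>. test_function (space_time T) \<phi> \<longrightarrow> (\<forall>t\<in>time_interval T.
            (LINT x|lborel. ut t x * \<phi> (x, t)) - (LINT x|lborel. ut 0 x * \<phi> (x, 0))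
          + (LINT s:{0..t}|lborel. (LINT x|lborel.
                - ut s x * time_deriv T \<phi> (x, s)
                + weak_gradient (\<lambda>y. u (y, s)) x \<bullet> space_grad T \<phi> (x, s)))
          + (LINT s:{0..t}|lborel. (LINT x|lborel. \<mu> * ut s x / (1 + s) * \<phi> (x, s)))
          = (LINT s:{0..t}|lborel. (LINT x|lborel. \<bar>u (x, s)\<bar> powr p * \<phi> (x, s)))))"

lemma energy_solutionE:
  assumes "energy_solution \<mu> p \<epsilon> f g T u"
  obtains ut where "C1_L2_deriv (time_interval T) (\<lambda>t x. u (x, t)) ut"
    "AE x in lborel. u (x, 0) = \<epsilon> * f x" "AE x in lborel. ut 0 x = \<epsilon> * g x"
    "weak_formulation \<mu> p T u ut"
  using assms unfolding energy_solution_def weak_formulation_def by blast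

section \<open>Separated test functions on the half-open cylinder\<close>

lemma time_interval_0: "0 < T \<Longrightarrow> 0 \<in> time_interval T"
  by (simp add: time_interval_def zero_ereal_def)

lemma time_interval_downward: "t \<in> time_interval T \<Longrightarrow> 0 \<le> s \<Longrightarrow> s \<le> t \<Longrightarrow> s \<in> time_interval T"
  unfolding time_interval_def using le_less_trans[of "ereal s" "ereal t" T] by simp

lemma time_interval_later:
  assumes "t \<in> time_interval T" obtains t' where "t < t'" "t' \<in> time_interval T"
proof -
  have "ereal t < T" "0 \<le> t" using assms by (auto simp: time_interval_def)
  then obtain z where "ereal t < ereal z" "ereal z < T" using ereal_dense2 by blast
  then show ?thesis using that[of z] \<open>0 \<le> t\<close> by (simp add: time_interval_def)
qed

text \<open>The right end T is not attained, so from every time, t = 0 included, there is room to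
  move forward.\<close>

lemma derivative_domain_space_time: "derivative_domain (space_time T :: ('a::euclidean_space \<times> real) set)"
  unfolding derivative_domain_def
proof (intro ballI allI impI)
  fix z i :: "'a \<times> real" and e :: real assume z: "z \<in> space_time T" and i: "i \<in> Basis" and e: "e > 0"
  obtain x t where zt: "z = (x, t)" by force
  have t: "t \<in> time_interval T" using z by (simp add: space_time_def zt)
  show "\<exists>d. 0 < \<bar>d\<bar> \<and> \<bar>d\<bar> < e \<and> z + d *\<^sub>R i \<in> space_time T"
  proof (cases "snd i = 0")
    case True
    then show ?thesis using t e by (cases i, intro exI[of _ "e / 2"]) (auto simp: zt space_time_def)
  next
    case False
    then have i1: "snd i = 1" using i by (auto simp: Basis_prod_def)
    obtain t' where t': "t < t'" "t' \<in> time_interval T" using time_interval_later[OF t] .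
    define d where "d = min (e / 2) (t' - t)"
    have d: "0 < d" "d < e" "t + d \<le> t'" using t' e by (auto simp: d_def)
    have "t + d \<in> time_interval T"
      by (rule time_interval_downward[OF t'(2)]) (use d t in \<open>auto simp: time_interval_def\<close>)
    then show ?thesis using d i1 by (cases i, intro exI[of _ d]) (auto simp: zt space_time_def)
  qed
qed

lemma smooth_on_fst:
  fixes a :: "'a::euclidean_space \<Rightarrow> real" and S :: "('a \<times> real) set"
  assumes S: "derivative_domain S" and a: "smooth_on UNIV a"
  shows "smooth_on S (\<lambda>z. a (fst z))"
proof (rule smooth_on_deriv_family[OF S, where J = "Collect (smooth_on UNIV)" and H = "\<lambda>f z. f (fst z)"
      and N = "\<lambda>f v x. frechet_derivative f (at x) (fst v)"])
  show "((\<lambda>z. f (fst z)) has_derivative (\<lambda>v. frechet_derivative f (at (fst z)) (fst v))) (at z within S)"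
    if "f \<in> Collect (smooth_on UNIV)" for f :: "'a \<Rightarrow> real" and z :: "'a \<times> real"
    using has_derivative_compose[of fst fst z S f "frechet_derivative f (at (fst z))"]
      smooth_on_has_derivative[of UNIV f "fst z"] that
      bounded_linear_imp_has_derivative[OF bounded_linear_fst] by auto
  show "(\<lambda>x. frechet_derivative f (at x) (fst v)) \<in> Collect (smooth_on UNIV)"
    if "f \<in> Collect (smooth_on UNIV)" for f :: "'a \<Rightarrow> real" and v :: "'a \<times> real"
    using smooth_on_frechet_derivative[of UNIV f "fst v"] that by simp
qed (use a in auto)

text \<open>The product lam(t) a(x) need not have compact support in the cylinder, so it is cut off
  in time between E1 and E2 < T. Since E < E1, the cutoff is 1 near all of {0..E} and leaves the
  derivatives at t = E unchanged as well.\<close>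

lemma separated_test_function:
  fixes a :: "'a::euclidean_space \<Rightarrow> real" and lam :: "real \<Rightarrow> real"
  assumes a: "test_function UNIV a" and l: "smooth_on {-1<..} lam" and E: "E \<in> time_interval T"
  obtains \<Psi> where "test_function (space_time T) \<Psi>"
    "\<And>x s. s \<in> {0..E} \<Longrightarrow> \<Psi> (x, s) = lam s * a x"
    "\<And>x s D. s \<in> {0..E} \<Longrightarrow> (lam has_real_derivative D) (at s) \<Longrightarrow> time_deriv T \<Psi> (x, s) = D * a x"
    "\<And>x s. s \<in> {0..E} \<Longrightarrow>
       space_grad T \<Psi> (x, s) = lam s *\<^sub>R (\<Sum>b\<in>Basis. frechet_derivative a (at x) b *\<^sub>R b)"
proof -
  let ?S = "space_time T :: ('a \<times> real) set"
  note dd = derivative_domain_space_time[where 'a='a and T = T]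
  obtain E2 where E2: "E < E2" "E2 \<in> time_interval T" using time_interval_later[OF E] .
  define E1 where "E1 = (E + E2) / 2"
  have E1: "E < E1" "E1 < E2" using E2 by (auto simp: E1_def)
  define \<eta> where "\<eta> t = smooth_step ((E2 - t) / (E2 - E1))" for t
  have \<eta>1: "\<eta> t = 1" if "t \<le> E1" for t
    unfolding \<eta>_def by (rule smooth_step_eq_1) (use that E1 in \<open>simp add: field_simps\<close>)
  have \<eta>0: "\<eta> t = 0" if "t \<ge> E2" for t
    unfolding \<eta>_def by (rule smooth_step_eq_0) (use that E1 in \<open>simp add: field_simps\<close>)
  define \<Psi> where "\<Psi> z = a (fst z) * (lam (snd z) * \<eta> (snd z))" for z :: "'a \<times> real"
  have sa: "smooth_on UNIV a" using a by (simp add: test_function_def)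
  have snd: "smooth_on ?S snd" by (rule smooth_on_linear[OF dd bounded_linear_snd])
  have lin: "smooth_on ?S (\<lambda>z. (E2 - snd z) * (1 / (E2 - E1)))"
    by (intro smooth_on_mult smooth_on_diff smooth_on_const snd dd)
  have "smooth_on ?S (\<lambda>z. \<eta> (snd z))"
    unfolding \<eta>_def using smooth_on_compose[OF dd open_UNIV UNIV_I smooth_on_smooth_step lin] by simp
  moreover have "smooth_on ?S (\<lambda>z. lam (snd z))"
    by (rule smooth_on_compose[OF dd _ _ l snd]) (auto simp: space_time_def time_interval_def)
  ultimately have sm: "smooth_on ?S \<Psi>"
    unfolding \<Psi>_def[abs_def] by (intro smooth_on_mult smooth_on_fst sa dd)
  define C where "C = closure {x. a x \<noteq> 0} \<times> {0..E2}"
  have "compact C" using a by (auto simp: C_def test_function_def intro: compact_Times)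
  have supp: "{z \<in> ?S. \<Psi> z \<noteq> 0} \<subseteq> C"
  proof
    fix z assume z: "z \<in> {z \<in> ?S. \<Psi> z \<noteq> 0}"
    then have "a (fst z) \<noteq> 0" "\<eta> (snd z) \<noteq> 0" by (auto simp: \<Psi>_def)
    then have "fst z \<in> closure {x. a x \<noteq> 0}" "snd z < E2"
      using closure_subset[of "{x. a x \<noteq> 0}"] \<eta>0[of "snd z"] by (auto simp: not_le[symmetric])
    then show "z \<in> C" using z by (cases z) (auto simp: C_def space_time_def time_interval_def)
  qed
  have CS: "C \<subseteq> ?S"
    using time_interval_downward[OF E2(2)] by (auto simp: C_def space_time_def)
  have clC: "closure {z \<in> ?S. \<Psi> z \<noteq> 0} \<subseteq> C"
    using supp \<open>compact C\<close> by (simp add: closure_minimal compact_imp_closed)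
  moreover have "compact (C \<inter> closure {z \<in> ?S. \<Psi> z \<noteq> 0})"
    using \<open>compact C\<close> by (rule compact_Int_closed) simp
  ultimately have "compact (closure {z \<in> ?S. \<Psi> z \<noteq> 0})" by (simp add: Int_absorb1)
  then have "test_function ?S \<Psi>" using sm clC CS by (simp add: test_function_def)
  moreover have val: "\<Psi> (x, s) = lam s * a x" if "s \<in> {0..E}" for x s
    using \<eta>1[of s] that E1 by (simp add: \<Psi>_def)
  moreover have fd: "frechet_derivative \<Psi> (at (x, s) within ?S) = (\<lambda>v. a x * (D * snd v) + frechet_derivative a (at x) (fst v) * lam s)"
    if s: "s \<in> {0..E}" and D: "(lam has_real_derivative D) (at s)" for x s D
  proof (rule frechet_derivative_within_eq[OF dd])
    show inS: "(x, s) \<in> ?S" using time_interval_downward[OF E] s by (auto simp: space_time_def)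
    have da: "((\<lambda>z. a (fst z)) has_derivative (\<lambda>v. frechet_derivative a (at x) (fst v))) (at (x, s) within ?S)"
      using has_derivative_compose[of fst fst "(x, s)" ?S a "frechet_derivative a (at x)"]
        smooth_on_has_derivative[OF sa, of x] bounded_linear_imp_has_derivative[OF bounded_linear_fst] by auto
    have "(lam has_derivative (\<lambda>w. D * w)) (at s)" using D by (simp add: has_field_derivative_def)
    then have dl: "((\<lambda>z. lam (snd z)) has_derivative (\<lambda>v. D * snd v)) (at (x, s) within ?S)"
      using has_derivative_compose[of snd snd "(x, s)" ?S lam "\<lambda>w. D * w"]
        bounded_linear_imp_has_derivative[OF bounded_linear_snd] by auto
    have "((\<lambda>z. a (fst z) * lam (snd z)) has_derivative
        (\<lambda>v. a x * (D * snd v) + frechet_derivative a (at x) (fst v) * lam s)) (at (x, s) within ?S)"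
      using has_derivative_mult[OF da dl] by simp
    then show "(\<Psi> has_derivative (\<lambda>v. a x * (D * snd v) + frechet_derivative a (at x) (fst v) * lam s)) (at (x, s) within ?S)"
    proof (rule has_derivative_transform_within_open[where s = "UNIV \<times> {..<E1}"])
      show "(x, s) \<in> UNIV \<times> {..<E1}" using s E1 by auto
      show "a (fst z) * lam (snd z) = \<Psi> z" if "z \<in> UNIV \<times> {..<E1}" for z
        using that \<eta>1[of "snd z"] by (auto simp: \<Psi>_def)
    qed (auto intro: open_Times)
  qed
  have lin_a: "frechet_derivative a (at x) 0 = 0" for x
    using smooth_on_has_derivative[OF sa, of x] has_derivative_linear linear_0 by auto
  have td: "time_deriv T \<Psi> (x, s) = D * a x" if "s \<in> {0..E}" "(lam has_real_derivative D) (at s)" for x s D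
    unfolding time_deriv_def fd[OF that] by (simp add: lin_a)
  have sg: "space_grad T \<Psi> (x, s) = lam s *\<^sub>R (\<Sum>b\<in>Basis. frechet_derivative a (at x) b *\<^sub>R b)" if s: "s \<in> {0..E}" for x s
  proof -
    have "s \<in> {-1<..}" "open {-1::real<..}" using s by auto
    then have "(lam has_derivative frechet_derivative lam (at s within {-1<..})) (at s)"
      using smooth_on_has_derivative[OF l, of s] by (metis at_within_open)
    then obtain D where "(lam has_real_derivative D) (at s)"
      using differentiableI real_differentiableE by blast
    note fds = fd[OF s this]
    show ?thesis unfolding space_grad_def fds
      by (simp add: scaleR_sum_right mult.commute)
  qed
  show ?thesis
    by (rule that[OF \<open>test_function ?S \<Psi>\<close> val td sg])
qed

text \<open>For a separated test function every linear term is a pairing of u or ut with a fixed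
  element of L^2, hence continuous in time. Damping and lam' combine into the coefficient lam' -
  \<mu>/(1 + s) lam, and the choice of lam decides what is left: (1 + s)^\<mu> removes it,
  \<open>wave_weight\<close> turns it into the multiplier of the comparison argument.\<close>

lemma energy_identity_separated:
  fixes a :: "'a::euclidean_space \<Rightarrow> real" and lam lam' :: "real \<Rightarrow> real"
  assumes H1: "\<And>t. t \<in> time_interval T \<Longrightarrow> (\<lambda>x. u (x, t)) \<in> H1"
    and D: "C1_L2_deriv (time_interval T) (\<lambda>t x. u (x, t)) ut"
    and weak: "weak_formulation \<mu> p T u ut"
    and a: "test_function UNIV a" and l: "smooth_on {-1<..} lam"
    and l': "\<And>s. s \<ge> 0 \<Longrightarrow> (lam has_real_derivative lam' s) (at s)" "continuous_on {0..} lam'"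
    and t: "t \<in> time_interval T"
  shows "lam t * (LINT x|lborel. ut t x * a x) - lam 0 * (LINT x|lborel. ut 0 x * a x)
    = (LINT s:{0..t}|lborel. (lam' s - \<mu> / (1 + s) * lam s) * (LINT x|lborel. ut s x * a x)
        + lam s * (LINT x|lborel. u (x, s) * laplacian a x))
      + (LINT s:{0..t}|lborel. lam s * (LINT x|lborel. \<bar>u (x, s)\<bar> powr p * a x))"
proof -
  obtain \<Psi> where \<Psi>: "test_function (space_time T) \<Psi>"
    "\<And>x s. s \<in> {0..t} \<Longrightarrow> \<Psi> (x, s) = lam s * a x"
    "\<And>x s D. s \<in> {0..t} \<Longrightarrow> (lam has_real_derivative D) (at s) \<Longrightarrow> time_deriv T \<Psi> (x, s) = D * a x"
    "\<And>x s. s \<in> {0..t} \<Longrightarrow>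
       space_grad T \<Psi> (x, s) = lam s *\<^sub>R (\<Sum>b\<in>Basis. frechet_derivative a (at x) b *\<^sub>R b)"
    using separated_test_function[OF a l t] by blast
  define V where "V s = (LINT x|lborel. ut s x * a x)" for s
  define L where "L s = (LINT x|lborel. u (x, s) * laplacian a x)" for s
  have t0: "t \<ge> 0" using t by (simp add: time_interval_def)
  have sub: "s \<in> time_interval T" if "s \<in> {0..t}" for s
    using time_interval_downward[OF t] that by auto
  have aL: "a \<in> L2" by (rule test_function_L2[OF a])
  have utL: "ut s \<in> L2" if "s \<in> {0..t}" for s using D sub[OF that] by (auto simp: C1_L2_deriv_def C_L2_def)
  have Vc: "continuous_on {0..t} V" unfolding V_def
    using D sub by (intro continuous_on_subset[OF L2_pairing_continuous[OF _ aL]]) (auto simp: C1_L2_deriv_def)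
  have Lc: "continuous_on {0..t} L" unfolding L_def
    using D sub by (intro continuous_on_subset[OF L2_pairing_continuous[OF _ laplacian_L2[OF a]]]) (auto simp: C1_L2_deriv_def)
  have l'c: "continuous_on {0..t} lam'" using l'(2) by (rule continuous_on_subset) auto
  have lc: "continuous_on {0..t} lam"
    using smooth_on_imp_continuous_on[OF l] by (rule continuous_on_subset) auto
  have 1: "(LINT x|lborel. ut s x * \<Psi> (x, s)) = lam s * V s" if "s \<in> {0..t}" for s
  proof -
    have "(LINT x|lborel. ut s x * \<Psi> (x, s)) = (LINT x|lborel. lam s * (ut s x * a x))"
      using \<Psi>(2)[OF that] by (simp add: mult_ac)
    then show ?thesis by (simp add: V_def)
  qed
  have 2: "(LINT x|lborel. - ut s x * time_deriv T \<Psi> (x, s)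
        + weak_gradient (\<lambda>y. u (y, s)) x \<bullet> space_grad T \<Psi> (x, s)) = - lam' s * V s - lam s * L s"
    if s: "s \<in> {0..t}" for s
  proof -
    let ?g = "\<lambda>x. weak_gradient (\<lambda>y. u (y, s)) x \<bullet> (\<Sum>b\<in>Basis. frechet_derivative a (at x) b *\<^sub>R b)"
    have g: "integrable lborel ?g" "integral\<^sup>L lborel ?g = - L s"
      using weak_gradient_laplacian[OF H1[OF sub[OF s]] a] by (auto simp: L_def)
    have "(LINT x|lborel. - ut s x * time_deriv T \<Psi> (x, s)
        + weak_gradient (\<lambda>y. u (y, s)) x \<bullet> space_grad T \<Psi> (x, s))
       = (LINT x|lborel. (- lam' s) * (ut s x * a x) + lam s * ?g x)"
      using \<Psi>(3)[OF s l'(1)] \<Psi>(4)[OF s] s by (intro Bochner_Integration.integral_cong) (auto simp: mult_ac)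
    also have "\<dots> = (- lam' s) * V s + lam s * integral\<^sup>L lborel ?g"
      unfolding V_def using g(1) L2_mult_integrable[OF utL[OF s] aL]
      by (subst Bochner_Integration.integral_add) auto
    finally show ?thesis using g(2) by simp
  qed
  have 3: "(LINT x|lborel. \<mu> * ut s x / (1 + s) * \<Psi> (x, s)) = \<mu> / (1 + s) * lam s * V s"
    if s: "s \<in> {0..t}" for s
  proof -
    have "(LINT x|lborel. \<mu> * ut s x / (1 + s) * \<Psi> (x, s)) = (LINT x|lborel. \<mu> / (1 + s) * lam s * (ut s x * a x))"
      using \<Psi>(2)[OF s] by (simp add: mult_ac)
    then show ?thesis by (simp add: V_def)
  qed
  have 4: "(LINT x|lborel. \<bar>u (x, s)\<bar> powr p * \<Psi> (x, s)) = lam s * (LINT x|lborel. \<bar>u (x, s)\<bar> powr p * a x)"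
    if s: "s \<in> {0..t}" for s
  proof -
    have "(LINT x|lborel. \<bar>u (x, s)\<bar> powr p * \<Psi> (x, s)) = (LINT x|lborel. lam s * (\<bar>u (x, s)\<bar> powr p * a x))"
      using \<Psi>(2)[OF s] by (simp add: mult_ac)
    then show ?thesis by simp
  qed
  have i: "set_integrable lborel {0..t} (\<lambda>s. - lam' s * V s - lam s * L s)"
    "set_integrable lborel {0..t} (\<lambda>s. \<mu> / (1 + s) * lam s * V s)"
    by (intro borel_integrable_atLeastAtMost' continuous_intros l'c lc Vc Lc; auto)+
  have "lam t * V t - lam 0 * V 0 + (LINT s:{0..t}|lborel. - lam' s * V s - lam s * L s)
      + (LINT s:{0..t}|lborel. \<mu> / (1 + s) * lam s * V s)
      = (LINT s:{0..t}|lborel. lam s * (LINT x|lborel. \<bar>u (x, s)\<bar> powr p * a x))"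
    using weak[unfolded weak_formulation_def, rule_format, OF \<Psi>(1) t] 1[of t] 1[of 0] t0
      set_lebesgue_integral_cong[of "{0..t}" lborel "\<lambda>s. (LINT x|lborel. - ut s x * time_deriv T \<Psi> (x, s)
        + weak_gradient (\<lambda>y. u (y, s)) x \<bullet> space_grad T \<Psi> (x, s))" "\<lambda>s. - lam' s * V s - lam s * L s"]
      set_lebesgue_integral_cong[of "{0..t}" lborel "\<lambda>s. (LINT x|lborel. \<mu> * ut s x / (1 + s) * \<Psi> (x, s))"
        "\<lambda>s. \<mu> / (1 + s) * lam s * V s"]
      set_lebesgue_integral_cong[of "{0..t}" lborel "\<lambda>s. (LINT x|lborel. \<bar>u (x, s)\<bar> powr p * \<Psi> (x, s))"
        "\<lambda>s. lam s * (LINT x|lborel. \<bar>u (x, s)\<bar> powr p * a x)"]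
      2 3 4 by simp
  moreover have "(LINT s:{0..t}|lborel. (lam' s - \<mu> / (1 + s) * lam s) * V s + lam s * L s)
     = - (LINT s:{0..t}|lborel. (- lam' s * V s - lam s * L s) + \<mu> / (1 + s) * lam s * V s)"
    unfolding set_integral_uminus[OF set_integral_add(1)[OF i], symmetric]
    by (rule set_lebesgue_integral_cong) (auto simp: algebra_simps)
  moreover have "(LINT s:{0..t}|lborel. (- lam' s * V s - lam s * L s) + \<mu> / (1 + s) * lam s * V s)
      = (LINT s:{0..t}|lborel. - lam' s * V s - lam s * L s) + (LINT s:{0..t}|lborel. \<mu> / (1 + s) * lam s * V s)"
    by (rule set_integral_add(2)[OF i])
  ultimately show ?thesis unfolding V_def L_def by linarith
qed

section \<open>From support and integrability in space-time to time slices\<close>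

lemma AE_outside_ess_support:
  fixes u :: "'a::euclidean_space \<Rightarrow> real"
  assumes "ess_support S u \<subseteq> A"
  shows "AE w in lborel. w \<in> S - A \<longrightarrow> u w = 0"
proof -
  define \<W> where "\<W> = {W. open W \<and> (AE w in lborel. w \<in> W \<inter> S \<longrightarrow> u w = 0)}"
  \<comment> \<open>The open sets on which u vanishes almost everywhere may be uncountable in
    number; Lindelof's theorem leaves only countably many exceptional null sets.\<close>
  obtain \<V> where V: "\<V> \<subseteq> \<W>" "countable \<V>" "\<Union>\<V> = \<Union>\<W>"
    using Lindelof[of \<W>] by (auto simp: \<W>_def)
  have "AE w in lborel. \<forall>W\<in>\<V>. w \<in> W \<inter> S \<longrightarrow> u w = 0"
    using V by (intro AE_ball_countable') (auto simp: \<W>_def)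
  then show ?thesis
  proof eventually_elim
    case (elim w)
    show ?case
    proof
      assume w: "w \<in> S - A"
      then have "w \<notin> ess_support S u" using assms by auto
      then have "w \<in> \<Union>\<W>" using w by (auto simp: ess_support_def \<W>_def)
      then show "u w = 0" using elim V w by blast
    qed
  qed
qed

lemma AE_lborel_slices:
  fixes P :: "'a::euclidean_space \<times> real \<Rightarrow> bool"
  assumes "AE z in lborel. P z"
  shows "AE s in lborel. AE x in lborel. P (x, s)"
proof -
  have "AE z in distr (lborel \<Otimes>\<^sub>M lborel) (lborel \<Otimes>\<^sub>M lborel) (\<lambda>(x, y). (y, x)). P z"
    using assms unfolding lborel_prod[symmetric] by (subst lborel_pair.distr_pair_swap[symmetric])
  then have "AE z in lborel \<Otimes>\<^sub>M lborel. P ((\<lambda>(x, y). (y, x)) z)"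
    by (rule AE_distrD[rotated]) measurable
  then show ?thesis using lborel_pair.AE_pair by fastforce
qed

lemma AE_exists_in_interval:
  fixes a b :: real
  assumes "AE s in lborel. P s" "a < b"
  obtains s where "s \<in> {a<..<b}" "P s"
proof -
  have "\<exists>s\<in>{a<..<b}. P s"
  proof (rule ccontr)
    assume "\<not> ?thesis"
    then have "AE s in lborel. s \<notin> {a<..<b}" using assms(1) by (auto elim!: eventually_mono)
    then have "emeasure lborel {a<..<b} = 0"
      by (subst (asm) AE_iff_measurable[where N = "{a<..<b}"]) auto
    then show False using assms(2) by simp
  qed
  then show ?thesis using that by blast
qed

text \<open>The support hypothesis yields information for almost every time only. For given t, good
  times s > t close to t have slices vanishing beyond t + R + \<delta>. These converge in L^2 to
  u(t), and the difference quotients to ut t; vanishing survives the limit, and then \<delta> tends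
  to 0. Approaching from the right includes t = 0.\<close>

lemma support_slices:
  fixes u :: "'a::euclidean_space \<times> real \<Rightarrow> real"
  assumes D: "C1_L2_deriv (time_interval T) (\<lambda>t x. u (x, t)) ut"
    and supp: "ess_support (space_time T) u \<subseteq> {(x, t). (x, t) \<in> space_time T \<and> norm x \<le> t + R}"
    and t: "t \<in> time_interval T"
  shows "AE x in lborel. norm x > t + R \<longrightarrow> u (x, t) = 0"
    and "AE x in lborel. norm x > t + R \<longrightarrow> ut t x = 0"
proof -
  let ?I = "time_interval T"
  have UL: "(\<lambda>x. u (x, s)) \<in> L2" "ut s \<in> L2" if "s \<in> ?I" for s
    using D that by (auto simp: C1_L2_deriv_def C_L2_def)
  have good: "AE s in lborel. AE x in lborel. (x, s) \<in> space_time T \<and> norm x > s + R \<longrightarrow> u (x, s) = 0"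
  proof -
    have "AE z in lborel. z \<in> space_time T \<and> norm (fst z) > snd z + R \<longrightarrow> u z = 0"
      by (rule eventually_mono[OF AE_outside_ess_support[OF supp]]) auto
    from AE_lborel_slices[OF this] show ?thesis by simp
  qed
  have right: "\<exists>s. s \<in> ?I \<and> t < s \<and> s < t + \<delta> \<and> P s \<and> (AE x in lborel. norm x > s + R \<longrightarrow> u (x, s) = 0)"
    if "\<forall>\<^sub>F s in at t within ?I. P s" "\<delta> > 0" "t \<in> ?I" for P \<delta> t
  proof -
    obtain d where d: "d > 0" "\<And>s. s \<in> ?I \<Longrightarrow> s \<noteq> t \<Longrightarrow> dist s t < d \<Longrightarrow> P s"
      using \<open>\<forall>\<^sub>F s in at t within ?I. P s\<close> unfolding eventually_at by auto
    obtain t' where t': "t < t'" "t' \<in> ?I" using time_interval_later[OF \<open>t \<in> ?I\<close>] .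
    define b where "b = min t' (t + min d \<delta>)"
    have "t < b" using t' d \<open>\<delta> > 0\<close> by (auto simp: b_def)
    then obtain s where s: "s \<in> {t<..<b}"
      "AE x in lborel. (x, s) \<in> space_time T \<and> norm x > s + R \<longrightarrow> u (x, s) = 0"
      using AE_exists_in_interval[OF good] by blast
    have sI: "s \<in> ?I" using s \<open>t \<in> ?I\<close>
      by (intro time_interval_downward[OF t'(2)]) (auto simp: b_def time_interval_def)
    then show ?thesis using s d(2)[of s] by (intro exI[of _ s]) (auto simp: b_def dist_real_def space_time_def)
  qed
  have open_up: "AE x in lborel. norm x > t + R \<longrightarrow> v x = 0"
    if v: "v \<in> L2" and lim: "\<And>\<delta> e. \<delta> > 0 \<Longrightarrow> e > 0 \<Longrightarrow>
        \<exists>w\<in>L2. (AE x in lborel. norm x > t + R + \<delta> \<longrightarrow> w x = 0) \<and> L2_norm (\<lambda>x. w x - v x) < e"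
    for v :: "'a \<Rightarrow> real" and t
  proof -
    have "AE x in lborel. \<forall>k::nat. norm x > t + R + 1 / (real k + 1) \<longrightarrow> v x = 0"
      unfolding AE_all_countable
    proof
      fix k :: nat
      have "{x::'a. norm x > t + R + 1 / (real k + 1)} = - cball 0 (t + R + 1 / (real k + 1))" by auto
      then have "{x::'a. norm x > t + R + 1 / (real k + 1)} \<in> sets borel" by auto
      from L2_vanish_limit[OF v this] show "AE x in lborel. norm x > t + R + 1 / (real k + 1) \<longrightarrow> v x = 0"
        using lim[of "1 / (real k + 1)"] by auto
    qed
    then show ?thesis
    proof eventually_elim
      case (elim x)
      show ?case
      proof
        assume "norm x > t + R"
        then obtain k where "1 / (real k + 1) < norm x - (t + R)"
          using reals_Archimedean[of "norm x - (t + R)"] by (auto simp: field_simps inverse_eq_divide)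
        then have "norm x > t + R + 1 / (real k + 1)" by linarith
        then show "v x = 0" using elim by blast
      qed
    qed
  qed
  have A: "AE x in lborel. norm x > t + R \<longrightarrow> u (x, t) = 0" if t: "t \<in> ?I" for t
  proof (rule open_up[OF UL(1)[OF t]])
    fix \<delta> e :: real assume "\<delta> > 0" "e > 0"
    have "((\<lambda>s. L2_norm (\<lambda>x. u (x, s) - u (x, t))) \<longlongrightarrow> 0) (at t within ?I)"
      using D t by (auto simp: C1_L2_deriv_def C_L2_def)
    from order_tendstoD(2)[OF this \<open>e > 0\<close>]
    obtain s where s: "s \<in> ?I" "t < s" "s < t + \<delta>" "L2_norm (\<lambda>x. u (x, s) - u (x, t)) < e"
      "AE x in lborel. norm x > s + R \<longrightarrow> u (x, s) = 0"
      using right[OF _ \<open>\<delta> > 0\<close> t] by blast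
    have "AE x in lborel. norm x > t + R + \<delta> \<longrightarrow> u (x, s) = 0"
      using s(5) by eventually_elim (use s in auto)
    then show "\<exists>w\<in>L2. (AE x in lborel. norm x > t + R + \<delta> \<longrightarrow> w x = 0) \<and> L2_norm (\<lambda>x. w x - u (x, t)) < e"
      using s UL(1)[OF s(1)] by (intro bexI[of _ "\<lambda>x. u (x, s)"]) auto
  qed
  show "AE x in lborel. norm x > t + R \<longrightarrow> u (x, t) = 0" by (rule A[OF t])
  show "AE x in lborel. norm x > t + R \<longrightarrow> ut t x = 0"
  proof (rule open_up[OF UL(2)[OF t]])
    fix \<delta> e :: real assume "\<delta> > 0" "e > 0"
    have "((\<lambda>s. L2_norm (\<lambda>x. (u (x, s) - u (x, t)) / (s - t) - ut t x)) \<longlongrightarrow> 0) (at t within ?I)"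
      using D t by (auto simp: C1_L2_deriv_def)
    from order_tendstoD(2)[OF this \<open>e > 0\<close>]
    obtain s where s: "s \<in> ?I" "t < s" "s < t + \<delta>"
      "L2_norm (\<lambda>x. (u (x, s) - u (x, t)) / (s - t) - ut t x) < e"
      "AE x in lborel. norm x > s + R \<longrightarrow> u (x, s) = 0"
      using right[OF _ \<open>\<delta> > 0\<close> t] by blast
    have "AE x in lborel. norm x > t + R + \<delta> \<longrightarrow> (u (x, s) - u (x, t)) / (s - t) = 0"
      using s(5) A[OF t] by eventually_elim (use s \<open>\<delta> > 0\<close> in auto)
    then show "\<exists>w\<in>L2. (AE x in lborel. norm x > t + R + \<delta> \<longrightarrow> w x = 0) \<and> L2_norm (\<lambda>x. w x - ut t x) < e"
      using s UL(1)[OF s(1)] UL(1)[OF t]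
      by (intro bexI[of _ "\<lambda>x. (u (x, s) - u (x, t)) / (s - t)"]) (auto intro!: L2_divide L2_diff)
  qed
qed

lemma set_integrable_continuous_mult:
  fixes h K :: "real \<Rightarrow> real"
  assumes K: "set_integrable lborel {a..b} K" and h: "continuous_on {a..b} h"
  shows "set_integrable lborel {a..b} (\<lambda>s. h s * K s)"
proof -
  have "compact (h ` {a..b})" by (intro compact_continuous_image h) auto
  then obtain B where B: "\<And>s. s \<in> {a..b} \<Longrightarrow> \<bar>h s\<bar> \<le> B"
    using compact_imp_bounded[of "h ` {a..b}"] unfolding bounded_iff ball_simps real_norm_def by blast
  define k where "k s = indicat_real {a..b} s *\<^sub>R K s" for s
  define h0 where "h0 s = indicat_real {a..b} s *\<^sub>R h s" for s
  have k: "integrable lborel k" using K by (simp add: set_integrable_def k_def[abs_def])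
  have [measurable]: "h0 \<in> borel_measurable borel" unfolding h0_def[abs_def]
    by (rule borel_measurable_continuous_on_indicator) (use h in auto)
  have "integrable lborel (\<lambda>s. h0 s * k s)"
  proof (rule Bochner_Integration.integrable_bound)
    show "integrable lborel (\<lambda>s. \<bar>B\<bar> * k s)" using k by simp
    have "\<bar>h0 s\<bar> \<le> \<bar>B\<bar>" for s
      using B[of s] by (auto simp: h0_def indicator_def)
    then show "AE s in lborel. norm (h0 s * k s) \<le> norm (\<bar>B\<bar> * k s)"
      by (auto simp: abs_mult intro!: mult_right_mono)
    show "(\<lambda>s. h0 s * k s) \<in> borel_measurable lborel" using borel_measurable_integrable[OF k] by measurable
  qed
  moreover have "(\<lambda>s. h0 s * k s) = (\<lambda>s. indicat_real {a..b} s *\<^sub>R (h s * K s))"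
    by (auto simp: h0_def k_def indicator_def fun_eq_iff)
  ultimately show ?thesis by (simp add: set_integrable_def)
qed

text \<open>Fubini on a compact cylinder over {0..E} whose base contains the support of
  \<open>a\<close>. The exceptional null set of times is the reason why the later bounds on the
  nonlinear term hold almost everywhere in s.\<close>

lemma Lp_loc_slices_integrable:
  fixes u :: "'a::euclidean_space \<times> real \<Rightarrow> real"
  assumes u: "Lp_loc p (space_time T) u" and a: "test_function UNIV a" and E: "E \<in> time_interval T"
  shows "AE s in lborel. s \<in> {0..E} \<longrightarrow> integrable lborel (\<lambda>x. \<bar>u (x, s)\<bar> powr p * a x)"
    and "set_integrable lborel {0..E} (\<lambda>s. LINT x|lborel. \<bar>u (x, s)\<bar> powr p * a x)"
proof -
  obtain r B where rB: "\<And>x. \<bar>a x\<bar> \<le> B" "\<And>x. norm x > r \<Longrightarrow> a x = 0" "continuous_on UNIV a"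
    using test_function_UNIV_bounds[OF a] by metis
  define Q where "Q = cball (0::'a) r \<times> {0..E}"
  have "compact Q" "Q \<subseteq> space_time T"
    using time_interval_downward[OF E] by (auto simp: Q_def space_time_def intro: compact_Times)
  then have i: "integrable lborel (\<lambda>z. indicat_real Q z * \<bar>u z\<bar> powr p)"
    using u by (simp add: Lp_loc_def set_integrable_def)
  have "continuous_on UNIV (\<lambda>z::'a \<times> real. a (fst z))"
    by (intro continuous_on_compose2[OF rB(3)] continuous_intros) auto
  then have [measurable]: "(\<lambda>z::'a \<times> real. a (fst z)) \<in> borel_measurable borel"
    by (rule borel_measurable_continuous_onI)
  have "integrable lborel (\<lambda>z. a (fst z) * (indicat_real Q z * \<bar>u z\<bar> powr p))"
  proof (rule Bochner_Integration.integrable_bound)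
    show "integrable lborel (\<lambda>z. \<bar>B\<bar> * (indicat_real Q z * \<bar>u z\<bar> powr p))" using i by simp
    have "\<bar>a x\<bar> \<le> \<bar>B\<bar>" for x using rB(1)[of x] by simp
    then show "AE z in lborel. norm (a (fst z) * (indicat_real Q z * \<bar>u z\<bar> powr p))
       \<le> norm (\<bar>B\<bar> * (indicat_real Q z * \<bar>u z\<bar> powr p))"
      by (auto simp: abs_mult intro!: mult_right_mono)
    show "(\<lambda>z. a (fst z) * (indicat_real Q z * \<bar>u z\<bar> powr p)) \<in> borel_measurable lborel"
      using borel_measurable_integrable[OF i] by measurable
  qed
  moreover have "(\<lambda>z. a (fst z) * (indicat_real Q z * \<bar>u z\<bar> powr p))
      = case_prod (\<lambda>x s. indicat_real {0..E} s * (\<bar>u (x, s)\<bar> powr p * a x))"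
  proof
    fix z
    show "a (fst z) * (indicat_real Q z * \<bar>u z\<bar> powr p)
      = (case z of (x, s) \<Rightarrow> indicat_real {0..E} s * (\<bar>u (x, s)\<bar> powr p * a x))"
      using rB(2)[of "fst z"] by (cases z) (auto simp: Q_def indicator_def not_le)
  qed
  ultimately have j: "integrable (lborel \<Otimes>\<^sub>M lborel) (case_prod (\<lambda>x s. indicat_real {0..E} s * (\<bar>u (x, s)\<bar> powr p * a x)))"
    by (simp add: lborel_prod)
  show "AE s in lborel. s \<in> {0..E} \<longrightarrow> integrable lborel (\<lambda>x. \<bar>u (x, s)\<bar> powr p * a x)"
    using lborel_pair.AE_integrable_snd[OF j] by eventually_elim (auto simp: indicator_def)
  show "set_integrable lborel {0..E} (\<lambda>s. LINT x|lborel. \<bar>u (x, s)\<bar> powr p * a x)"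
    using lborel_pair.integrable_snd[OF j] by (simp add: set_integrable_def)
qed

text \<open>Where v does not vanish the cutoff is 1, so both integrals reduce to the ball of radius
  r, and \<open>Hoelder_lower_bound\<close> applies there.\<close>

lemma slice_Hoelder:
  fixes v \<phi> :: "'a::euclidean_space \<Rightarrow> real"
  assumes p: "p > 1" and r: "0 \<le> r" "r \<le> \<rho>"
    and v: "v \<in> L2" "AE x in lborel. norm x > r \<longrightarrow> v x = 0"
    and \<phi>: "\<And>x. \<phi> x > 0" "smooth_on UNIV \<phi>"
    and i: "integrable lborel (\<lambda>x. \<bar>v x\<bar> powr p * (ball_cutoff \<rho> x * 1))"
    and D: "D > 0" "(\<integral>\<^sup>+x. ennreal (\<phi> x powr (p / (p - 1))) * indicator (cball 0 r) x \<partial>lborel) \<le> ennreal D"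
    and A: "0 \<le> A" "A \<le> (LINT x|lborel. v x * (ball_cutoff \<rho> x * \<phi> x))"
  shows "A powr p * D powr (1 - p) \<le> (LINT x|lborel. \<bar>v x\<bar> powr p * (ball_cutoff \<rho> x * 1))"
proof -
  have \<rho>: "\<rho> \<ge> 0" using r by simp
  have [measurable]: "v \<in> borel_measurable borel" using v by (simp add: L2_measurable)
  have [measurable]: "\<phi> \<in> borel_measurable borel"
    using \<phi>(2) by (intro borel_measurable_continuous_onI smooth_on_imp_continuous_on)
  have [measurable]: "ball_cutoff \<rho> \<in> borel_measurable (borel :: 'a measure)"
    using smooth_on_ball_cutoff by (intro borel_measurable_continuous_onI smooth_on_imp_continuous_on)
  have [measurable]: "cball (0::'a) r \<in> sets borel" by simp
  have one: "ball_cutoff \<rho> x = 1" if "norm x \<le> r" for x :: 'a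
    using that r by (intro ball_cutoff_eq_1) auto
  have e1: "AE x in lborel. \<bar>v x\<bar> powr p * (ball_cutoff \<rho> x * 1) = indicat_real (cball 0 r) x *\<^sub>R \<bar>v x\<bar> powr p"
    using v(2) by eventually_elim (auto simp: indicator_def one not_le)
  have e2: "AE x in lborel. v x * (ball_cutoff \<rho> x * \<phi> x) = indicat_real (cball 0 r) x *\<^sub>R (v x * \<phi> x)"
    using v(2) by eventually_elim (auto simp: indicator_def one not_le)
  have i2: "integrable lborel (\<lambda>x. v x * (ball_cutoff \<rho> x * \<phi> x))"
    by (intro L2_mult_integrable v test_function_L2 test_function_ball_cutoff \<rho> \<phi>)
  have nn: "(\<integral>\<^sup>+x. ennreal (indicat_real (cball 0 r) x *\<^sub>R \<phi> x powr (p / (p - 1))) \<partial>lborel) \<le> ennreal D"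
  proof -
    have "(\<integral>\<^sup>+x. ennreal (indicat_real (cball 0 r) x *\<^sub>R \<phi> x powr (p / (p - 1))) \<partial>lborel)
       = (\<integral>\<^sup>+x. ennreal (\<phi> x powr (p / (p - 1))) * indicator (cball 0 r) x \<partial>lborel)"
      by (rule nn_integral_cong) (auto simp: indicator_def)
    then show ?thesis using D(2) by simp
  qed
  have i3: "integrable lborel (\<lambda>x. indicat_real (cball 0 r) x *\<^sub>R \<phi> x powr (p / (p - 1)))"
    using nn by (intro integrableI_nonneg) (auto simp: indicator_def intro: le_less_trans)
  have "A powr p * D powr (1 - p) \<le> (LINT x:cball 0 r|lborel. \<bar>v x\<bar> powr p)"
  proof (rule Hoelder_lower_bound[OF p D(1) A(1), where \<phi> = \<phi>])
    show "set_integrable lborel (cball 0 r) (\<lambda>x. \<bar>v x\<bar> powr p)"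
      unfolding set_integrable_def by (subst integrable_cong_AE[THEN iffD1, OF _ _ e1 i]) auto
    show "set_integrable lborel (cball 0 r) (\<lambda>x. v x * \<phi> x)"
      unfolding set_integrable_def by (subst integrable_cong_AE[THEN iffD1, OF _ _ e2 i2]) auto
    show "A \<le> (LINT x:cball 0 r|lborel. v x * \<phi> x)"
      unfolding set_lebesgue_integral_def using A(2) by (subst integral_cong_AE[OF _ _ e2, symmetric]) auto
    show "set_integrable lborel (cball 0 r) (\<lambda>x. \<phi> x powr (p / (p - 1)))"
      unfolding set_integrable_def by (rule i3)
    have "ennreal (LINT x:cball 0 r|lborel. \<phi> x powr (p / (p - 1))) \<le> ennreal D"
      using nn nn_integral_eq_integral[OF i3] unfolding set_lebesgue_integral_def by simp
    then show "(LINT x:cball 0 r|lborel. \<phi> x powr (p / (p - 1))) \<le> D"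
      using D(1) by (simp add: ennreal_le_iff)
    show "\<phi> x \<ge> 0" for x using \<phi>(1)[of x] by simp
  qed
  also have "\<dots> = (LINT x|lborel. \<bar>v x\<bar> powr p * (ball_cutoff \<rho> x * 1))"
    unfolding set_lebesgue_integral_def by (subst integral_cong_AE[OF _ _ e1]) auto
  finally show ?thesis .
qed

section \<open>The Strauss polynomial, smooth weights and the initial moment\<close>

lemma strauss_gamma_pos:
  assumes d: "d > 1" and p: "1 < p" "p < strauss_exponent d"
  shows "strauss_gamma p d > 0"
proof -
  define S where "S = sqrt (d\<^sup>2 + 10 * d - 7)"
  \<comment> \<open>Completing the square gives 4 (d - 1) \<gamma> = S^2 - X^2. The upper bound on p
    says X < S, and p > 1 gives X > d - 3 \<ge> -S.\<close>
  define X where "X = 2 * (d - 1) * p - (d + 1)"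
  have S2: "S\<^sup>2 = d\<^sup>2 + 10 * d - 7" unfolding S_def using d one_less_power[of d 2] by (intro real_sqrt_pow2) linarith
  have "\<bar>d - 3\<bar> \<le> S" unfolding S_def
    by (rule real_le_rsqrt) (use d in \<open>simp add: power2_eq_square algebra_simps\<close>)
  moreover have "X > d - 3"
  proof -
    have "2 * (d - 1) * 1 < 2 * (d - 1) * p" using d p by (intro mult_strict_left_mono) auto
    then show ?thesis by (simp add: X_def)
  qed
  ultimately have "- S < X" by linarith
  moreover have "X < S" using p(2) d by (simp add: X_def S_def strauss_exponent_def field_simps)
  ultimately have "\<bar>X\<bar> < \<bar>S\<bar>" by linarith
  then have "X\<^sup>2 < S\<^sup>2" by (metis abs_ge_zero power2_abs power_strict_mono zero_less_numeral)
  then have "0 < (S\<^sup>2 - X\<^sup>2) / (4 * (d - 1))" using d by simp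
  also have "(S\<^sup>2 - X\<^sup>2) / (4 * (d - 1)) = strauss_gamma p d"
    using d unfolding S2 X_def strauss_gamma_def by (simp add: field_simps power2_eq_square)
  finally show ?thesis .
qed

lemma smooth_on_shifted_powr: "smooth_on {-1<..} (\<lambda>t::real. (1 + t) powr a)"
proof -
  have D: "derivative_domain {-1::real<..}" by (rule derivative_domain_open) auto
  have "smooth_on {-1<..} (\<lambda>t::real. 1 + t)"
    by (intro smooth_on_add smooth_on_const smooth_on_linear D bounded_linear_ident)
  then show ?thesis by (intro smooth_on_compose[OF D _ _ smooth_on_powr]) auto
qed

lemma smooth_on_wave_weight: "smooth_on {-1<..} (wave_weight b c)"
proof -
  have D: "derivative_domain {-1::real<..}" by (rule derivative_domain_open) auto
  have l: "smooth_on {-1<..} (\<lambda>t::real. 1 + t)"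
    by (intro smooth_on_add smooth_on_const smooth_on_linear D bounded_linear_ident)
  then have "smooth_on {-1<..} (\<lambda>t::real. inverse (1 + t))"
    by (intro smooth_on_compose[OF D _ _ smooth_on_inverse]) auto
  then have "smooth_on {-1<..} (\<lambda>t::real. 1 + t + c * inverse (1 + t))"
    by (intro smooth_on_add[OF D l] smooth_on_mult smooth_on_const D)
  then have "smooth_on {-1<..} (\<lambda>t::real. exp (1 + t + c * inverse (1 + t)))"
    by (intro smooth_on_compose[OF D open_UNIV UNIV_I smooth_on_exp])
  then show ?thesis unfolding wave_weight_def[abs_def] divide_inverse
    by (intro smooth_on_mult smooth_on_shifted_powr D)
qed

lemma laplacian_const: "laplacian (\<lambda>_. c) x = 0"
proof -
  have "frechet_derivative (\<lambda>_::'a. k::real) (at y) = (\<lambda>_. 0)" for k y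
    by (rule frechet_derivative_at[symmetric]) simp
  then show ?thesis by (simp add: laplacian_def)
qed

text \<open>The eigenfunction is positive, so a zero moment would force f to vanish on the ball and
  hence almost everywhere. The cutoff, which is 1 on the ball, makes the eigenfunction square
  integrable and so yields integrability of the product.\<close>

lemma initial_moment_pos:
  fixes f :: "'a::euclidean_space \<Rightarrow> real"
  assumes f: "f \<in> L2" "AE x in lborel. f x \<ge> 0" "\<not> (AE x in lborel. f x = 0)"
    and out: "AE x in lborel. norm x > R \<longrightarrow> f x = 0"
  shows "(LINT x:cball 0 R|lborel. f x * wave_eigen x) > 0"
proof -
  have sm: "smooth_on UNIV (wave_eigen :: 'a \<Rightarrow> real)" by (rule smooth_on_dir_exp[OF bounded_weight_1])
  have [measurable]: "(wave_eigen :: 'a \<Rightarrow> real) \<in> borel_measurable borel"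
    using sm by (intro borel_measurable_continuous_onI smooth_on_imp_continuous_on)
  define \<rho> where "\<rho> = max R 0"
  have "integrable lborel (\<lambda>x. f x * (ball_cutoff \<rho> x * wave_eigen x))"
    by (intro L2_mult_integrable f test_function_L2 test_function_ball_cutoff sm) (simp add: \<rho>_def)
  then have "integrable lborel (\<lambda>x. indicat_real (cball 0 R) x *\<^sub>R (f x * (ball_cutoff \<rho> x * wave_eigen x)))"
    by (intro integrable_mult_indicator) auto
  moreover have "(\<lambda>x. indicat_real (cball 0 R) x *\<^sub>R (f x * (ball_cutoff \<rho> x * wave_eigen x)))
      = (\<lambda>x. indicat_real (cball 0 R) x *\<^sub>R (f x * wave_eigen x))"
    by (auto simp: fun_eq_iff indicator_def ball_cutoff_eq_1 \<rho>_def)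
  ultimately have i: "integrable lborel (\<lambda>x. indicat_real (cball 0 R) x *\<^sub>R (f x * wave_eigen x))" by simp
  have nn: "AE x in lborel. 0 \<le> indicat_real (cball 0 R) x *\<^sub>R (f x * wave_eigen x)"
    using f(2) by eventually_elim (auto simp: indicator_def less_imp_le[OF wave_eigen_pos])
  have "(LINT x:cball 0 R|lborel. f x * wave_eigen x) \<noteq> 0"
  proof
    assume "(LINT x:cball 0 R|lborel. f x * wave_eigen x) = 0"
    then have "AE x in lborel. indicat_real (cball 0 R) x *\<^sub>R (f x * wave_eigen x) = 0"
      unfolding set_lebesgue_integral_def using integral_nonneg_eq_0_iff_AE[OF i nn] by simp
    then have "AE x in lborel. f x = 0"
      using out
    proof eventually_elim
      case (elim x)
      then show ?case using wave_eigen_pos[of x] by (cases "norm x \<le> R") (auto simp: indicator_def)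
    qed
    then show False using f(3) by simp
  qed
  moreover have "(LINT x:cball 0 R|lborel. f x * wave_eigen x) \<ge> 0"
    unfolding set_lebesgue_integral_def using nn by (rule integral_nonneg_AE)
  ultimately show ?thesis by linarith
qed

lemma set_integral_split:
  fixes h :: "real \<Rightarrow> real"
  assumes "set_integrable lborel {0..t} h" "0 \<le> s" "s \<le> t"
  shows "(LINT r:{0..t}|lborel. h r) = (LINT r:{0..s}|lborel. h r) + (LINT r:{s..t}|lborel. h r)"
proof -
  have "{0..t} = {0..s} \<union> {s..t}" using assms by auto
  moreover have "(LINT r:{0..s} \<union> {s..t}|lborel. h r) = (LINT r:{0..s}|lborel. h r) + (LINT r:{s..t}|lborel. h r)"
  proof (rule set_integral_Un_AE)
    show "AE x in lborel. \<not> (x \<in> {0..s} \<and> x \<in> {s..t})"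
      using AE_lborel_singleton[of s] by eventually_elim auto
  qed (use assms in \<open>auto intro: set_integrable_subset\<close>)
  ultimately show ?thesis by simp
qed

text \<open>The test functions \<open>\<chi>\<close> and \<open>\<chi> * wave_eigen\<close>, with \<open>\<chi> = 1\<close> on the support of \<open>u\<close> up to time
  \<open>E\<close>, turn the weak equation into the identities for \<open>F = \<integral>u\<close> and \<open>G = \<integral>u wave_eigen\<close>.\<close>

lemma energy_solution_lower_bounds:
  fixes f g :: "'a::euclidean_space \<Rightarrow> real" and u :: "'a \<times> real \<Rightarrow> real"
  assumes p: "p > 1" and \<mu>: "\<mu> > 0" and R: "R \<ge> 1" and \<epsilon>: "\<epsilon> > 0"
    and f: "f \<in> L2" "AE x in lborel. f x \<ge> 0" and g: "AE x in lborel. g x \<ge> 0"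
    and c0: "(LINT x:cball 0 R|lborel. f x * wave_eigen x) > 0"
    and sol: "energy_solution \<mu> p \<epsilon> f g T u"
    and supp: "ess_support (space_time T) u \<subseteq> {(x, t). (x, t) \<in> space_time T \<and> norm x \<le> t + R}"
    and E: "E \<in> time_interval T" "E > 0"
  obtains F F' K G where
    "damped_equation \<mu> E F F' K"
    "\<And>D. (\<And>s. s \<ge> 0 \<Longrightarrow> D s > 0) \<Longrightarrow>
       (\<And>s. s \<ge> 0 \<Longrightarrow> emeasure lborel (cball (0::'a) (s + R)) \<le> ennreal (D s)) \<Longrightarrow>
       AE s in lborel. s \<in> {0..E} \<longrightarrow> F s \<ge> 0 \<longrightarrow> K s \<ge> F s powr p * D s powr (1 - p)"
    "\<And>D. (\<And>s. s \<ge> 0 \<Longrightarrow> D s > 0) \<Longrightarrow>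
       (\<And>s. s \<ge> 0 \<Longrightarrow> (\<integral>\<^sup>+x. ennreal (wave_eigen x powr (p / (p - 1))) * indicator (cball (0::'a) (s + R)) x \<partial>lborel)
           \<le> ennreal (D s)) \<Longrightarrow>
       AE s in lborel. s \<in> {0..E} \<longrightarrow> G s \<ge> 0 \<longrightarrow> K s \<ge> G s powr p * D s powr (1 - p)"
    "\<And>t. t \<in> {2 + \<mu> / 2..E} \<Longrightarrow> G t \<ge> \<epsilon> * (LINT x:cball 0 R|lborel. f x * wave_eigen x)
        / wave_weight (- (\<mu> / 2)) ((3 + \<mu> / 2)\<^sup>2) (2 + \<mu> / 2) * (exp t * (1 + t) powr (- (\<mu> / 2)))"
proof -
  let ?I = "time_interval T"
  define c where "c = (3 + \<mu> / 2)\<^sup>2"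
  define M0 where "M0 = (LINT x:cball 0 R|lborel. f x * wave_eigen x)"
  have CH: "C_H1 ?I (\<lambda>t x. u (x, t))" and Lp: "Lp_loc p (space_time T) u"
    using sol by (auto simp: energy_solution_def)
  obtain ut where D: "C1_L2_deriv ?I (\<lambda>t x. u (x, t)) ut"
    and u0: "AE x in lborel. u (x, 0) = \<epsilon> * f x" and ut0: "AE x in lborel. ut 0 x = \<epsilon> * g x"
    and weak: "weak_formulation \<mu> p T u ut"
    using sol by (rule energy_solutionE)
  have H1: "(\<lambda>x. u (x, t)) \<in> H1" if "t \<in> ?I" for t using CH that by (auto simp: C_H1_def)
  have sub: "s \<in> ?I" if "s \<in> {0..E}" for s using time_interval_downward[OF E(1)] that by auto
  have uL: "(\<lambda>x. u (x, s)) \<in> L2" if "s \<in> {0..E}" for s using H1[OF sub[OF that]] by (simp add: H1_def)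
  have zin: "0 \<in> {0..E}" using E by simp
  \<comment> \<open>The radius reached by the support at the final time, so that one cutoff serves
    all of {0..E}.\<close>
  define \<rho> where "\<rho> = E + R"
  have \<rho>: "\<rho> \<ge> 0" using E R by (simp add: \<rho>_def)
  have sm1: "smooth_on UNIV (\<lambda>_::'a. 1::real)" by (rule smooth_on_const[OF derivative_domain_UNIV])
  have smw: "smooth_on UNIV (wave_eigen :: 'a \<Rightarrow> real)" by (rule smooth_on_dir_exp[OF bounded_weight_1])
  \<comment> \<open>The factor 1 gives both functions the form cutoff times eigenfunction of the
    Laplacian, for the eigenvalues 0 and 1.\<close>
  define a0 a1 :: "'a \<Rightarrow> real" where "a0 x = ball_cutoff \<rho> x * 1" and "a1 x = ball_cutoff \<rho> x * wave_eigen x" for x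
  have ta: "test_function UNIV a0" "test_function UNIV a1"
    unfolding a0_def[abs_def] a1_def[abs_def] by (rule test_function_ball_cutoff[OF \<rho>], rule sm1 smw)+
  have ann: "a0 x \<ge> 0" "a1 x \<ge> 0" for x
    using ball_cutoff_nonneg[of \<rho> x] wave_eigen_pos[of x] by (auto simp: a0_def a1_def)
  define pair where "pair a s = (LINT x|lborel. u (x, s) * a x)" for a s
  define pair' where "pair' a s = (LINT x|lborel. ut s x * a x)" for a s
  define pw where "pw a s = (LINT x|lborel. \<bar>u (x, s)\<bar> powr p * a x)" for a s
  have der: "(pair a has_real_derivative pair' a t) (at t within {0..E})" if "test_function UNIV a" "t \<in> {0..E}" for a t
    unfolding pair_def pair'_def
    by (rule DERIV_subset[OF L2_pairing_has_derivative[OF D test_function_L2[OF that(1)] sub[OF that(2)]]])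
       (use sub in auto)
  have cont: "continuous_on {0..E} (pair' a)" if "test_function UNIV a" for a
    unfolding pair'_def using D sub
    by (intro continuous_on_subset[OF L2_pairing_continuous[OF _ test_function_L2[OF that]]]) (auto simp: C1_L2_deriv_def)
  have contp: "continuous_on {0..E} (pair a)" if "test_function UNIV a" for a
    by (rule DERIV_continuous_on[OF der[OF that]])
  have pwi: "set_integrable lborel {0..E} (pw a)" if "test_function UNIV a" for a
    unfolding pw_def by (rule Lp_loc_slices_integrable(2)[OF Lp that E(1)])
  have pwnn: "pw a s \<ge> 0" if "\<And>x. a x \<ge> 0" for a s
    unfolding pw_def using that by (intro Bochner_Integration.integral_nonneg) simp
  \<comment> \<open>Inside the cone the cutoff is 1 on a whole neighbourhood, so its derivatives do
    not contribute; outside, u vanishes.\<close>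
  have lap: "(LINT x|lborel. u (x, s) * laplacian (\<lambda>x. ball_cutoff \<rho> x * \<phi> x) x) = pair (\<lambda>x. ball_cutoff \<rho> x * \<psi> x) s"
    if s: "s \<in> {0..E}" and \<phi>: "smooth_on UNIV \<phi>" "smooth_on UNIV \<psi>" "\<And>x. laplacian \<phi> x = \<psi> x" for s \<phi> \<psi>
  proof -
    have e: "AE x in lborel. u (x, s) * laplacian (\<lambda>x. ball_cutoff \<rho> x * \<phi> x) x = u (x, s) * (ball_cutoff \<rho> x * \<psi> x)"
      using support_slices(1)[OF D supp sub[OF s]]
    proof eventually_elim
      case (elim x)
      show ?case
      proof (cases "norm x > s + R")
        case False
        then have x: "norm x < \<rho> + 1" using s by (simp add: \<rho>_def)
        have "laplacian (\<lambda>x. ball_cutoff \<rho> x * \<phi> x) x = laplacian \<phi> x"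
          by (rule laplacian_cong_open[where S = "ball 0 (\<rho> + 1)"]) (use x \<rho> in \<open>auto simp: ball_cutoff_eq_1\<close>)
        then show ?thesis using x \<rho> \<phi>(3) by (simp add: ball_cutoff_eq_1)
      qed (use elim in simp)
    qed
    have [measurable]: "(\<lambda>x. u (x, s)) \<in> borel_measurable borel" using uL[OF s] by (rule L2_measurable)
    have [measurable]: "laplacian (\<lambda>x. ball_cutoff \<rho> x * \<phi> x) \<in> borel_measurable borel"
      by (intro L2_measurable laplacian_L2 test_function_ball_cutoff \<rho> \<phi>)
    have [measurable]: "(\<lambda>x. ball_cutoff \<rho> x * \<psi> x) \<in> borel_measurable borel"
      by (intro L2_measurable test_function_L2 test_function_ball_cutoff \<rho> \<phi>)
    show ?thesis unfolding pair_def by (rule integral_cong_AE[OF _ _ e]) measurable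
  qed
  have lap0: "(LINT x|lborel. u (x, s) * laplacian a0 x) = 0" if "s \<in> {0..E}" for s
    using lap[OF that sm1 smooth_on_const[OF derivative_domain_UNIV, of 0] laplacian_const]
    by (simp add: a0_def[abs_def] pair_def)
  have lap1: "(LINT x|lborel. u (x, s) * laplacian a1 x) = pair a1 s" if "s \<in> {0..E}" for s
    using lap[OF that smw smw laplacian_wave_eigen] by (simp add: a1_def[abs_def])
  have pl: "((\<lambda>t. (1 + t) powr \<mu>) has_real_derivative \<mu> * (1 + s) powr (\<mu> - 1)) (at s)" if "s \<ge> 0" for s
    using that by (auto intro!: derivative_eq_intros)
  have plc: "continuous_on {0..} (\<lambda>s. \<mu> * (1 + s) powr (\<mu> - 1))" by (intro continuous_intros) auto
  have pz: "\<mu> * (1 + s) powr (\<mu> - 1) = \<mu> * (1 + s) powr \<mu> / (1 + s)" if "s \<ge> 0" for s :: real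
    using that by (simp add: powr_diff)
  have ident: "lam t * pair' a t - lam 0 * pair' a 0
    = (LINT s:{0..t}|lborel. (lam' s - \<mu> / (1 + s) * lam s) * pair' a s
        + lam s * (LINT x|lborel. u (x, s) * laplacian a x))
      + (LINT s:{0..t}|lborel. lam s * pw a s)"
    if "test_function UNIV a" "smooth_on {-1<..} lam" "\<And>s. s \<ge> 0 \<Longrightarrow> (lam has_real_derivative lam' s) (at s)"
      "continuous_on {0..} lam'" "t \<in> {0..E}" for a lam lam' t
    unfolding pair'_def pw_def
    by (rule energy_identity_separated[where T = T and u = u and ut = ut and \<mu> = \<mu> and p = p, OF _ D weak])
       (erule H1, rule that, rule that, erule that(3), rule that, rule sub, rule that)
  have Fid: "(1 + t) powr \<mu> * pair' a0 t - pair' a0 0 = (LINT s:{0..t}|lborel. (1 + s) powr \<mu> * pw a0 s)"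
    if t: "t \<in> {0..E}" for t
  proof -
    have "(LINT s:{0..t}|lborel. (\<mu> * (1 + s) powr (\<mu> - 1) - \<mu> / (1 + s) * (1 + s) powr \<mu>) * pair' a0 s
        + (1 + s) powr \<mu> * (LINT x|lborel. u (x, s) * laplacian a0 x)) = (LINT s:{0..t}|lborel. 0)"
      using t by (intro set_lebesgue_integral_cong) (auto simp: lap0 pz)
    then show ?thesis
      using ident[OF ta(1) smooth_on_shifted_powr pl plc t] by simp
  qed
  have Gid: "(1 + t) powr \<mu> * pair' a1 t - pair' a1 0
      = (LINT s:{0..t}|lborel. (1 + s) powr \<mu> * pair a1 s) + (LINT s:{0..t}|lborel. (1 + s) powr \<mu> * pw a1 s)"
    if t: "t \<in> {0..E}" for t
  proof -
    have "(LINT s:{0..t}|lborel. (\<mu> * (1 + s) powr (\<mu> - 1) - \<mu> / (1 + s) * (1 + s) powr \<mu>) * pair' a1 s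
        + (1 + s) powr \<mu> * (LINT x|lborel. u (x, s) * laplacian a1 x)) = (LINT s:{0..t}|lborel. (1 + s) powr \<mu> * pair a1 s)"
      using t by (intro set_lebesgue_integral_cong) (auto simp: lap1 pz)
    then show ?thesis
      using ident[OF ta(2) smooth_on_shifted_powr pl plc t] by simp
  qed
  define b where "b = \<mu> / 2"
  define l where "l = wave_weight b c"
  define l' where "l' s = (1 - c / (1 + s)\<^sup>2 + b / (1 + s)) * l s" for s
  have ld: "(l has_real_derivative l' s) (at s)" if "s \<ge> 0" for s
    unfolding l_def l'_def using wave_weight_deriv[of s b c UNIV] that by simp
  have lc: "continuous_on {0..} l"
    unfolding l_def using smooth_on_imp_continuous_on[OF smooth_on_wave_weight] by (rule continuous_on_subset) auto
  have l'c: "continuous_on {0..} l'" unfolding l'_def[abs_def] by (intro continuous_intros lc) auto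
  have lpos: "l s > 0" if "s \<ge> 0" for s unfolding l_def using that by (intro wave_weight_pos) simp
  define h where "h r = (1 - b / (1 + r) - c / (1 + r)\<^sup>2) * l r * pair' a1 r + l r * pair a1 r" for r
  have hc: "continuous_on {0..E} h" unfolding h_def[abs_def]
    by (intro continuous_intros cont contp ta continuous_on_subset[OF lc]) auto
  have hi: "set_integrable lborel {0..t} h" if "t \<le> E" for t
    by (intro borel_integrable_atLeastAtMost' continuous_on_subset[OF hc]) (use that in auto)
  have lpw: "set_integrable lborel {0..t} (\<lambda>s. l s * pw a1 s)" if "t \<le> E" for t
    by (intro set_integrable_continuous_mult set_integrable_subset[OF pwi[OF ta(2)]] continuous_on_subset[OF lc])
       (use that in auto)
  have Wid: "l t * pair' a1 t - l 0 * pair' a1 0 = (LINT s:{0..t}|lborel. h s) + (LINT s:{0..t}|lborel. l s * pw a1 s)"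
    if t: "t \<in> {0..E}" for t
  proof -
    \<comment> \<open>Since \<mu> = 2 b, subtracting the damping flips the sign of the term b/(1 +
      s).\<close>
    have "(l' s - \<mu> / (1 + s) * l s) = (1 - b / (1 + s) - c / (1 + s)\<^sup>2) * l s" for s
    proof -
      have "\<mu> / (1 + s) = (b + b) / (1 + s)" by (simp add: b_def)
      then show ?thesis by (simp only: l'_def) (simp add: add_divide_distrib algebra_simps)
    qed
    then have "(LINT s:{0..t}|lborel. (l' s - \<mu> / (1 + s) * l s) * pair' a1 s
        + l s * (LINT x|lborel. u (x, s) * laplacian a1 x)) = (LINT s:{0..t}|lborel. h s)"
      using t by (intro set_lebesgue_integral_cong) (auto simp: lap1 h_def)
    moreover have "smooth_on {-1<..} l" unfolding l_def by (rule smooth_on_wave_weight)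
    ultimately show ?thesis
      using ident[OF ta(2) _ ld l'c t] by simp
  qed
  have ii: "l t * pair' a1 t - l s * pair' a1 s \<ge> (LINT r:{s..t}|lborel. h r)"
    if st: "0 \<le> s" "s \<le> t" "t \<le> E" for s t
  proof -
    have "(LINT r:{s..t}|lborel. l r * pw a1 r) \<ge> 0"
      using st ann by (intro set_integral_nonneg_on mult_nonneg_nonneg pwnn less_imp_le[OF lpos]) auto
    then show ?thesis using Wid[of s] Wid[of t] set_integral_split[OF hi st(1,2)] set_integral_split[OF lpw st(1,2)] st
      by simp
  qed
  have out0: "AE x in lborel. norm x > R \<longrightarrow> u (x, 0) = 0"
    using support_slices(1)[OF D supp sub[OF zin]] by simp
  have F0: "pair a0 0 \<ge> 0"
    unfolding pair_def
  proof (rule integral_nonneg_AE)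
    show "AE x in lborel. 0 \<le> u (x, 0) * a0 x"
      using u0 f(2) by eventually_elim (use ann \<epsilon> in auto)
  qed
  have F'0: "pair' a 0 \<ge> 0" if "\<And>x. a x \<ge> 0" for a
    unfolding pair'_def
  proof (rule integral_nonneg_AE)
    show "AE x in lborel. 0 \<le> ut 0 x * a x"
      using ut0 g by eventually_elim (use that \<epsilon> in auto)
  qed
  have G0: "pair a1 0 = \<epsilon> * M0"
  proof -
    have e: "AE x in lborel. u (x, 0) * a1 x = \<epsilon> * (indicat_real (cball 0 R) x *\<^sub>R (f x * wave_eigen x))"
      using u0 out0
    proof eventually_elim
      case (elim x)
      have "a1 x = wave_eigen x" if "norm x \<le> R"
        using that E \<rho> by (simp add: a1_def ball_cutoff_eq_1 \<rho>_def)
      then show ?case using elim by (auto simp: indicator_def not_le)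
    qed
    have [measurable]: "(\<lambda>x. u (x, 0)) \<in> borel_measurable borel" "f \<in> borel_measurable borel"
      "a1 \<in> borel_measurable borel" "(wave_eigen :: 'a \<Rightarrow> real) \<in> borel_measurable borel"
      using L2_measurable[OF uL[OF zin]] L2_measurable[OF f(1)] test_function_measurable[OF ta(2)]
        borel_measurable_continuous_onI[OF smooth_on_imp_continuous_on[OF smw]] by auto
    have [measurable]: "cball (0::'a) R \<in> sets borel" by simp
    have "pair a1 0 = (LINT x|lborel. \<epsilon> * (indicat_real (cball 0 R) x *\<^sub>R (f x * wave_eigen x)))"
      unfolding pair_def by (rule integral_cong_AE[OF _ _ e]) auto
    then show ?thesis by (simp add: M0_def set_lebesgue_integral_def)
  qed
  \<comment> \<open>One argument for both lower bounds: \<phi> = 1 gives the feedback of F into the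
    nonlinear term, \<phi> = \<open>wave_eigen\<close> the bound through G.\<close>
  have hold: "AE s in lborel. s \<in> {0..E} \<longrightarrow> pair (\<lambda>x. ball_cutoff \<rho> x * \<phi> x) s \<ge> 0 \<longrightarrow>
      pw a0 s \<ge> pair (\<lambda>x. ball_cutoff \<rho> x * \<phi> x) s powr p * Ds s powr (1 - p)"
    if \<phi>: "\<And>x. \<phi> x > 0" "smooth_on UNIV \<phi>" and Ds: "\<And>s. s \<ge> 0 \<Longrightarrow> Ds s > 0"
      "\<And>s. s \<ge> 0 \<Longrightarrow> (\<integral>\<^sup>+x. ennreal (\<phi> x powr (p / (p - 1))) * indicator (cball (0::'a) (s + R)) x \<partial>lborel) \<le> ennreal (Ds s)"
    for \<phi> Ds
    using Lp_loc_slices_integrable(1)[OF Lp ta(1) E(1)]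
  proof eventually_elim
    case (elim s)
    show ?case
    proof (intro impI)
      assume s: "s \<in> {0..E}" and A: "pair (\<lambda>x. ball_cutoff \<rho> x * \<phi> x) s \<ge> 0"
      show "pair (\<lambda>x. ball_cutoff \<rho> x * \<phi> x) s powr p * Ds s powr (1 - p) \<le> pw a0 s"
        unfolding pw_def a0_def
      proof (rule slice_Hoelder[OF p _ _ uL[OF s] _ \<phi>, where r = "s + R"])
        show "AE x in lborel. norm x > s + R \<longrightarrow> u (x, s) = 0" by (rule support_slices(1)[OF D supp sub[OF s]])
        show "integrable lborel (\<lambda>x. \<bar>u (x, s)\<bar> powr p * (ball_cutoff \<rho> x * 1))"
          using elim s by (simp add: a0_def)
      qed (use s R A Ds in \<open>auto simp: \<rho>_def pair_def\<close>)
    qed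
  qed
  have b2: "2 * b = \<mu>" by (simp add: b_def)
  show ?thesis
  proof (rule that[of "pair a0" "pair' a0" "pw a0" "pair a1"])
    have "set_integrable lborel {0..E} (\<lambda>s. (1 + s) powr \<mu> * pw a0 s)"
      by (intro set_integrable_continuous_mult pwi ta continuous_intros) auto
    then show "damped_equation \<mu> E (pair a0) (pair' a0) (pw a0)"
      unfolding damped_equation_def using der cont ta F0 F'0 ann pwnn Fid by auto
    show "AE s in lborel. s \<in> {0..E} \<longrightarrow> pair a0 s \<ge> 0 \<longrightarrow> pw a0 s \<ge> pair a0 s powr p * Ds s powr (1 - p)"
      if "\<And>s. s \<ge> 0 \<Longrightarrow> Ds s > 0" "\<And>s. s \<ge> 0 \<Longrightarrow> emeasure lborel (cball (0::'a) (s + R)) \<le> ennreal (Ds s)" for Ds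
      using hold[of "\<lambda>_. 1" Ds] sm1 that by (simp add: a0_def[abs_def])
    show "AE s in lborel. s \<in> {0..E} \<longrightarrow> pair a1 s \<ge> 0 \<longrightarrow> pw a0 s \<ge> pair a1 s powr p * Ds s powr (1 - p)"
      if "\<And>s. s \<ge> 0 \<Longrightarrow> Ds s > 0" "\<And>s. s \<ge> 0 \<Longrightarrow> (\<integral>\<^sup>+x. ennreal (wave_eigen x powr (p / (p - 1))) * indicator (cball (0::'a) (s + R)) x \<partial>lborel)
           \<le> ennreal (Ds s)" for Ds
      unfolding a1_def[abs_def] by (rule hold[OF wave_eigen_pos smw that])
    show "pair a1 t \<ge> \<epsilon> * (LINT x:cball 0 R|lborel. f x * wave_eigen x)
        / wave_weight (- (\<mu> / 2)) ((3 + \<mu> / 2)\<^sup>2) (2 + \<mu> / 2) * (exp t * (1 + t) powr (- (\<mu> / 2)))"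
      if t: "t \<in> {2 + \<mu> / 2..E}" for t
      unfolding M0_def[symmetric] G0[symmetric] b_def[symmetric]
    proof (rule wave_growth[where G' = "pair' a1" and E = E])
      show "pair a1 0 > 0" using G0 \<epsilon> c0 by (simp add: M0_def)
      show "(1 + t) powr (2 * b) * pair' a1 t - pair' a1 0 \<ge> (LINT s:{0..t}|lborel. (1 + s) powr (2 * b) * pair a1 s)"
        if "t \<in> {0..E}" for t
        unfolding b2 using Gid[OF that] set_integral_nonneg_on[of "{0..t}" "\<lambda>s. (1 + s) powr \<mu> * pw a1 s"] pwnn ann
        by simp
      show "wave_weight b ((3 + b)\<^sup>2) t * pair' a1 t - wave_weight b ((3 + b)\<^sup>2) s * pair' a1 s \<ge>
         (LINT r:{s..t}|lborel. (1 - b / (1 + r) - (3 + b)\<^sup>2 / (1 + r)\<^sup>2) * wave_weight b ((3 + b)\<^sup>2) r * pair' a1 r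
            + wave_weight b ((3 + b)\<^sup>2) r * pair a1 r)"
        if "0 \<le> s" "s \<le> t" "t \<le> E" for s t
        using ii[OF that] unfolding h_def l_def c_def b_def by simp
    qed (use t \<mu> der cont ta F'0 ann in \<open>auto simp: b_def\<close>)
  qed
qed

text \<open>The initial data enter the constants only through the moment M0, whose positivity rests
  on f being supported in the ball of radius R. This follows from the existence of a single
  solution; if there is none, the claim is vacuous, and the case split on \<open>M0 > 0\<close>
  separates the two situations before \<open>C\<close> is chosen.\<close>

theorem lifespan_estimate:
  fixes f g :: "'a::euclidean_space \<Rightarrow> real"
  assumes dim: "DIM('a) \<ge> 2" and \<mu>: "\<mu> > 0" and p: "1 < p" "p < strauss_exponent (real DIM('a) + \<mu>)"
    and f: "f \<in> L2" and f0: "AE x in lborel. f x \<ge> 0" and g0: "AE x in lborel. g x \<ge> 0"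
    and fn: "\<not> (AE x in lborel. f x = 0)" and R: "R \<ge> 1"
  shows "\<exists>C>0. \<forall>\<epsilon> T u. 0 < \<epsilon> \<longrightarrow> \<epsilon> \<le> 1 \<longrightarrow> 0 < T \<longrightarrow> energy_solution \<mu> p \<epsilon> f g T u \<longrightarrow>
       ess_support (space_time T) u \<subseteq> {(x, t). (x, t) \<in> space_time T \<and> norm x \<le> t + R} \<longrightarrow>
       T \<le> ereal (C * \<epsilon> powr (- 2 * p * (p - 1) / strauss_gamma p (real DIM('a) + \<mu>)))"
proof -
  define N where "N = real DIM('a)"
  define M0 where "M0 = (LINT x:cball 0 R|lborel. f x * wave_eigen x)"
  have M0: "M0 > 0" if \<epsilon>: "\<epsilon> > 0" and "0 < T" and sol: "energy_solution \<mu> p \<epsilon> f g T u"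
    and supp: "ess_support (space_time T) u \<subseteq> {(x, t). (x, t) \<in> space_time T \<and> norm x \<le> t + R}"
    for \<epsilon> T and u :: "'a \<times> real \<Rightarrow> real"
  proof -
    obtain ut where D: "C1_L2_deriv (time_interval T) (\<lambda>t x. u (x, t)) ut"
      and u0: "AE x in lborel. u (x, 0) = \<epsilon> * f x"
      using sol by (rule energy_solutionE)
    have "AE x in lborel. norm x > 0 + R \<longrightarrow> u (x, 0) = 0"
      by (rule support_slices(1)[OF D supp time_interval_0[OF \<open>0 < T\<close>]])
    with u0 have "AE x in lborel. norm x > R \<longrightarrow> f x = 0"
      by eventually_elim (use \<epsilon> in auto)
    then show ?thesis unfolding M0_def by (rule initial_moment_pos[OF f f0 fn])
  qed
  show ?thesis
  proof (cases "M0 > 0")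
    case False
    then show ?thesis using M0 by (intro exI[of _ 1]) auto
  next
    case True
    define q where "q = p / (p - 1)"
    have q: "q > 0" "q * (1 - p) = - p" using p by (auto simp: q_def field_simps)
    define \<beta> where "\<beta> = N - 1 - (N - 1) * q / 2"
    obtain C3 where C3: "C3 > 0" and we: "\<And>\<rho>. \<rho> \<ge> 0 \<Longrightarrow>
        (\<integral>\<^sup>+(x::'a). ennreal (wave_eigen x powr q) * indicator (cball 0 \<rho>) x \<partial>lborel)
          \<le> ennreal (C3 * (1 + \<rho>) powr \<beta> * exp (q * \<rho>))"
      by (rule wave_eigen_Lq_norm[where 'a = 'a, OF q(1), folded N_def, folded \<beta>_def]) (rule that; blast)
    define V where "V = unit_ball_vol N * R powr N"
    have V: "V > 0" using R by (simp add: V_def N_def)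
    define c4 where "c4 = M0 / wave_weight (- (\<mu> / 2)) ((3 + \<mu> / 2)\<^sup>2) (2 + \<mu> / 2)"
    have c4: "c4 > 0" unfolding c4_def using True \<mu> by (intro divide_pos_pos wave_weight_pos) auto
    \<comment> \<open>The power of the radius that the L^q norm of the eigenfunction contributes
      once it is raised to 1 - p in the Hoelder bound.\<close>
    define \<alpha> where "\<alpha> = \<beta> * (1 - p)"
    have \<alpha>: "\<alpha> = (N - 1) * (1 - p) + (N - 1) * p / 2"
    proof -
      have "\<alpha> = (N - 1) * (1 - p) - (N - 1) / 2 * (q * (1 - p))" by (simp add: \<alpha>_def \<beta>_def algebra_simps)
      then show ?thesis unfolding q by simp
    qed
    define C1 where "C1 = V powr (1 - p)"
    \<comment> \<open>The last two factors pay for replacing s + R by s, in the exponential and in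
      the power.\<close>
    define C2 where "C2 = c4 powr p * C3 powr (1 - p) * exp (- p * R) * (1 + R) powr (- \<bar>\<alpha>\<bar>)"
    have C12: "C1 > 0" "C2 > 0" using V c4 C3 R by (auto simp: C1_def C2_def)
    have N2: "N \<ge> 2" using dim by (simp add: N_def)
    have \<gamma>: "strauss_gamma p (N + \<mu>) > 0"
      using p \<mu> N2 by (intro strauss_gamma_pos) (auto simp: N_def)
    have nn: "N \<ge> 0" "2 + \<mu> / 2 \<ge> 0" using N2 \<mu> by auto
    obtain C where C: "C > 0" and life:
      "\<And>E \<epsilon> F F' K. \<lbrakk>E > 0; 0 < \<epsilon>; \<epsilon> \<le> 1; damped_equation \<mu> E F F' K;
      AE s in lborel. s \<in> {0..E} \<longrightarrow> F s \<ge> 0 \<longrightarrow> K s \<ge> C1 * (1 + s) powr (- N * (p - 1)) * F s powr p;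
      AE s in lborel. s \<in> {2 + \<mu> / 2..E} \<longrightarrow> K s \<ge> C2 * \<epsilon> powr p * (1 + s) powr (N - 1 - (N + \<mu> - 1) * p / 2)\<rbrakk>
      \<Longrightarrow> E \<le> C * \<epsilon> powr (- 2 * p * (p - 1) / strauss_gamma p (N + \<mu>))"
      by (rule lifespan_bound[OF p(1) less_imp_le[OF \<mu>] nn(1) C12 nn(2) \<gamma>])
         (rule that; blast)
    have "T \<le> ereal (C * \<epsilon> powr (- 2 * p * (p - 1) / strauss_gamma p (N + \<mu>)))"
      if \<epsilon>: "0 < \<epsilon>" "\<epsilon> \<le> 1" and "0 < T" and sol: "energy_solution \<mu> p \<epsilon> f g T u"
        and supp: "ess_support (space_time T) u \<subseteq> {(x, t). (x, t) \<in> space_time T \<and> norm x \<le> t + R}"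
      for \<epsilon> T and u :: "'a \<times> real \<Rightarrow> real"
    proof (rule ccontr)
      define Y where "Y = C * \<epsilon> powr (- 2 * p * (p - 1) / strauss_gamma p (N + \<mu>))"
      assume "\<not> ?thesis"
      then have "ereal Y < T" by (simp add: Y_def)
      \<comment> \<open>A finite time beyond the claimed bound at which the solution still exists,
        also when T is infinite.\<close>
      then obtain E where E: "Y < E" "ereal E < T" using ereal_dense2[of "ereal Y" T] by auto
      have "Y > 0" using C \<epsilon> by (simp add: Y_def)
      then have EI: "E \<in> time_interval T" "E > 0" using E by (auto simp: time_interval_def)
      show False
      proof (rule energy_solution_lower_bounds[OF p(1) \<mu> R \<epsilon>(1) f f0 g0 True[unfolded M0_def] sol supp EI,
            folded M0_def])
        fix F F' K G
        assume F: "damped_equation \<mu> E F F' K"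
        and K1: "\<And>D. (\<And>s. s \<ge> 0 \<Longrightarrow> D s > 0) \<Longrightarrow>
           (\<And>s. s \<ge> 0 \<Longrightarrow> emeasure lborel (cball (0::'a) (s + R)) \<le> ennreal (D s)) \<Longrightarrow>
           AE s in lborel. s \<in> {0..E} \<longrightarrow> F s \<ge> 0 \<longrightarrow> K s \<ge> F s powr p * D s powr (1 - p)"
        and K2: "\<And>D. (\<And>s. s \<ge> 0 \<Longrightarrow> D s > 0) \<Longrightarrow>
           (\<And>s. s \<ge> 0 \<Longrightarrow> (\<integral>\<^sup>+x. ennreal (wave_eigen x powr (p / (p - 1))) * indicator (cball (0::'a) (s + R)) x \<partial>lborel)
               \<le> ennreal (D s)) \<Longrightarrow>
           AE s in lborel. s \<in> {0..E} \<longrightarrow> G s \<ge> 0 \<longrightarrow> K s \<ge> G s powr p * D s powr (1 - p)"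
        and G: "\<And>t. t \<in> {2 + \<mu> / 2..E} \<Longrightarrow> G t \<ge> \<epsilon> * M0
            / wave_weight (- (\<mu> / 2)) ((3 + \<mu> / 2)\<^sup>2) (2 + \<mu> / 2) * (exp t * (1 + t) powr (- (\<mu> / 2)))"
      have "AE s in lborel. s \<in> {0..E} \<longrightarrow> F s \<ge> 0 \<longrightarrow> K s \<ge> F s powr p * (V * (1 + s) powr N) powr (1 - p)"
      proof (rule K1)
        fix s :: real assume s: "s \<ge> 0"
        show "V * (1 + s) powr N > 0" using V s by simp
        have "s + R \<le> R * (1 + s)" using R s mult_right_mono[of 1 R s] by (simp add: algebra_simps)
        then have "(s + R) powr N \<le> (R * (1 + s)) powr N" using s R N2 by (intro powr_mono2) auto
        also have "\<dots> = R powr N * (1 + s) powr N" using s R by (simp add: powr_mult)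
        finally have "unit_ball_vol N * (s + R) powr N \<le> V * (1 + s) powr N"
          unfolding V_def mult.assoc by (intro mult_left_mono) (auto simp: N_def)
        moreover have "emeasure lborel (cball (0::'a) (s + R)) = ennreal (unit_ball_vol N * (s + R) powr N)"
          using s R by (simp add: emeasure_cball N_def powr_realpow)
        ultimately show "emeasure lborel (cball (0::'a) (s + R)) \<le> ennreal (V * (1 + s) powr N)"
          by (simp add: ennreal_leI)
      qed
      then have k1: "AE s in lborel. s \<in> {0..E} \<longrightarrow> F s \<ge> 0 \<longrightarrow> K s \<ge> C1 * (1 + s) powr (- N * (p - 1)) * F s powr p"
      proof eventually_elim
        case (elim s)
        have "(V * (1 + s) powr N) powr (1 - p) = C1 * (1 + s) powr (- N * (p - 1))" if "s \<ge> 0"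
          using that V by (simp add: powr_mult powr_powr C1_def algebra_simps)
        then show ?case using elim by (simp add: mult.commute)
      qed
      have "AE s in lborel. s \<in> {0..E} \<longrightarrow> G s \<ge> 0 \<longrightarrow>
          K s \<ge> G s powr p * (C3 * (1 + (s + R)) powr \<beta> * exp (q * (s + R))) powr (1 - p)"
        using C3 R we[of "s + R" for s] by (intro K2) (auto simp: q_def)
      then have k2: "AE s in lborel. s \<in> {2 + \<mu> / 2..E} \<longrightarrow> K s \<ge> C2 * \<epsilon> powr p * (1 + s) powr (N - 1 - (N + \<mu> - 1) * p / 2)"
      proof eventually_elim
        case (elim s)
        show ?case
        proof
          assume s: "s \<in> {2 + \<mu> / 2..E}"
          have s0: "s \<ge> 0" "s \<in> {0..E}" using s \<mu> by auto
          have Gs: "G s \<ge> c4 * \<epsilon> * (exp s * (1 + s) powr (- (\<mu> / 2)))"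
            using G[OF s] by (simp add: c4_def mult_ac)
          have pos: "c4 * \<epsilon> * (exp s * (1 + s) powr (- (\<mu> / 2))) > 0" using c4 \<epsilon> s0 by simp
          have A: "(1 + (s + R)) powr \<alpha> \<ge> (1 + R) powr (- \<bar>\<alpha>\<bar>) * (1 + s) powr \<alpha>"
          proof (cases "\<alpha> \<ge> 0")
            case True
            have "(1 + R) powr (- \<bar>\<alpha>\<bar>) * (1 + s) powr \<alpha> \<le> 1 * (1 + s) powr \<alpha>"
              using R by (intro mult_right_mono) (auto simp: powr_minus inverse_le_1_iff ge_one_powr_ge_zero)
            also have "\<dots> \<le> (1 + (s + R)) powr \<alpha>" using True R s0 by (simp add: powr_mono2)
            finally show ?thesis .
          next
            case False
            have "(1 + R) powr (- \<bar>\<alpha>\<bar>) * (1 + s) powr \<alpha> = ((1 + R) * (1 + s)) powr \<alpha>"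
              using False R s0 by (simp add: powr_mult)
            also have "\<dots> \<le> (1 + (s + R)) powr \<alpha>"
              using False R s0 by (intro powr_mono2') (auto simp: algebra_simps)
            finally show ?thesis .
          qed
          have e1: "(C3 * (1 + (s + R)) powr \<beta> * exp (q * (s + R))) powr (1 - p)
             = C3 powr (1 - p) * (1 + (s + R)) powr \<alpha> * (exp (- p * R) * exp (- p * s))"
          proof -
            have "exp (q * (s + R)) powr (1 - p) = exp ((q * (1 - p)) * (s + R))"
              by (simp add: exp_powr_real mult_ac)
            also have "\<dots> = exp (- p * R) * exp (- p * s)"
              unfolding q exp_add[symmetric] by (simp add: algebra_simps)
            finally have "exp (q * (s + R)) powr (1 - p) = exp (- p * R) * exp (- p * s)" .
            then show ?thesis using C3 s0 R by (simp add: powr_mult powr_powr \<alpha>_def)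
          qed
          have e2: "(c4 * \<epsilon> * (exp s * (1 + s) powr (- (\<mu> / 2)))) powr p
             = c4 powr p * \<epsilon> powr p * (exp (p * s) * (1 + s) powr (- (\<mu> / 2) * p))"
            using c4 \<epsilon> s0 by (simp add: powr_mult powr_powr exp_powr_real mult_ac)
          \<comment> \<open>The factor (1 + s)^(-\<mu>/2) in the bound for G, raised to the power p,
            is what shifts N to N + \<mu>.\<close>
          have e3: "N - 1 - (N + \<mu> - 1) * p / 2 = - (\<mu> / 2) * p + \<alpha>"
            unfolding \<alpha> by (simp add: field_simps)
          have "C2 * \<epsilon> powr p * (1 + s) powr (N - 1 - (N + \<mu> - 1) * p / 2)
             = (c4 powr p * \<epsilon> powr p * (exp (p * s) * (1 + s) powr (- (\<mu> / 2) * p))) *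
               (C3 powr (1 - p) * ((1 + R) powr (- \<bar>\<alpha>\<bar>) * (1 + s) powr \<alpha>) * (exp (- p * R) * exp (- p * s)))"
          proof -
            \<comment> \<open>The exponential growth of G^p cancels exactly against that of the L^q
              norm, because q (1 - p) = -p; only powers of 1 + s survive.\<close>
            have e0: "exp (p * s) * exp (- p * s) = 1" by (simp add: exp_add[symmetric])
            have "(c4 powr p * \<epsilon> powr p * (exp (p * s) * (1 + s) powr (- (\<mu> / 2) * p))) *
               (C3 powr (1 - p) * ((1 + R) powr (- \<bar>\<alpha>\<bar>) * (1 + s) powr \<alpha>) * (exp (- p * R) * exp (- p * s)))
               = c4 powr p * \<epsilon> powr p * (1 + s) powr (- (\<mu> / 2) * p) * C3 powr (1 - p) *
                 (1 + R) powr (- \<bar>\<alpha>\<bar>) * (1 + s) powr \<alpha> * exp (- p * R) * (exp (p * s) * exp (- p * s))"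
              by (simp only: mult_ac)
            also have "\<dots> = C2 * \<epsilon> powr p * ((1 + s) powr (- (\<mu> / 2) * p) * (1 + s) powr \<alpha>)"
              unfolding e0 C2_def by (simp only: mult_ac mult_1_right)
            finally show ?thesis unfolding e3 powr_add by (rule sym)
          qed
          also have "\<dots> \<le> (c4 powr p * \<epsilon> powr p * (exp (p * s) * (1 + s) powr (- (\<mu> / 2) * p))) *
               (C3 powr (1 - p) * (1 + (s + R)) powr \<alpha> * (exp (- p * R) * exp (- p * s)))"
            by (intro mult_left_mono mult_right_mono A) auto
          also have "\<dots> \<le> G s powr p * (C3 * (1 + (s + R)) powr \<beta> * exp (q * (s + R))) powr (1 - p)"
            unfolding e1 e2[symmetric] using Gs pos p by (intro mult_right_mono powr_mono2) auto
          also have "\<dots> \<le> K s" using elim s0 Gs pos by simp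
          finally show "C2 * \<epsilon> powr p * (1 + s) powr (N - 1 - (N + \<mu> - 1) * p / 2) \<le> K s" .
        qed
      qed
      have "E \<le> Y" unfolding Y_def by (rule life[OF EI(2) \<epsilon> F k1 k2])
      then show False using E by simp
      qed
    qed
    then show ?thesis using C unfolding N_def by blast
  qed
qed

theorem theorem1p2:
  fixes f g :: "real ^ 'n \<Rightarrow> real" and \<mu> p R :: real
  assumes "CARD('n) \<ge> 2"
    and "\<mu> > 0"
    and "1 < p" and "p < strauss_exponent (real CARD('n) + \<mu>)"
    and "f \<in> H1" and "g \<in> L2"
    and "AE x in lborel. f x \<ge> 0" and "AE x in lborel. g x \<ge> 0"
    and "\<not> (AE x in lborel. f x = 0)" and "\<not> (AE x in lborel. g x = 0)"
    and "R \<ge> 1"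
  shows "\<exists>\<epsilon>\<^sub>0>0. \<exists>C>0. \<forall>\<epsilon>. 0 < \<epsilon> \<and> \<epsilon> \<le> \<epsilon>\<^sub>0 \<longrightarrow>
    (\<forall>(T::ereal) (u :: (real ^ 'n) \<times> real \<Rightarrow> real).
       0 < T \<longrightarrow>
       energy_solution \<mu> p \<epsilon> f g T u \<longrightarrow>
       ess_support (space_time T) u \<subseteq> {(x, t). (x, t) \<in> space_time T \<and> norm x \<le> t + R} \<longrightarrow>
       T \<le> ereal (C * \<epsilon> powr (- 2 * p * (p - 1) / strauss_gamma p (real CARD('n) + \<mu>))))"
proof -
  have D: "DIM(real ^ 'n) = CARD('n)" by simp
  have "f \<in> L2" using assms(5) by (simp add: H1_def)
  from lifespan_estimate[where 'a = "real ^ 'n", unfolded D, OF assms(1-4) this assms(7,8,9,11)]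
  show ?thesis by (intro exI[of _ "1::real"]) (auto simp: less_imp_le)
qed

end
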